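(* Let $\mu(n)=\frac{\pi\sqrt{24n-1}}{6}$ and, for $k\in\{0,1\}$, let \[Y_k(n)=\frac{M_k(n-1)M_k(n+1)}{M_k(n)^2}.\] For $k=0$ or $1$ and every positive integer $n$ with $\mu(n)\geq 115$, \[Y_k(n)<1-\frac{\pi^4}{9\mu(n)^3}+\frac{4\pi^4}{9\mu(n)^4}-\frac{\pi^4}{3\mu(n)^5}+\frac{\frac{\pi^8}{81}+5}{\mu(n)^6}\] and \[Y_k(n)>1-\frac{\pi^4}{9\mu(n)^3}+\frac{4\pi^4}{9\mu(n)^4}-\frac{\pi^4}{3\mu(n)^5}-\frac{60}{\mu(n)^6}.\]
   Context: For a partition $\lambda$ of a positive integer, let $\omega(\lambda)$ be the number of parts equal to $1$ and let $\nu(\lambda)$ be the number of parts of $\lambda$ strictly larger than $\omega(\lambda)$. The crank of $\lambda$ is its largest part if $\omega(\lambda)=0$, and $\nu(\lambda)-\omega(\lambda)$ if $\omega(\lambda)>0$. For $n\geq 0$, $M_0(n)$ (resp. $M_1(n)$) denotes the number of partitions of $n$ with even (resp. odd) crank. *)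

theory Defs
  imports Complex_Main "HOL-Library.Multiset"
begin

definition partitions :: "nat \<Rightarrow> nat multiset set" where
  "partitions n = {l. 0 \<notin># l \<and> sum_mset l = n}"

lemma finite_partitions: "finite (partitions n)"
proof (induction n rule: less_induct)
  case (less n)
  have "partitions n \<subseteq> insert {#} (\<Union>k\<in>{1..n}. add_mset k ` partitions (n - k))"
  proof
    fix l assume l: "l \<in> partitions n"
    show "l \<in> insert {#} (\<Union>k\<in>{1..n}. add_mset k ` partitions (n - k))"
    proof (cases l)
      case empty
      then show ?thesis by simp
    next
      case (add k l')
      then have "k \<in> {1..n}" "l' \<in> partitions (n - k)"
        using l by (auto simp: partitions_def)
      then show ?thesis using add by blast
    qed
  qed
  moreover have "finite (insert {#} (\<Union>k\<in>{1..n}. add_mset k ` partitions (n - k)))"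
    using less.IH by auto
  ultimately show ?case by (rule finite_subset)
qed

definition num_ones :: "nat multiset \<Rightarrow> nat" where
  "num_ones l = count l 1"

definition num_large :: "nat multiset \<Rightarrow> nat" where
  "num_large l = size {#x \<in># l. x > num_ones l#}"

(* The crank is usually defined only for partitions of positive integers; the empty
   partition (of 0) is assigned crank 0 here. *)
definition crank :: "nat multiset \<Rightarrow> int" where
  "crank l =
     (if l = {#} then 0
      else if num_ones l = 0 then int (Max_mset l)
      else int (num_large l) - int (num_ones l))"

(* Since mod 2 takes values in {0, 1} on all of int, k = 0 selects even crank and
   k = 1 selects odd crank. *)
definition M :: "nat \<Rightarrow> nat \<Rightarrow> nat" where
  "M k n = card {l \<in> partitions n. crank l mod 2 = int k}"

definition \<mu> :: "nat \<Rightarrow> real" where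
  "\<mu> n = pi * sqrt (24 * real n - 1) / 6"

(* Only meant for n \<ge> 1, as n - 1 is truncated subtraction. *)
definition Y :: "nat \<Rightarrow> nat \<Rightarrow> real" where
  "Y k n = real (M k (n - 1)) * real (M k (n + 1)) / (real (M k n))\<^sup>2"

end

theory Submission
  imports
    Defs
    "HOL-Complex_Analysis.Complex_Analysis"
    "HOL-Probability.Probability"
begin

text \<open>
  The numbers \<open>M\<^sub>0(n)\<close> and \<open>M\<^sub>1(n)\<close> have sum \<open>p(n)\<close> and difference \<open>c(n)\<close>, the number of partitions
  counted with the sign of the crank parity. The generating function of \<open>c(n)\<close> is, up to the anomaly at
  \<open>n = 1\<close>, the product of Gauss' theta series \<open>\<Sum> (-1)\<^sup>s q\<^sup>s\<^sup>2\<close> and \<open>\<Prod> (1 - q\<^sup>2\<^sup>i\<^sup>-\<^sup>1)\<close>; as the first factor is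
  sparse and bounded, \<open>c(n)\<close> is at most of size \<open>exp (sqrt (2n))\<close>, exponentially smaller than \<open>p(n)\<close>.

  For \<open>p(n)\<close> a single major arc of the circle method suffices. There the modular transformation of the
  generating function replaces it by an elementary function, and the resulting integral has an
  antiderivative in terms of the primitive of \<open>exp (w\<^sup>2)\<close>, so that no contour has to be moved. On the minor
  arc the trivial bound already saves \<open>exp (- 3\<mu>/\<pi>\<^sup>2)\<close>. The result is
  \<open>p(n) = \<pi>\<^sup>2/(6 sqrt 3) exp \<mu> (1 - 1/\<mu>) / \<mu>\<^sup>2\<close> with relative error at most \<open>13/\<mu>\<^sup>6\<close>.

  Inserting this into \<open>Y\<^sub>k\<close>, with \<open>\<mu>(n \<plusminus> 1)\<^sup>2 = \<mu>(n)\<^sup>2 \<plusminus> 2\<pi>\<^sup>2/3\<close>, the ratio of the main terms has the stated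
  expansion with sixth coefficient about \<open>15\<close>, and the accumulated errors are below \<open>57/\<mu>\<^sup>6\<close>.
\<close>

section \<open>The modular transformation of the partition generating function\<close>

text \<open>The modular formula rests on a double series over \<open>k\<close> and \<open>m\<close>
  that converges only conditionally. Cut to a square it is symmetric under exchanging
  \<open>c\<close> and \<open>1 / c\<close>, and the part outside the square produces the logarithm
  that becomes the square root factor. The formula is proved for real arguments and continued after
  exponentiation, so that no branch of a logarithm has to be followed. One inequality governs the
  explicit constants. Relative to the main term, of size exp(x)/x^2 with x = \<mu> n, the minor arc
  contributes at most a multiple of x^2 exp(-0.2934 x), which has to stay below 13/x^6; at the left
  end of the range this is tight. All other errors are exponentially smaller. The range starts at
  114.9 instead of 115 because the asymptotics are also applied at n - 1. The identities for the
  crank parity are congruences between finite products modulo q^(N+1), where N is the index of the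
  coefficient that is wanted.\<close>

lemma sinh_product_formula_real:
  fixes x :: real
  assumes "x \<noteq> 0"
  shows "(\<lambda>n. \<Prod>k=1..n. 1 + x\<^sup>2 / (real k)\<^sup>2) \<longlonglongrightarrow> sinh (pi * x) / (pi * x)"
proof -
  have sin_eq: "sin (of_real pi * (\<i> * of_real x)) = \<i> * of_real (sinh (pi * x))"
  proof -
    have "sin (\<i> * of_real (pi * x)) = \<i> * of_real (sinh (pi * x))"
      by (simp add: sin_i_times sinh_def sinh_field_def exp_of_real scaleR_conv_of_real exp_minus flip: of_real_mult of_real_minus)
    thus ?thesis by (simp add: mult_ac)
  qed
  have "(\<lambda>n. of_real pi * (\<i> * of_real x) * (\<Prod>k=1..n. 1 - (\<i> * of_real x)^2 / of_nat k^2))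
          \<longlonglongrightarrow> sin (of_real pi * (\<i> * of_real x))"
    by (rule sin_product_formula_complex)
  also have "(\<lambda>n. of_real pi * (\<i> * of_real x) * (\<Prod>k=1..n. 1 - (\<i> * of_real x)^2 / of_nat k^2)) =
        (\<lambda>n. \<i> * of_real (pi * x * (\<Prod>k=1..n. 1 + x\<^sup>2 / (real k)\<^sup>2)))"
    by (simp add: power_mult_distrib mult_ac)
  finally have "(\<lambda>n. \<i> * complex_of_real (pi * x * (\<Prod>k=1..n. 1 + x\<^sup>2 / (real k)\<^sup>2)))
     \<longlonglongrightarrow> \<i> * of_real (sinh (pi * x))" unfolding sin_eq .
  from tendsto_mult[OF tendsto_const[of "-\<i>"] this]
  have "(\<lambda>n. complex_of_real (pi * x * (\<Prod>k=1..n. 1 + x\<^sup>2 / (real k)\<^sup>2)))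
     \<longlonglongrightarrow> of_real (sinh (pi * x))" by (simp only: mult.assoc[symmetric]) simp
  hence "(\<lambda>n. pi * x * (\<Prod>k=1..n. 1 + x\<^sup>2 / (real k)\<^sup>2)) \<longlonglongrightarrow> sinh (pi * x)"
    by (subst (asm) tendsto_of_real_iff)
  from tendsto_divide[OF this tendsto_const[of "pi * x"]] assms show ?thesis by simp
qed

text \<open>Logarithmic derivative of the product for sinh. Termwise differentiation is done on the
  bounded interval \<open>S\<close>, where the derivatives have a summable majorant; this is why
  \<open>S\<close> stops at \<open>x + 1\<close>.\<close>

lemma coth_partial_fractions:
  fixes x :: real
  assumes "x > 0"
  shows "(\<lambda>k. 2 * x / ((real (Suc k))\<^sup>2 + x\<^sup>2)) sums (pi * cosh (pi * x) / sinh (pi * x) - 1 / x)"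
proof -
  define f where "f = (\<lambda>k y::real. ln (1 + y\<^sup>2 / (real (Suc k))\<^sup>2))"
  define f' where "f' = (\<lambda>k y::real. 2 * y / ((real (Suc k))\<^sup>2 + y\<^sup>2))"
  define S where "S = {0<..<x+1}"
  have summ: "summable (\<lambda>k. 2 * (x+1) / (real (Suc k))\<^sup>2)"
    using summable_mult[OF inverse_squares_sums[THEN sums_summable], of "2*(x+1)"]
    by (simp add: add_ac)
  have f'_bound: "norm (f' k y) \<le> 2 * (x+1) / (real (Suc k))\<^sup>2" if "y \<in> S" for k y
    unfolding f'_def using that assms
    by (auto simp: S_def intro!: frac_le mult_mono add_nonneg_nonneg)
  have sums: "(\<lambda>k. f k y) sums ln (sinh (pi * y) / (pi * y))" if "y \<in> S" for y
  proof -
    have y: "y > 0" using that by (auto simp: S_def)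
    have "(\<lambda>n. ln (\<Prod>k=1..n. 1 + y\<^sup>2 / (real k)\<^sup>2)) \<longlonglongrightarrow> ln (sinh (pi * y) / (pi * y))"
      using y by (intro tendsto_ln sinh_product_formula_real) auto
    also have "(\<lambda>n. ln (\<Prod>k=1..n. 1 + y\<^sup>2 / (real k)\<^sup>2)) = (\<lambda>n. \<Sum>k<n. f k y)"
    proof
      fix n
      have "ln (\<Prod>k=1..n. 1 + y\<^sup>2 / (real k)\<^sup>2) = (\<Sum>k=1..n. ln (1 + y\<^sup>2 / (real k)\<^sup>2))"
        by (subst ln_prod) (auto intro!: add_pos_nonneg simp: add_nonneg_eq_0_iff)
      also have "\<dots> = (\<Sum>k<n. f k y)"
        unfolding f_def by (rule sum.reindex_bij_witness[of _ Suc "\<lambda>k. k - 1"]) auto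
      finally show "ln (\<Prod>k=1..n. 1 + y\<^sup>2 / (real k)\<^sup>2) = (\<Sum>k<n. f k y)" .
    qed
    finally show ?thesis unfolding sums_def .
  qed
  have xS: "x \<in> S" using assms by (auto simp: S_def)
  have deriv: "((\<lambda>y. \<Sum>k. f k y) has_field_derivative (\<Sum>k. f' k x)) (at x)"
  proof (rule has_field_derivative_series'(2))
    show "convex S" by (simp add: S_def)
    show "(f k has_field_derivative f' k y) (at y within S)" if "y \<in> S" for k y
    proof -
      have "1 + y\<^sup>2 / (real (Suc k))\<^sup>2 > 0" by (intro add_pos_nonneg) auto
      moreover have "(real (Suc k))\<^sup>2 + y\<^sup>2 \<noteq> 0" using that by (auto simp: add_nonneg_eq_0_iff)
      ultimately show ?thesis
        unfolding f_def f'_def by (auto intro!: derivative_eq_intros simp del: of_nat_Suc simp: divide_simps)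
    qed
    show "uniformly_convergent_on S (\<lambda>n y. \<Sum>k<n. f' k y)"
      using f'_bound summ by (rule Weierstrass_m_test')
    show "x \<in> S" by fact
    show "summable (\<lambda>n. f n x)" using sums[OF xS] by (rule sums_summable)
    show "x \<in> interior S" using xS by (simp add: S_def interior_open)
  qed
  have "((\<lambda>y. ln (sinh (pi * y) / (pi * y))) has_field_derivative (pi * cosh (pi * x) / sinh (pi * x) - 1 / x)) (at x)"
    using assms by (auto intro!: derivative_eq_intros simp: field_simps)
  hence "((\<lambda>y. \<Sum>k. f k y) has_field_derivative (pi * cosh (pi * x) / sinh (pi * x) - 1 / x)) (at x)"
    by (rule has_field_derivative_transform_within_open[of _ _ _ S])
      (use xS sums in \<open>auto simp: S_def sums_iff\<close>)
  with deriv have "(\<Sum>k. f' k x) = pi * cosh (pi * x) / sinh (pi * x) - 1 / x" by (rule DERIV_unique)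
  moreover have "summable (\<lambda>k. f' k x)"
    by (rule summable_comparison_test'[OF summ]) (rule f'_bound[OF xS])
  ultimately show ?thesis by (auto simp: f'_def sums_iff)
qed

text \<open>It turns every term of the series \<open>log_euler\<close> below into a sum over a
  second index, so that the logarithm of the generating function becomes a lattice sum.\<close>

lemma inverse_exp_minus_one_partial_fractions:
  fixes x :: real
  assumes "x > 0"
  shows "(\<lambda>k. x / ((real (Suc k))\<^sup>2 + x\<^sup>2) / pi) sums (1 / (exp (2 * pi * x) - 1) - 1 / (2 * pi * x) + 1 / 2)"
proof -
  have "exp (pi * x) > 1" using assms by simp
  hence e: "exp (pi * x) * exp (pi * x) > 1" by (simp add: less_1_mult)
  have "(pi * cosh (pi * x) / sinh (pi * x) - 1 / x) / (2 * pi) =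
        1 / (exp (2 * pi * x) - 1) - 1 / (2 * pi * x) + 1 / 2"
  proof -
    define E where "E = exp (pi * x)"
    have E: "E > 1" "E * E > 1" using e assms by (auto simp: E_def)
    have "cosh (pi * x) = (E + 1 / E) / 2" "sinh (pi * x) = (E - 1 / E) / 2" "exp (2 * pi * x) = E * E"
      by (simp_all add: E_def cosh_def sinh_def exp_minus field_simps flip: exp_add)
    moreover have "(E + 1 / E) / 2 / ((E - 1 / E) / 2) = 2 / (E * E - 1) + 1"
      using E by (simp add: divide_simps)
    ultimately have "cosh (pi * x) / sinh (pi * x) = 2 / (exp (2 * pi * x) - 1) + 1" by metis
    hence "pi * cosh (pi * x) / sinh (pi * x) = pi * (2 / (exp (2 * pi * x) - 1) + 1)"
      by (metis times_divide_eq_right)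
    moreover have "(2 / (Z - 1) + 1) / 2 = 1 / (Z - 1) + 1 / 2" for Z :: real
      by (cases "Z = 1") (simp_all add: field_simps)
    ultimately show ?thesis by (simp add: diff_divide_distrib mult.commute)
  qed
  moreover have "2 * x / ((real (Suc k))\<^sup>2 + x\<^sup>2) / (2 * pi) = x / ((real (Suc k))\<^sup>2 + x\<^sup>2) / pi" for k
    by simp
  ultimately show ?thesis
    using sums_divide[OF coth_partial_fractions[OF assms], of "2 * pi"] by (simp only:)
qed


text \<open>The Lambert series of the logarithm of the product of 1/(1 - q^i) at q = exp(-t), with
  the sum over i carried out. It contains no complex logarithm. The type is left open to have the
  real and the complex function under one name.\<close>

definition log_euler :: "'a \<Rightarrow> 'a :: {real_normed_field, banach}" where
  "log_euler t = (\<Sum>k. 1 / (of_nat (Suc k) * (exp (of_nat (Suc k) * t) - 1)))"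

lemma norm_exp_minus_one_ge:
  fixes z :: complex
  shows "norm (exp z - 1) \<ge> exp (Re z) - 1"
  using norm_triangle_ineq2[of "exp z" 1] by (simp add: norm_exp_eq_Re)

text \<open>The majorant sees \<open>t\<close> only through a lower bound for its real part, which
  makes the convergence locally uniform in the half-plane.\<close>

lemma norm_log_euler_term_le:
  fixes t :: complex
  assumes "Re t \<ge> r" "r > 0"
  shows "norm (1 / (of_nat (Suc k) * (exp (of_nat (Suc k) * t) - 1))) \<le> 1 / r * (1 / (real (Suc k))\<^sup>2)"
proof -
  have "real (Suc k) * r \<le> real (Suc k) * Re t" using assms by (intro mult_left_mono) auto
  also have "\<dots> \<le> exp (real (Suc k) * Re t) - 1" using exp_ge_add_one_self[of "real (Suc k) * Re t"] by linarith
  also have "\<dots> \<le> norm (exp (of_nat (Suc k) * t) - 1)"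
    using norm_exp_minus_one_ge[of "of_nat (Suc k) * t"] by (simp del: of_nat_Suc)
  finally have "real (Suc k) * (real (Suc k) * r) \<le> real (Suc k) * norm (exp (of_nat (Suc k) * t) - 1)"
    by (intro mult_left_mono) auto
  hence "1 / (real (Suc k) * norm (exp (of_nat (Suc k) * t) - 1)) \<le> 1 / (real (Suc k) * (real (Suc k) * r))"
    using assms by (intro divide_left_mono) (auto intro!: mult_pos_pos elim: less_le_trans[rotated])
  thus ?thesis by (simp add: norm_divide norm_mult power2_eq_square mult_ac del: of_nat_Suc)
qed

lemma log_euler_sums_complex:
  fixes t :: complex
  assumes "Re t > 0"
  shows "(\<lambda>k. 1 / (of_nat (Suc k) * (exp (of_nat (Suc k) * t) - 1))) sums log_euler t"
proof -
  have "summable (\<lambda>k. 1 / Re t * (1 / (real (Suc k))\<^sup>2))"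
    using inverse_squares_sums[THEN sums_summable] by (intro summable_mult) (simp add: add_ac)
  hence "summable (\<lambda>k. 1 / (of_nat (Suc k) * (exp (of_nat (Suc k) * t) - 1)))"
    by (rule summable_comparison_test') (rule norm_log_euler_term_le, use assms in auto)
  thus ?thesis by (simp add: log_euler_def summable_sums)
qed

lemma log_euler_sums_real:
  fixes t :: real
  assumes "t > 0"
  shows "(\<lambda>k. 1 / (real (Suc k) * (exp (real (Suc k) * t) - 1))) sums log_euler t"
    and "log_euler (complex_of_real t) = of_real (log_euler t)"
proof -
  have eq: "1 / (of_nat (Suc k) * (exp (of_nat (Suc k) * complex_of_real t) - 1)) =
        of_real (1 / (real (Suc k) * (exp (real (Suc k) * t) - 1)))" for k
    by (simp flip: exp_of_real)
  have *: "(\<lambda>k. complex_of_real (1 / (real (Suc k) * (exp (real (Suc k) * t) - 1)))) sums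
           log_euler (complex_of_real t)"
    using log_euler_sums_complex[of "of_real t"] assms unfolding eq by simp
  hence "summable (\<lambda>k. 1 / (real (Suc k) * (exp (real (Suc k) * t) - 1)))"
    using summable_Re[OF sums_summable[OF *]] by simp
  thus **: "(\<lambda>k. 1 / (real (Suc k) * (exp (real (Suc k) * t) - 1))) sums log_euler t"
    by (simp add: log_euler_def summable_sums)
  show "log_euler (complex_of_real t) = of_real (log_euler t)"
    using sums_unique2[OF * sums_of_real[OF **]] .
qed

text \<open>Comparison with the integral of a decreasing function: \<open>F\<close> is a primitive
  that vanishes at infinity, and \<open>- F (real K)\<close> is the arctangent term. The error is a
  single value of the summand, of order 1/K^2, hence still of order 1/K after summation over K
  values of \<open>k\<close>.\<close>

lemma lattice_tail:
  fixes c :: real and k K :: nat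
  assumes "c > 0" "k > 0" "K > 0"
    and "(\<lambda>m. (c / pi) / ((c * real k)\<^sup>2 + (real (Suc (m + K)))\<^sup>2)) sums s"
  shows "\<bar>s - arctan (c * real k / real K) / (pi * real k)\<bar> \<le> c / (pi * (real K)\<^sup>2)"
proof -
  define f where "f = (\<lambda>y::real. (c / pi) / ((c * real k)\<^sup>2 + y\<^sup>2))"
  define F where "F = (\<lambda>y::real. - arctan (c * real k / y) / (pi * real k))"
  have dF: "(F has_real_derivative f y) (at y)" if "y > 0" for y
  proof -
    have "0 < (c * real k)\<^sup>2 + y\<^sup>2" using that by (intro add_nonneg_pos) auto
    note pos = this
    have "(F has_real_derivative - (inverse (1 + (c * real k / y)\<^sup>2) * (- (c * real k) / y\<^sup>2)) / (pi * real k)) (at y)"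
      unfolding F_def using that by (auto intro!: derivative_eq_intros simp: power2_eq_square)
    also have "inverse (1 + (c * real k / y)\<^sup>2) * (- (c * real k) / y\<^sup>2) = - (c * real k) / ((c * real k)\<^sup>2 + y\<^sup>2)"
      using that pos by (simp add: power_divide divide_simps add.commute)
    also have "- (- (c * real k) / ((c * real k)\<^sup>2 + y\<^sup>2)) / (pi * real k) = f y"
      using assms(1-3) by (simp add: f_def)
    finally show ?thesis .
  qed
  have f_anti: "f y \<le> f x" if "0 < x" "x \<le> y" for x y
  proof -
    have "(c * real k)\<^sup>2 + x\<^sup>2 > 0" "(c * real k)\<^sup>2 + y\<^sup>2 > 0" "x\<^sup>2 \<le> y\<^sup>2"
      using that by (auto intro: add_nonneg_pos)
    thus ?thesis unfolding f_def using assms(1-3) by (intro divide_left_mono) auto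
  qed
  have step: "f (y + 1) \<le> F (y + 1) - F y" "F (y + 1) - F y \<le> f y" if "y > 0" for y
  proof -
    have "\<exists>\<xi>. y < \<xi> \<and> \<xi> < y + 1 \<and> F (y + 1) - F y = (y + 1 - y) * f \<xi>"
      by (rule MVT2) (use that dF in auto)
    then obtain \<xi> where \<xi>: "y < \<xi>" "\<xi> < y + 1" "F (y + 1) - F y = (y + 1 - y) * f \<xi>" by blast
    thus "f (y + 1) \<le> F (y + 1) - F y" "F (y + 1) - F y \<le> f y"
      using f_anti[of \<xi> "y+1"] f_anti[of y \<xi>] that by auto
  qed
  have s: "(\<lambda>n. \<Sum>m<n. f (real (Suc (m + K)))) \<longlonglongrightarrow> s"
    using assms(4) unfolding sums_def f_def .
  have F0: "(\<lambda>n. F (real (n + j))) \<longlonglongrightarrow> 0" for j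
  proof -
    have "filterlim (\<lambda>n. real (n + j)) at_top sequentially"
      by (rule filterlim_compose[OF filterlim_real_sequentially filterlim_add_const_nat_at_top])
    hence "(\<lambda>n. c * real k / real (n + j)) \<longlonglongrightarrow> 0" by (rule tendsto_divide_0[OF tendsto_const filterlim_at_top_imp_at_infinity])
    from tendsto_divide[OF tendsto_minus[OF tendsto_arctan[OF this]] tendsto_const[of "pi * real k"]]
    show ?thesis using assms(1-3) by (simp add: F_def)
  qed
  have upper: "s \<le> 0 - F (real K)"
  proof (rule LIMSEQ_le[OF s tendsto_diff[OF F0[of K] tendsto_const]], intro exI allI impI)
    show "(\<Sum>m<n. f (real (Suc (m + K)))) \<le> F (real (n + K)) - F (real K)" for n
    proof (induction n)
      case (Suc n)
      have "f (real (n + K) + 1) \<le> F (real (n + K) + 1) - F (real (n + K))" using assms(1-3) by (intro step) auto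
      thus ?case using Suc by (simp add: add_ac)
    qed auto
  qed
  \<comment> \<open>The step of the integral from K to K + 1 has no summand above it and is paid for
    by \<open>f (real K)\<close>.\<close>
  have lower: "0 - F (real K) - f (real K) \<le> s"
  proof (rule LIMSEQ_le[OF tendsto_diff[OF tendsto_diff[OF F0[of "Suc K"] tendsto_const] tendsto_const] s], intro exI allI impI)
    show "F (real (n + Suc K)) - F (real K) - f (real K) \<le> (\<Sum>m<n. f (real (Suc (m + K))))" for n
    proof (induction n)
      case 0
      thus ?case using step(2)[of "real K"] assms(1-3) by (simp add: add_ac)
    next
      case (Suc n)
      have "F (real (Suc (n + K)) + 1) - F (real (Suc (n + K))) \<le> f (real (Suc (n + K)))" using assms(1-3) by (intro step) auto
      thus ?case using Suc by (simp add: add_ac)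
    qed
  qed
  have "f (real K) \<le> (c / pi) / (real K)\<^sup>2"
  proof -
    have "(c * real k)\<^sup>2 + (real K)\<^sup>2 > 0" using assms(1-3) by (auto intro: add_nonneg_pos)
    thus ?thesis unfolding f_def using assms(1-3) by (intro divide_left_mono) auto
  qed
  moreover have "f (real K) \<ge> 0" unfolding f_def using assms(1-3) by simp
  ultimately show ?thesis using upper lower by (simp add: F_def abs_le_iff)
qed

lemma riemann_sum_decreasing:
  fixes \<phi> \<Psi> :: "real \<Rightarrow> real"
  assumes deriv: "\<And>x. x \<in> {0..1} \<Longrightarrow> (\<Psi> has_real_derivative \<phi> x) (at x)"
    and decr: "\<And>x y. 0 \<le> x \<Longrightarrow> x \<le> y \<Longrightarrow> y \<le> 1 \<Longrightarrow> \<phi> y \<le> \<phi> x"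
    and K: "K > 0"
  shows "\<bar>(\<Sum>k=1..K. \<phi> (real k / real K)) / real K - (\<Psi> 1 - \<Psi> 0)\<bar> \<le> (\<phi> 0 - \<phi> 1) / real K"
proof -
  have step: "\<phi> (real (Suc k) / real K) / real K \<le> \<Psi> (real (Suc k) / real K) - \<Psi> (real k / real K) \<and>
     \<Psi> (real (Suc k) / real K) - \<Psi> (real k / real K) \<le> \<phi> (real k / real K) / real K" if "k < K" for k
  proof -
    have lt: "real k / real K < real (Suc k) / real K" using K by (simp add: divide_strict_right_mono)
    have le1: "real (Suc k) / real K \<le> 1" using that by simp
    obtain \<xi> where \<xi>: "real k / real K < \<xi>" "\<xi> < real (Suc k) / real K"
      "\<Psi> (real (Suc k) / real K) - \<Psi> (real k / real K) = (real (Suc k) / real K - real k / real K) * \<phi> \<xi>"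
      using MVT2[OF lt, of \<Psi> \<phi>] deriv le1 by (smt (verit, best) atLeastAtMost_iff divide_nonneg_nonneg of_nat_0_le_iff)
    have nn: "real k / real K \<ge> 0" by simp
    have "real (Suc k) / real K - real k / real K = 1 / real K" by (simp add: diff_divide_distrib[symmetric])
    moreover have "\<phi> (real (Suc k) / real K) \<le> \<phi> \<xi>" "\<phi> \<xi> \<le> \<phi> (real k / real K)"
      using \<xi>(1,2) le1 nn by (intro decr; linarith)+
    ultimately show ?thesis using \<xi>(3) K by (simp add: divide_right_mono)
  qed
  have "(\<Sum>k<n. \<phi> (real (Suc k) / real K)) / real K \<le> \<Psi> (real n / real K) - \<Psi> 0 \<and>
        \<Psi> (real n / real K) - \<Psi> 0 \<le> ((\<Sum>k<n. \<phi> (real (Suc k) / real K)) + \<phi> 0 - \<phi> (real n / real K)) / real K" if "n \<le> K" for n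
    using that
  proof (induction n)
    case (Suc n)
    thus ?case using step[of n] by (simp add: add_divide_distrib diff_divide_distrib)
  qed auto
  from this[of K] have "(\<Sum>k<K. \<phi> (real (Suc k) / real K)) / real K \<le> \<Psi> 1 - \<Psi> 0 \<and>
        \<Psi> 1 - \<Psi> 0 \<le> ((\<Sum>k<K. \<phi> (real (Suc k) / real K)) + \<phi> 0 - \<phi> 1) / real K" using K by simp
  moreover have "(\<Sum>k<K. \<phi> (real (Suc k) / real K)) = (\<Sum>k=1..K. \<phi> (real k / real K))"
    by (rule sum.reindex_bij_witness[of _ "\<lambda>k. k - 1" Suc]) auto
  ultimately show ?thesis by (simp add: abs_le_iff add_divide_distrib diff_divide_distrib)
qed

text \<open>Instead of evaluating a limiting integral, the sum is differentiated in
  \<open>c\<close>: the derivative is a Riemann sum of a rational function with limit 1/(2c), and at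
  c = 1 the sum vanishes. The error of the derivative is bounded uniformly between 1 and
  \<open>c\<close>, so it survives integration.\<close>

lemma arctan_sum_tendsto_ln:
  fixes c :: real
  assumes "c > 0"
  shows "(\<lambda>K. \<Sum>k=1..K. (arctan (c * real k / real K) - arctan (1 / c * real k / real K)) / (pi * real k))
           \<longlonglongrightarrow> ln c / 2"
proof -
  define T where "T = (\<lambda>K x. \<Sum>k=1..K. (arctan (x * real k / real K) - arctan (1 / x * real k / real K)) / (pi * real k))"
  define T' where "T' = (\<lambda>K x. (\<Sum>k=1..K. 1 / (1 + x\<^sup>2 * (real k / real K)\<^sup>2) + 1 / (x\<^sup>2 + (real k / real K)\<^sup>2)) / real K / pi)"
  have T_deriv: "(T K has_real_derivative T' K x) (at x)" if "x > 0" "K > 0" for K x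
  proof -
    have "((\<lambda>x. (arctan (x * real k / real K) - arctan (1 / x * real k / real K)) / (pi * real k)) has_real_derivative
            (1 / (1 + x\<^sup>2 * (real k / real K)\<^sup>2) + 1 / (x\<^sup>2 + (real k / real K)\<^sup>2)) / real K / pi) (at x)" if "k \<in> {1..K}" for k
    proof -
      define y where "y = real k / real K"
      have y: "y > 0" using that \<open>K > 0\<close> by (auto simp: y_def)
      have 1: "1 + x\<^sup>2 * y\<^sup>2 > 0" "x\<^sup>2 + y\<^sup>2 > 0" using \<open>x > 0\<close> by (auto intro: add_pos_nonneg)
      have "((\<lambda>x. (arctan (x * y) - arctan (y / x)) / (pi * real k)) has_real_derivative
            (y / (1 + x\<^sup>2 * y\<^sup>2) + y / (x\<^sup>2 + y\<^sup>2)) / (pi * real k)) (at x)"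
      proof -
        have "((\<lambda>x. arctan (x * y)) has_real_derivative y / (1 + x\<^sup>2 * y\<^sup>2)) (at x)"
          by (auto intro!: derivative_eq_intros simp: field_simps power_mult_distrib)
        moreover have "((\<lambda>x. arctan (y / x)) has_real_derivative - (y / (x\<^sup>2 + y\<^sup>2))) (at x)"
        proof (rule DERIV_cong)
          show "((\<lambda>x. arctan (y / x)) has_real_derivative (inverse (1 + (y / x)\<^sup>2) * (- y / x\<^sup>2))) (at x)"
            using \<open>x > 0\<close> by (auto intro!: derivative_eq_intros simp: power2_eq_square)
          show "inverse (1 + (y / x)\<^sup>2) * (- y / x\<^sup>2) = - (y / (x\<^sup>2 + y\<^sup>2))"
            using \<open>x > 0\<close> 1 by (simp add: power_divide divide_simps)
        qed
        ultimately have "((\<lambda>x. arctan (x * y) - arctan (y / x)) has_real_derivative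
           (y / (1 + x\<^sup>2 * y\<^sup>2) - - (y / (x\<^sup>2 + y\<^sup>2)))) (at x)" by (rule DERIV_diff)
        from DERIV_cdivide[OF this, of "pi * real k"] show ?thesis by simp
      qed
      moreover have "(y / (1 + x\<^sup>2 * y\<^sup>2) + y / (x\<^sup>2 + y\<^sup>2)) / (pi * real k) =
          (1 / (1 + x\<^sup>2 * y\<^sup>2) + 1 / (x\<^sup>2 + y\<^sup>2)) / real K / pi"
        using that by (simp add: y_def add_divide_distrib mult.commute)
      moreover have "(\<lambda>x. (arctan (x * real k / real K) - arctan (1 / x * real k / real K)) / (pi * real k)) =
          (\<lambda>x. (arctan (x * y) - arctan (y / x)) / (pi * real k))"
        by (simp add: y_def mult.commute)
      ultimately show ?thesis unfolding y_def by simp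
    qed
    hence "(T K has_real_derivative (\<Sum>k=1..K. (1 / (1 + x\<^sup>2 * (real k / real K)\<^sup>2) + 1 / (x\<^sup>2 + (real k / real K)\<^sup>2)) / real K / pi)) (at x)"
      unfolding T_def by (intro DERIV_sum) auto
    thus ?thesis by (simp add: T'_def sum_divide_distrib)
  qed
  have T'_approx: "\<bar>T' K x - 1 / (2 * x)\<bar> \<le> (1 + 1 / x\<^sup>2) / (pi * real K)" if "x > 0" "K > 0" for K x
  proof -
    define \<phi> where "\<phi> = (\<lambda>y. 1 / (1 + x\<^sup>2 * y\<^sup>2) + 1 / (x\<^sup>2 + y\<^sup>2))"
    define \<Psi> where "\<Psi> = (\<lambda>y. (arctan (x * y) + arctan (y / x)) / x)"
    have "\<bar>(\<Sum>k=1..K. \<phi> (real k / real K)) / real K - (\<Psi> 1 - \<Psi> 0)\<bar> \<le> (\<phi> 0 - \<phi> 1) / real K"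
    proof (rule riemann_sum_decreasing)
      show "(\<Psi> has_real_derivative \<phi> y) (at y)" for y
      proof -
        have 1: "1 + x\<^sup>2 * y\<^sup>2 > 0" "x\<^sup>2 + y\<^sup>2 > 0" using \<open>x > 0\<close> by (auto intro: add_pos_nonneg)
        show ?thesis unfolding \<Psi>_def
        proof (rule DERIV_cong)
          show "((\<lambda>y. (arctan (x * y) + arctan (y / x)) / x) has_real_derivative
                 (inverse (1 + (x * y)\<^sup>2) * x + inverse (1 + (y / x)\<^sup>2) * (1 / x)) / x) (at y)"
            using \<open>x > 0\<close> by (auto intro!: derivative_eq_intros)
          have "inverse (1 + (y / x)\<^sup>2) = x\<^sup>2 / (x\<^sup>2 + y\<^sup>2)"
            using \<open>x > 0\<close> 1 by (simp add: power_divide divide_simps)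
          thus "(inverse (1 + (x * y)\<^sup>2) * x + inverse (1 + (y / x)\<^sup>2) * (1 / x)) / x = \<phi> y"
            using \<open>x > 0\<close> by (simp add: \<phi>_def power_mult_distrib add_divide_distrib power2_eq_square inverse_eq_divide)
        qed
      qed
      show "\<phi> y \<le> \<phi> z" if "0 \<le> z" "z \<le> y" "y \<le> 1" for y z
      proof -
        have "z\<^sup>2 \<le> y\<^sup>2" using that by (intro power_mono) auto
        thus ?thesis unfolding \<phi>_def using \<open>x > 0\<close>
          by (intro add_mono divide_left_mono mult_left_mono mult_pos_pos) (auto intro!: add_pos_nonneg)
      qed
    qed fact+
    \<comment> \<open>arctan(x) + arctan(1/x) = pi/2 for positive x.\<close>
    moreover have "\<Psi> 1 - \<Psi> 0 = pi / (2 * x)"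
      using arctan_inverse[of x] \<open>x > 0\<close> by (simp add: \<Psi>_def inverse_eq_divide sgn_if)
    moreover have "\<phi> 0 - \<phi> 1 \<le> 1 + 1 / x\<^sup>2"
    proof -
      have "\<phi> 1 \<ge> 0" unfolding \<phi>_def by (intro add_nonneg_nonneg divide_nonneg_nonneg) auto
      moreover have "\<phi> 0 = 1 + 1 / x\<^sup>2" by (simp add: \<phi>_def)
      ultimately show ?thesis by linarith
    qed
    ultimately have "\<bar>(\<Sum>k=1..K. \<phi> (real k / real K)) / real K - pi / (2 * x)\<bar> \<le> (1 + 1 / x\<^sup>2) / real K"
      using \<open>K > 0\<close> by (smt (verit) divide_right_mono of_nat_0_le_iff)
    hence "\<bar>(\<Sum>k=1..K. \<phi> (real k / real K)) / real K - pi / (2 * x)\<bar> / pi \<le> (1 + 1 / x\<^sup>2) / real K / pi"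
      by (rule divide_right_mono) auto
    also have "\<bar>(\<Sum>k=1..K. \<phi> (real k / real K)) / real K - pi / (2 * x)\<bar> / pi = \<bar>T' K x - 1 / (2 * x)\<bar>"
    proof -
      have "T' K x - 1 / (2 * x) = ((\<Sum>k=1..K. \<phi> (real k / real K)) / real K - pi / (2 * x)) / pi"
        by (simp add: T'_def \<phi>_def diff_divide_distrib)
      thus ?thesis by simp
    qed
    finally show ?thesis by (simp add: mult.commute)
  qed
  define m where "m = min 1 c"
  have m: "m > 0" using assms by (simp add: m_def)
  have bound: "\<bar>T K c - ln c / 2\<bar> \<le> (1 + 1 / m\<^sup>2) / (pi * real K) * \<bar>c - 1\<bar>" if "K > 0" for K
  proof -
    define S where "S = {min 1 c..max 1 c}"
    have "norm ((T K c - ln c / 2) - (T K 1 - ln 1 / 2)) \<le> (1 + 1 / m\<^sup>2) / (pi * real K) * norm (c - 1)"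
    proof (rule field_differentiable_bound[where f' = "\<lambda>x. T' K x - 1 / (2 * x)" and S = S])
      show "convex S" by (simp add: S_def)
      fix x assume "x \<in> S"
      hence x: "x > 0" "x \<ge> m" using assms by (auto simp: S_def m_def)
      show "((\<lambda>x. T K x - ln x / 2) has_field_derivative T' K x - 1 / (2 * x)) (at x within S)"
        using x \<open>K > 0\<close> by (auto intro!: derivative_eq_intros T_deriv[THEN DERIV_subset] simp: field_simps)
      have "(1 + 1 / x\<^sup>2) / (pi * real K) \<le> (1 + 1 / m\<^sup>2) / (pi * real K)"
        using m x \<open>K > 0\<close> by (intro divide_right_mono add_mono divide_left_mono power_mono mult_pos_pos) auto
      thus "norm (T' K x - 1 / (2 * x)) \<le> (1 + 1 / m\<^sup>2) / (pi * real K)"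
        using T'_approx[OF x(1) \<open>K > 0\<close>] by simp
    qed (auto simp: S_def)
    moreover have "T K 1 = 0" by (simp add: T_def)
    ultimately show ?thesis by simp
  qed
  have "(\<lambda>K. (1 + 1 / m\<^sup>2) * \<bar>c - 1\<bar> / pi * (1 / real K)) \<longlonglongrightarrow> (1 + 1 / m\<^sup>2) * \<bar>c - 1\<bar> / pi * 0"
    by (intro tendsto_mult tendsto_const lim_1_over_n)
  hence lim: "(\<lambda>K. (1 + 1 / m\<^sup>2) / (pi * real K) * \<bar>c - 1\<bar>) \<longlonglongrightarrow> 0" by (simp add: mult_ac)
  have "(\<lambda>K. T K c - ln c / 2) \<longlonglongrightarrow> 0"
    by (rule Lim_null_comparison[OF _ lim]) (use bound in \<open>auto intro!: eventually_sequentiallyI[of 1]\<close>)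
  thus ?thesis by (simp add: T_def LIM_zero_iff)
qed

text \<open>With t = 2 pi c this is the transformation of the logarithm of the eta function. Both
  series are expanded in partial fractions and subtracted: the sums of 1/k^2 give the elementary
  term, the square truncations agree, and the remainders give \<open>ln c / 2\<close> through their
  arctangent approximations.\<close>

theorem log_euler_modular_real:
  fixes c :: real
  assumes c: "c > 0"
  shows "log_euler (2 * pi * c) - log_euler (2 * pi / c) =
           (1 / (2 * pi * c) - c / (2 * pi)) * (pi\<^sup>2 / 6) + ln c / 2"
proof -
  define a where "a = (\<lambda>c k. 1 / (real k * (exp (real k * (2 * pi * c)) - 1)))"
  define f where "f = (\<lambda>c k m. (c / pi) / ((c * real k)\<^sup>2 + (real m)\<^sup>2))"
  define g where "g = (\<lambda>c k. a c k - 1 / (2 * pi * c) * (1 / (real k)\<^sup>2) + 1 / (2 * real k))"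
  define R where "R = (\<lambda>c K k. g c k - (\<Sum>m=1..K. f c k m))"
  have shift: "(\<Sum>k<K. h (Suc k)) = (\<Sum>k=1..K. h k)" for h :: "nat \<Rightarrow> real" and K
    by (rule sum.reindex_bij_witness[of _ "\<lambda>k. k - 1" Suc]) auto
  have lim_a: "(\<lambda>K. \<Sum>k=1..K. a d k) \<longlonglongrightarrow> log_euler (2 * pi * d)" if "d > 0" for d
    using log_euler_sums_real(1)[of "2 * pi * d"] that unfolding sums_def a_def shift[symmetric] by simp
  have lim_sq: "(\<lambda>K. \<Sum>k=1..K. 1 / (real k)\<^sup>2) \<longlonglongrightarrow> pi\<^sup>2 / 6"
    using inverse_squares_sums unfolding sums_def shift[symmetric] by (simp add: add_ac)
  have f_sums: "(\<lambda>m. f d k (Suc m)) sums g d k" if "d > 0" "k > 0" for d k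
  proof -
    have "(\<lambda>m. d * real k / ((real (Suc m))\<^sup>2 + (d * real k)\<^sup>2) / pi / real k) sums
           ((1 / (exp (2 * pi * (d * real k)) - 1) - 1 / (2 * pi * (d * real k)) + 1 / 2) / real k)"
      using inverse_exp_minus_one_partial_fractions[of "d * real k"] that
      by (intro sums_divide) auto
    also have "(\<lambda>m. d * real k / ((real (Suc m))\<^sup>2 + (d * real k)\<^sup>2) / pi / real k) = (\<lambda>m. f d k (Suc m))"
      using that by (auto simp: f_def fun_eq_iff add.commute)
    also have "(1 / (exp (2 * pi * (d * real k)) - 1) - 1 / (2 * pi * (d * real k)) + 1 / 2) / real k = g d k"
      using that by (simp add: g_def a_def add_divide_distrib diff_divide_distrib power2_eq_square mult_ac)
    finally show ?thesis .
  qed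
  have R_sums: "(\<lambda>m. f d k (Suc (m + K))) sums R d K k" if "d > 0" "k > 0" for d k K
    using sums_iff_shift[of "\<lambda>m. f d k (Suc m)" K "R d K k"] f_sums[OF that] by (simp add: R_def shift)
  have R_approx: "\<bar>R d K k - arctan (d * real k / real K) / (pi * real k)\<bar> \<le> d / (pi * (real K)\<^sup>2)"
    if "d > 0" "k > 0" "K > 0" for d k K
    using R_sums[of d k K] that by (intro lattice_tail) (auto simp: f_def)
  \<comment> \<open>Both indices are cut at the same K. The harmonic sums diverge, but they do not
    depend on \<open>d\<close> and cancel between \<open>d = c\<close> and
    \<open>d = 1 / c\<close>.\<close>
  have split: "(\<Sum>k=1..K. a d k) = 1 / (2 * pi * d) * (\<Sum>k=1..K. 1 / (real k)\<^sup>2) - (\<Sum>k=1..K. 1 / (2 * real k))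
      + (\<Sum>k=1..K. \<Sum>m=1..K. f d k m) + (\<Sum>k=1..K. R d K k)" for d K
    by (simp add: R_def g_def sum_distrib_left sum.distrib sum_subtractf)
  \<comment> \<open>Inverting \<open>c\<close> exchanges the two indices of \<open>f\<close>, so the
    sums over the square agree by transposition.\<close>
  have box: "(\<Sum>k=1..K. \<Sum>m=1..K. f (1 / c) k m) = (\<Sum>k=1..K. \<Sum>m=1..K. f c k m)" for K
  proof -
    have "f (1 / c) k m = f c m k" if "k > 0" "m > 0" for k m
    proof -
      have "(c * real m)\<^sup>2 + (real k)\<^sup>2 > 0" using that by (auto intro: add_nonneg_pos)
      moreover have "(1 / c * real k)\<^sup>2 + (real m)\<^sup>2 = ((c * real m)\<^sup>2 + (real k)\<^sup>2) / c\<^sup>2"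
        using c by (simp add: field_simps power2_eq_square)
      ultimately show ?thesis using c by (simp add: f_def power2_eq_square)
    qed
    hence "(\<Sum>k=1..K. \<Sum>m=1..K. f (1 / c) k m) = (\<Sum>k=1..K. \<Sum>m=1..K. f c m k)"
      by (intro sum.cong) auto
    also have "\<dots> = (\<Sum>k=1..K. \<Sum>m=1..K. f c k m)" by (rule sum.swap)
    finally show ?thesis .
  qed
  define T where "T = (\<lambda>K. \<Sum>k=1..K. (arctan (c * real k / real K) - arctan (1 / c * real k / real K)) / (pi * real k))"
  have lim_T: "T \<longlonglongrightarrow> ln c / 2" unfolding T_def by (rule arctan_sum_tendsto_ln) fact
  have diff_bound: "norm ((\<Sum>k=1..K. R c K k) - (\<Sum>k=1..K. R (1 / c) K k) - T K) \<le> (c + 1 / c) / pi * (1 / real K)"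
    if "K > 0" for K
  proof -
    have "norm ((\<Sum>k=1..K. R c K k) - (\<Sum>k=1..K. R (1 / c) K k) - T K) =
      norm (\<Sum>k=1..K. (R c K k - arctan (c * real k / real K) / (pi * real k)) -
                (R (1 / c) K k - arctan (1 / c * real k / real K) / (pi * real k)))"
      by (simp add: T_def sum_subtractf diff_divide_distrib)
    also have "\<dots> \<le> (\<Sum>k=1..K. c / (pi * (real K)\<^sup>2) + 1 / c / (pi * (real K)\<^sup>2))"
    proof (rule sum_norm_le)
      fix k assume "k \<in> {1..K}"
      thus "norm ((R c K k - arctan (c * real k / real K) / (pi * real k)) -
                (R (1 / c) K k - arctan (1 / c * real k / real K) / (pi * real k)))
          \<le> c / (pi * (real K)\<^sup>2) + 1 / c / (pi * (real K)\<^sup>2)"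
        using R_approx[of c k K] R_approx[of "1 / c" k K] c that unfolding real_norm_def
        by (intro order.trans[OF abs_triangle_ineq4 add_mono]) auto
    qed
    also have "\<dots> = (c + 1 / c) / pi * (1 / real K)"
      using that by (simp add: power2_eq_square add_divide_distrib distrib_left)
    finally show ?thesis .
  qed
  have lim0: "(\<lambda>K. (\<Sum>k=1..K. R c K k) - (\<Sum>k=1..K. R (1 / c) K k) - T K) \<longlonglongrightarrow> 0"
  proof (rule Lim_null_comparison)
    show "\<forall>\<^sub>F K in sequentially. norm ((\<Sum>k=1..K. R c K k) - (\<Sum>k=1..K. R (1 / c) K k) - T K) \<le> (c + 1 / c) / pi * (1 / real K)"
      using diff_bound by (intro eventually_sequentiallyI[of 1]) auto
    show "(\<lambda>K. (c + 1 / c) / pi * (1 / real K)) \<longlonglongrightarrow> 0"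
      by (rule tendsto_mult_right_zero[OF lim_1_over_n])
  qed
  have limR: "(\<lambda>K. (\<Sum>k=1..K. R c K k) - (\<Sum>k=1..K. R (1 / c) K k)) \<longlonglongrightarrow> ln c / 2"
    using tendsto_add[OF lim0 lim_T] by simp
  have "(\<lambda>K. (1 / (2 * pi * c) - c / (2 * pi)) * (\<Sum>k=1..K. 1 / (real k)\<^sup>2) +
     ((\<Sum>k=1..K. R c K k) - (\<Sum>k=1..K. R (1 / c) K k))) \<longlonglongrightarrow>
        (1 / (2 * pi * c) - c / (2 * pi)) * (pi\<^sup>2 / 6) + ln c / 2"
    by (intro tendsto_add tendsto_mult lim_sq limR tendsto_const)
  also have "(\<lambda>K. (1 / (2 * pi * c) - c / (2 * pi)) * (\<Sum>k=1..K. 1 / (real k)\<^sup>2) +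
     ((\<Sum>k=1..K. R c K k) - (\<Sum>k=1..K. R (1 / c) K k))) = (\<lambda>K. (\<Sum>k=1..K. a c k) - (\<Sum>k=1..K. a (1 / c) k))"
    unfolding split box using c by (simp add: left_diff_distrib algebra_simps)
  finally have "(\<lambda>K. (\<Sum>k=1..K. a c k) - (\<Sum>k=1..K. a (1 / c) k)) \<longlonglongrightarrow>
     (1 / (2 * pi * c) - c / (2 * pi)) * (pi\<^sup>2 / 6) + ln c / 2" .
  moreover have "(\<lambda>K. (\<Sum>k=1..K. a c k) - (\<Sum>k=1..K. a (1 / c) k)) \<longlonglongrightarrow>
     log_euler (2 * pi * c) - log_euler (2 * pi * (1 / c))"
    using c by (intro tendsto_diff lim_a) auto
  ultimately show ?thesis using LIMSEQ_unique by fastforce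
qed

section \<open>Continuation of the transformation formula to the right half-plane\<close>

lemma holomorphic_log_euler: "log_euler holomorphic_on {t. Re t > 0}"
proof -
  define u where "u = (\<lambda>k t. 1 / (of_nat (Suc k) * (exp (of_nat (Suc k) * t) - 1)) :: complex)"
  have hol: "(\<lambda>t. \<Sum>k<n. u k t) holomorphic_on {t. Re t > 0}" for n
  proof (intro holomorphic_on_sum)
    fix k
    have "of_nat (Suc k) * (exp (of_nat (Suc k) * t) - 1) \<noteq> 0" if "Re t > 0" for t :: complex
    proof -
      have "Re (of_nat (Suc k) * t) > 0" using that by (simp del: of_nat_Suc)
      hence "exp (of_nat (Suc k) * t) \<noteq> 1" by (auto simp: exp_eq_1)
      thus ?thesis by (simp del: of_nat_Suc)
    qed
    thus "(\<lambda>t. u k t) holomorphic_on {t. Re t > 0}" unfolding u_def by (intro holomorphic_intros) auto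
  qed
  have "\<exists>d>0. cball t d \<subseteq> {t. 0 < Re t} \<and>
       uniform_limit (cball t d) (\<lambda>n t. \<Sum>k<n. u k t) log_euler sequentially" if "t \<in> {t. Re t > 0}" for t
  proof -
  define r where "r = Re t / 2"
  have r: "r > 0" using that by (simp add: r_def)
  have cball: "Re s \<ge> r" if "s \<in> cball t r" for s
    using that abs_Re_le_cmod[of "t - s"] by (auto simp: r_def dist_norm)
  have "uniform_limit (cball t r) (\<lambda>n t. \<Sum>k<n. u k t) (\<lambda>t. \<Sum>k. u k t) sequentially"
  proof (rule Weierstrass_m_test)
    show "norm (u k s) \<le> 1 / r * (1 / (real (Suc k))\<^sup>2)" if "s \<in> cball t r" for k s
      unfolding u_def using cball[OF that] r by (rule norm_log_euler_term_le)
    show "summable (\<lambda>k. 1 / r * (1 / (real (Suc k))\<^sup>2))"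
      using inverse_squares_sums[THEN sums_summable] by (intro summable_mult) (simp add: add_ac)
  qed
  moreover have "(\<lambda>t. \<Sum>k. u k t) = log_euler" by (simp add: u_def log_euler_def fun_eq_iff)
  moreover have "cball t r \<subseteq> {t. Re t > 0}" using cball r by force
  ultimately show ?thesis using r by auto
  qed
  with open_halfspace_Re_gt hol show ?thesis by (rule holomorphic_uniform_sequence)
qed

text \<open>The positive reals accumulate at 1, inside the connected half-plane, so the identity
  theorem applies.\<close>

lemma half_plane_identity:
  assumes "f holomorphic_on {t. Re t > 0}" "g holomorphic_on {t. Re t > 0}"
    and "\<And>x. x > 0 \<Longrightarrow> f (complex_of_real x) = g (complex_of_real x)" and "Re t > 0"
  shows "f t = g t"
proof -
  have "f t - g t = 0"
  proof (rule analytic_continuation[where f = "\<lambda>t. f t - g t" and w = t and S = "{t. Re t > 0}" and U = "complex_of_real ` {0<..}" and \<xi> = 1])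
    show "(\<lambda>t. f t - g t) holomorphic_on {t. Re t > 0}" using assms by (intro holomorphic_intros)
    show "open {t. Re t > 0}" by (rule open_halfspace_Re_gt)
    show "connected {t. Re t > 0}" by (intro convex_connected convex_halfspace_Re_gt)
    show "1 islimpt complex_of_real ` {0<..}"
      unfolding islimpt_approachable
    proof (intro allI impI)
      fix e :: real assume "e > 0"
      thus "\<exists>x'\<in>complex_of_real ` {0<..}. x' \<noteq> 1 \<and> dist x' 1 < e"
        by (intro bexI[OF _ imageI[of "1 + e / 2"]]) (auto simp: dist_norm)
    qed
  qed (use assms in auto)
  thus ?thesis by simp
qed

text \<open>After exponentiation \<open>ln c / 2\<close> becomes a principal square root, which is
  holomorphic here because the right half-plane avoids the cut. The dual argument 4 pi^2/t stays in
  the half-plane as well.\<close>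

theorem exp_log_euler_modular:
  fixes t :: complex
  assumes "Re t > 0"
  shows "exp (log_euler t) =
    csqrt (t / of_real (2 * pi)) * exp (of_real (pi\<^sup>2 / 6) / t - t / 24) * exp (log_euler (of_real (4 * pi\<^sup>2) / t))"
proof (rule half_plane_identity[OF _ _ _ assms])
  show "(\<lambda>t. exp (log_euler t)) holomorphic_on {t. Re t > 0}"
    by (intro holomorphic_intros holomorphic_log_euler)
  have "(\<lambda>t. log_euler (of_real (4 * pi\<^sup>2) / t)) holomorphic_on {t. Re t > 0}"
  proof (rule holomorphic_on_compose_gen[OF _ holomorphic_log_euler, unfolded o_def])
    show "(\<lambda>t. complex_of_real (4 * pi\<^sup>2) / t) holomorphic_on {t. Re t > 0}"
      by (intro holomorphic_intros) auto
    show "(\<lambda>t. complex_of_real (4 * pi\<^sup>2) / t) ` {t. Re t > 0} \<subseteq> {t. Re t > 0}"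
      by (auto simp: Re_divide intro!: divide_pos_pos add_pos_nonneg)
  qed
  moreover have "(\<lambda>t. csqrt (t / of_real (2 * pi))) holomorphic_on {t. Re t > 0}"
    by (intro holomorphic_intros) (auto simp: complex_nonpos_Reals_iff divide_le_0_iff not_le)
  ultimately show "(\<lambda>t. csqrt (t / of_real (2 * pi)) * exp (of_real (pi\<^sup>2 / 6) / t - t / 24) * exp (log_euler (of_real (4 * pi\<^sup>2) / t))) holomorphic_on {t. Re t > 0}"
    by (intro holomorphic_on_mult holomorphic_on_exp' holomorphic_on_diff holomorphic_on_divide
          holomorphic_on_const holomorphic_on_ident) auto
next
  fix x :: real assume x: "x > 0"
  have "log_euler x = log_euler (4 * pi\<^sup>2 / x) + (pi\<^sup>2 / (6 * x) - x / 24) + ln (x / (2 * pi)) / 2"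
  proof -
    have 1: "(1 / (2 * pi * (x / (2 * pi))) - (x / (2 * pi)) / (2 * pi)) * (pi\<^sup>2 / 6) = pi\<^sup>2 / (6 * x) - x / 24"
      using x by (simp add: field_simps power2_eq_square)
    have 2: "2 * pi / (x / (2 * pi)) = 4 * pi\<^sup>2 / x"
      using x by (simp add: field_simps power2_eq_square)
    have "x / (2 * pi) > 0" using x by simp
    from log_euler_modular_real[OF this, unfolded 1 2]
    have "log_euler x - log_euler (4 * pi\<^sup>2 / x) = pi\<^sup>2 / (6 * x) - x / 24 + ln (x / (2 * pi)) / 2" by simp
    thus ?thesis by linarith
  qed
  hence "exp (log_euler x) = exp (log_euler (4 * pi\<^sup>2 / x)) * exp (pi\<^sup>2 / (6 * x) - x / 24) * sqrt (x / (2 * pi))"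
    using x by (simp add: exp_add ln_sqrt[symmetric])
  hence "complex_of_real (exp (log_euler x)) =
     of_real (sqrt (x / (2 * pi)) * exp (pi\<^sup>2 / (6 * x) - x / 24) * exp (log_euler (4 * pi\<^sup>2 / x)))"
    by (simp add: mult_ac)
  moreover have "csqrt (of_real x / of_real (2 * pi)) = of_real (sqrt (x / (2 * pi)))"
    using x by (subst of_real_sqrt) auto
  ultimately show "exp (log_euler (complex_of_real x)) =
      csqrt (of_real x / of_real (2 * pi)) * exp (of_real (pi\<^sup>2 / 6) / of_real x - of_real x / 24) * exp (log_euler (of_real (4 * pi\<^sup>2) / of_real x))"
    using log_euler_sums_real(2)[OF x] log_euler_sums_real(2)[of "4 * pi\<^sup>2 / x"] x
    by (simp add: exp_of_real[symmetric])
qed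

section \<open>Partition generating functions\<close>

text \<open>The coefficient of q^n in the product of 1/(1 - g(i) q^i) over \<open>S\<close>. Weight
  1 counts partitions; the weight \<open>large_sign\<close> will later carry the sign of the
  crank.\<close>

definition partition_weight :: "(nat \<Rightarrow> 'a :: comm_ring_1) \<Rightarrow> nat set \<Rightarrow> nat \<Rightarrow> 'a" where
  "partition_weight g S n = (\<Sum>l\<in>{l \<in> partitions n. set_mset l \<subseteq> S}. \<Prod>i\<in>#l. g i)"

lemma member_le_sum_mset: "i \<in># l \<Longrightarrow> i \<le> sum_mset l" for i :: nat
  by (auto dest!: multi_member_split)

lemma partition_weight_empty: "partition_weight g {} n = (if n = 0 then 1 else 0)"
proof -
  have "{l \<in> partitions n. set_mset l \<subseteq> {}} = (if n = 0 then {{#}} else {})"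
    by (auto simp: partitions_def)
  thus ?thesis by (simp add: partition_weight_def)
qed

text \<open>Removing one copy of \<open>i\<close> maps the partitions containing \<open>i\<close>
  onto partitions of n - i that may contain \<open>i\<close> again. In terms of generating functions
  this is multiplication by 1 - g(i) q^i.\<close>

lemma partition_weight_insert:
  assumes "i \<notin> S" "i > 0"
  shows "partition_weight g (insert i S) n =
     partition_weight g S n + (if i \<le> n then g i * partition_weight g (insert i S) (n - i) else 0)"
proof -
  define A where "A = {l \<in> partitions n. set_mset l \<subseteq> S}"
  define B where "B = {l \<in> partitions n. set_mset l \<subseteq> insert i S \<and> i \<in># l}"
  define C where "C = {l \<in> partitions (n - i). set_mset l \<subseteq> insert i S}"
  have split: "{l \<in> partitions n. set_mset l \<subseteq> insert i S} = A \<union> B" "A \<inter> B = {}"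
    using assms by (auto simp: A_def B_def)
  have fin: "finite A" "finite B" by (simp_all add: A_def B_def finite_partitions)
  have "partition_weight g (insert i S) n = (\<Sum>l\<in>A. \<Prod>i\<in>#l. g i) + (\<Sum>l\<in>B. \<Prod>i\<in>#l. g i)"
    unfolding partition_weight_def split(1) using fin split(2) by (rule sum.union_disjoint)
  also have "(\<Sum>l\<in>B. \<Prod>i\<in>#l. g i) = (if i \<le> n then g i * partition_weight g (insert i S) (n - i) else 0)"
  proof (cases "i \<le> n")
    case True
    have "(\<Sum>l\<in>B. \<Prod>i\<in>#l. g i) = (\<Sum>l\<in>C. g i * (\<Prod>i\<in>#l. g i))"
    proof (rule sum.reindex_bij_witness[of _ "add_mset i" "\<lambda>l. l - {#i#}"])
      fix l assume l: "l \<in> B"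
      hence "i \<in># l" by (simp add: B_def)
      then obtain l' where l': "l = add_mset i l'" by (metis insert_DiffM)
      show "add_mset i (l - {#i#}) = l" using l' by simp
      show "l - {#i#} \<in> C" using l l' assms by (auto simp: B_def C_def partitions_def)
      show "g i * (\<Prod>i\<in>#(l - {#i#}). g i) = (\<Prod>i\<in>#l. g i)" using l' by simp
    next
      fix l assume "l \<in> C"
      thus "add_mset i l \<in> B" using assms True by (auto simp: B_def C_def partitions_def)
    qed auto
    thus ?thesis using True by (simp add: partition_weight_def C_def sum_distrib_left)
  next
    case False
    have "B = {}"
    proof (rule ccontr)
      assume "B \<noteq> {}"
      then obtain l where "l \<in> B" by auto
      hence "i \<in># l" "sum_mset l = n" by (auto simp: B_def partitions_def)
      thus False using False member_le_sum_mset[of i l] by simp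
    qed
    thus ?thesis using False by simp
  qed
  finally show ?thesis by (simp add: partition_weight_def A_def)
qed

lemma partition_weight_atMost:
  assumes "n \<le> N"
  shows "partition_weight (\<lambda>_. 1) {1..N} n = of_nat (card (partitions n))"
proof -
  have "set_mset l \<subseteq> {1..N}" if "l \<in> partitions n" for l
  proof
    fix i assume "i \<in># l"
    moreover from this have "i \<le> sum_mset l" by (rule member_le_sum_mset)
    ultimately show "i \<in> {1..N}" using that assms by (cases "i = 0") (auto simp: partitions_def)
  qed
  hence "{l \<in> partitions n. set_mset l \<subseteq> {1..N}} = partitions n" by blast
  thus ?thesis by (simp add: partition_weight_def)
qed

lemma partition_weight_nonneg:
  fixes g :: "nat \<Rightarrow> 'a :: linordered_idom"
  assumes "\<And>i. g i \<ge> 0"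
  shows "partition_weight g S n \<ge> 0"
  unfolding partition_weight_def
proof (rule sum_nonneg)
  fix l
  show "(\<Prod>i\<in>#l. g i) \<ge> 0" by (induction l) (use assms in auto)
qed

lemma partition_weight_le:
  "partition_weight (\<lambda>_. 1 :: real) S n \<le> real (card (partitions n))"
  unfolding partition_weight_def by (simp add: card_mono finite_partitions)

text \<open>In the induction step the recurrence bounds the partial sums by themselves, shrunk by
  q^i, which gives summability by nonnegativity. Only then can the recurrence be passed to the limit
  to find the value.\<close>

lemma partition_weight_sums:
  fixes q :: real
  assumes "finite S" "0 \<notin> S" "0 \<le> q" "q < 1"
  shows "(\<lambda>n. partition_weight (\<lambda>_. 1) S n * q ^ n) sums (\<Prod>i\<in>S. 1 / (1 - q ^ i))"
  using assms(1,2)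
proof (induction S rule: finite_induct)
  case empty
  have "(\<lambda>n. if n = 0 then 1 else 0 :: real) sums 1" using sums_If_finite[of "\<lambda>n. n = 0" "\<lambda>_. 1 :: real"] by simp
  moreover have "(\<lambda>n. partition_weight (\<lambda>_. 1) {} n * q ^ n) = (\<lambda>n. if n = 0 then 1 else 0 :: real)"
    by (auto simp: partition_weight_empty)
  ultimately show ?case by simp
next
  case (insert i S)
  define a where "a = (\<lambda>n. partition_weight (\<lambda>_. 1) (insert i S) n * q ^ n)"
  define b where "b = (\<lambda>n. partition_weight (\<lambda>_. 1) S n * q ^ n)"
  define B where "B = (\<Prod>i\<in>S. 1 / (1 - q ^ i))"
  have i: "i > 0" "i \<notin> S" using insert by auto
  have qi: "0 \<le> q ^ i" "q ^ i < 1" using assms(3,4) i by (auto simp: power_less_one_iff)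
  have b: "b sums B" using insert by (simp add: b_def B_def)
  have nonneg: "a n \<ge> 0" "b n \<ge> 0" for n
    unfolding a_def b_def using assms(3) by (auto intro!: mult_nonneg_nonneg partition_weight_nonneg)
  have rec: "a n = b n + (if i \<le> n then q ^ i * a (n - i) else 0)" for n
    unfolding a_def b_def partition_weight_insert[OF i(2,1), of _ n]
    by (simp add: algebra_simps flip: power_add)
  have shift: "(\<Sum>n<m. if i \<le> n then q ^ i * a (n - i) else 0) = q ^ i * (\<Sum>n<m - i. a n)" for m
  proof -
    have "(\<Sum>n<m. if i \<le> n then q ^ i * a (n - i) else 0) = (\<Sum>n\<in>{i..<m}. q ^ i * a (n - i))"
      by (intro sum.mono_neutral_cong_right) auto
    also have "\<dots> = (\<Sum>n<m - i. q ^ i * a n)"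
      by (rule sum.reindex_bij_witness[of _ "\<lambda>n. n + i" "\<lambda>n. n - i"]) auto
    finally show ?thesis by (simp add: sum_distrib_left)
  qed
  have part: "(\<Sum>n<m. a n) = (\<Sum>n<m. b n) + q ^ i * (\<Sum>n<m - i. a n)" for m
    unfolding shift[symmetric] sum.distrib[symmetric] by (intro sum.cong rec refl)
  have bound: "(\<Sum>n<m. a n) \<le> B / (1 - q ^ i)" for m
  proof -
    have "(\<Sum>n<m - i. a n) \<le> (\<Sum>n<m. a n)" using nonneg by (intro sum_mono2) auto
    hence "q ^ i * (\<Sum>n<m - i. a n) \<le> q ^ i * (\<Sum>n<m. a n)" using qi by (intro mult_left_mono)
    moreover have "(\<Sum>n<m. b n) \<le> B" using b nonneg by (metis sum_le_suminf sums_iff finite_lessThan)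
    ultimately have "(\<Sum>n<m. a n) * (1 - q ^ i) \<le> B" using part[of m] by (simp add: algebra_simps)
    thus ?thesis using qi by (simp add: pos_le_divide_eq)
  qed
  have "summable a" using nonneg(1) bound by (rule summableI_nonneg_bounded)
  then obtain s where s: "a sums s" by (auto simp: summable_def)
  hence lim: "(\<lambda>m. \<Sum>n<m. a n) \<longlonglongrightarrow> s" by (simp add: sums_def)
  have "(\<lambda>m. \<Sum>n<m - i. a n) \<longlonglongrightarrow> s"
    by (rule filterlim_compose[OF lim]) (rule filterlim_minus_const_nat_at_top)
  hence "(\<lambda>m. (\<Sum>n<m. b n) + q ^ i * (\<Sum>n<m - i. a n)) \<longlonglongrightarrow> B + q ^ i * s"
    using b by (intro tendsto_intros) (simp add: sums_def)
  hence "s = B + q ^ i * s" using lim LIMSEQ_unique unfolding part[symmetric] by blast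
  hence "s = B / (1 - q ^ i)" using qi by (simp add: field_simps)
  moreover have "(\<Prod>i\<in>insert i S. 1 / (1 - q ^ i)) = B / (1 - q ^ i)"
    using insert by (simp add: B_def)
  ultimately show ?case using s by (simp add: a_def)
qed

lemma minus_ln_one_minus_sums:
  fixes x :: real
  assumes "0 \<le> x" "x < 1"
  shows "(\<lambda>k. x ^ Suc k / real (Suc k)) sums (- ln (1 - x))"
proof -
  have "summable (\<lambda>k. x ^ Suc k / real (Suc k))"
  proof (rule summable_comparison_test')
    show "summable (\<lambda>k. x ^ Suc k)" using assms by (simp add: summable_geometric summable_mult)
    show "norm (x ^ Suc k / real (Suc k)) \<le> x ^ Suc k" for k
    proof -
      have "x ^ Suc k / real (Suc k) \<le> x ^ Suc k / 1" using assms by (intro divide_left_mono) auto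
      thus ?thesis using assms by simp
    qed
  qed
  moreover have "- ln (1 - x) = (\<Sum>k. x ^ Suc k / real (Suc k))"
  proof -
    have "ln (1 - x) = (\<Sum>n. (-1) ^ n * (1 / real (n + 1)) * (1 - x - 1) ^ Suc n)"
      using assms by (intro ln_series) auto
    also have "(\<lambda>n. (-1) ^ n * (1 / real (n + 1)) * (1 - x - 1) ^ Suc n) = (\<lambda>n. - (x ^ Suc n / real (Suc n)))"
    proof
      fix n :: nat
      have "(-1) ^ n * (- x) ^ Suc n = - (x ^ Suc n)" by (cases "even n") auto
      thus "(-1) ^ n * (1 / real (n + 1)) * (1 - x - 1) ^ Suc n = - (x ^ Suc n / real (Suc n))"
        by (simp add: mult.commute mult.left_commute)
    qed
    finally show ?thesis using suminf_minus[OF \<open>summable _\<close>] by simp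
  qed
  ultimately show ?thesis by (simp add: sums_iff)
qed

text \<open>The logarithms are expanded and the order of summation is exchanged. All terms are
  nonnegative, so convergence of one iterated sum is enough.\<close>

lemma log_euler_eq_sum_ln:
  fixes t :: real
  assumes "t > 0"
  shows "(\<lambda>i. - ln (1 - exp (- t) ^ Suc i)) sums log_euler t"
proof -
  define q where "q = exp (- t)"
  have q: "0 < q" "q < 1" using assms by (auto simp: q_def)
  define f where "f = (\<lambda>(k, i). q ^ (Suc i * Suc k) / real (Suc k))"
  have rows: "((\<lambda>i. f (k, i)) has_sum 1 / (real (Suc k) * (exp (real (Suc k) * t) - 1))) UNIV" for k
  proof (rule sums_nonneg_imp_has_sum)
    define x where "x = q ^ Suc k"
    have x: "0 < x" "x < 1" using q by (auto simp: x_def power_less_one_iff simp del: power_Suc)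
    have "(\<lambda>i. x ^ i) sums (1 / (1 - x))" using x by (intro geometric_sums) auto
    note * = sums_divide[OF sums_mult[OF this, of x], of "real (Suc k)"]
    have "(\<lambda>i. f (k, i)) sums (x * (1 / (1 - x)) / real (Suc k))"
    proof -
      have "x * x ^ i / real (Suc k) = f (k, i)" for i
      proof -
        have "x * x ^ i = q ^ (Suc k * Suc i)" unfolding x_def power_mult by simp
        moreover have "f (k, i) = q ^ (Suc k * Suc i) / real (Suc k)"
          unfolding f_def by (simp only: prod.case mult.commute[of "Suc i"])
        ultimately show ?thesis by (simp only:)
      qed
      with * show ?thesis by (simp only:)
    qed
    moreover have "exp (real (Suc k) * t) = 1 / x"
      unfolding x_def q_def exp_of_nat_mult by (simp add: exp_minus inverse_eq_divide power_one_over del: power_Suc)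
    moreover have "1 / x - 1 = (1 - x) / x" using x by (simp add: diff_divide_distrib)
    ultimately show "(\<lambda>i. f (k, i)) sums (1 / (real (Suc k) * (exp (real (Suc k) * t) - 1)))"
      by (simp add: mult.commute)
  qed (use q in \<open>auto simp: f_def\<close>)
  have cols: "((\<lambda>k. f (k, i)) has_sum - ln (1 - q ^ Suc i)) UNIV" for i
  proof (rule sums_nonneg_imp_has_sum)
    have "0 < q ^ Suc i" "q ^ Suc i < 1" using q by (auto simp: power_less_one_iff simp del: power_Suc)
    thus "(\<lambda>k. f (k, i)) sums (- ln (1 - q ^ Suc i))"
      using minus_ln_one_minus_sums[of "q ^ Suc i"] by (simp add: f_def flip: power_mult del: power_Suc)
  qed (use q in \<open>auto simp: f_def\<close>)
  have total: "((\<lambda>k. 1 / (real (Suc k) * (exp (real (Suc k) * t) - 1))) has_sum log_euler t) UNIV"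
    using log_euler_sums_real(1)[OF assms] by (rule sums_nonneg_imp_has_sum) (use assms in simp)
  have "f summable_on UNIV \<times> UNIV"
    using rows total by (intro summable_on_SigmaI[where g = "\<lambda>k. 1 / (real (Suc k) * (exp (real (Suc k) * t) - 1))"])
      (use q in \<open>auto simp: f_def has_sum_imp_summable\<close>)
  with rows total have "(f has_sum log_euler t) (UNIV \<times> UNIV)"
    by (intro has_sum_SigmaI) auto
  hence "((\<lambda>(x, y). f (y, x)) has_sum log_euler t) (UNIV \<times> UNIV)" by (subst (asm) has_sum_swap)
  hence "((\<lambda>i. - ln (1 - q ^ Suc i)) has_sum log_euler t) UNIV"
    by (rule has_sum_SigmaD) (use cols in auto)
  thus ?thesis unfolding q_def by (rule has_sum_imp_sums)
qed

text \<open>A squeeze by finite products: with parts up to N the coefficients never exceed the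
  partition numbers, and they agree with them for n <= N. So the partial sums lie below the limit of
  the products, and every finite product lies below the full series.\<close>

theorem partition_gf_real:
  fixes t :: real
  assumes "t > 0"
  shows "(\<lambda>n. real (card (partitions n)) * exp (- t) ^ n) sums exp (log_euler t)"
proof -
  define q where "q = exp (- t)"
  define E where "E = exp (log_euler t)"
  have q: "0 < q" "q < 1" using assms by (auto simp: q_def)
  define Q where "Q = (\<lambda>N. \<Prod>i=1..N. 1 / (1 - q ^ i))"
  have lt1: "q ^ Suc i < 1" for i using q by (auto simp: power_less_one_iff simp del: power_Suc)
  have Q: "Q N = exp (\<Sum>i<N. - ln (1 - q ^ Suc i))" for N
  proof -
    have "Q N = (\<Prod>i<N. 1 / (1 - q ^ Suc i))" unfolding Q_def
      by (rule prod.reindex_bij_witness[of _ Suc "\<lambda>k. k - 1"]) auto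
    also have "\<dots> = (\<Prod>i<N. exp (- ln (1 - q ^ Suc i)))"
      using lt1 by (intro prod.cong) (auto simp: exp_minus inverse_eq_divide simp del: power_Suc)
    finally show ?thesis by (simp add: exp_sum)
  qed
  have lim: "Q \<longlonglongrightarrow> E"
    unfolding Q E_def using log_euler_eq_sum_ln[OF assms] by (intro tendsto_exp) (simp add: sums_def q_def)
  have "incseq Q"
  proof (rule incseq_SucI)
    fix N
    have "0 < q ^ Suc N" using q by simp
    hence "ln (1 - q ^ Suc N) \<le> 0" using lt1[of N] by (intro ln_le_zero_iff[THEN iffD2]) auto
    thus "Q N \<le> Q (Suc N)" by (simp add: Q del: power_Suc)
  qed
  hence QE: "Q N \<le> E" for N using lim by (rule incseq_le)
  define p where "p = (\<lambda>n. real (card (partitions n)) * q ^ n)"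
  have p_nn: "p n \<ge> 0" for n using q by (simp add: p_def)
  have Qs: "(\<lambda>n. partition_weight (\<lambda>_. 1) {1..N} n * q ^ n) sums Q N" for N
    unfolding Q_def using q by (intro partition_weight_sums) auto
  have bound: "(\<Sum>n<m. p n) \<le> E" for m
  proof -
    have "(\<Sum>n<m. p n) = (\<Sum>n<m. partition_weight (\<lambda>_. 1) {1..m} n * q ^ n)"
      unfolding p_def by (intro sum.cong refl arg_cong2[of _ _ _ _ "(*)"] partition_weight_atMost[symmetric]) auto
    also have "\<dots> \<le> Q m"
      using Qs[of m] q by (intro sum_le_suminf[of "\<lambda>n. partition_weight (\<lambda>_. 1) {1..m} n * q ^ n", folded sums_unique[OF Qs]])
        (auto simp: sums_iff intro!: mult_nonneg_nonneg partition_weight_nonneg)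
    also have "\<dots> \<le> E" by (rule QE)
    finally show ?thesis .
  qed
  have summ: "summable p" using p_nn bound by (rule summableI_nonneg_bounded)
  have "suminf p \<le> E" using summ bound by (rule suminf_le_const)
  moreover have "E \<le> suminf p"
  proof (rule LIMSEQ_le_const2[OF lim], intro exI allI impI)
    fix N
    show "Q N \<le> suminf p"
    proof (rule sums_le[OF _ Qs summable_sums[OF summ]])
      show "partition_weight (\<lambda>_. 1) {1..N} n * q ^ n \<le> p n" for n
        unfolding p_def using q by (intro mult_right_mono partition_weight_le) auto
    qed
  qed
  ultimately show ?thesis using summ by (simp add: sums_iff p_def q_def E_def)
qed

text \<open>The real case gives absolute convergence in the unit disc, hence holomorphy of the
  series; the values on the positive axis then determine it.\<close>

theorem partition_gf:
  fixes t :: complex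
  assumes "Re t > 0"
  shows "(\<lambda>n. of_nat (card (partitions n)) * exp (- t) ^ n) sums exp (log_euler t)"
proof -
  define P where "P = (\<lambda>z::complex. \<Sum>n. of_nat (card (partitions n)) * z ^ n)"
  have conv: "(\<lambda>n. of_nat (card (partitions n)) * z ^ n) sums P z" if "norm z < 1" for z
  proof -
    have "summable (\<lambda>n. of_nat (card (partitions n)) * z ^ n)"
    proof (cases "z = 0")
      case False
      have "summable (\<lambda>n. real (card (partitions n)) * norm z ^ n)"
        using partition_gf_real[of "- ln (norm z)"] that False by (simp add: sums_iff)
      hence "summable (\<lambda>n. norm (of_nat (card (partitions n)) * z ^ n))"
        unfolding norm_mult norm_power norm_of_nat .
      thus ?thesis by (rule summable_norm_cancel)
    next
      case True
      show ?thesis unfolding True by (rule sums_summable[OF powser_sums_zero])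
    qed
    thus ?thesis unfolding P_def by (rule summable_sums)
  qed
  have hol: "P holomorphic_on ball 0 1"
    using conv by (intro power_series_holomorphic[where a = "\<lambda>n. of_nat (card (partitions n))"]) auto
  have norm_lt: "norm (exp (- s)) < 1" if "Re s > 0" for s :: complex using that by (simp add: norm_exp_eq_Re)
  have "P (exp (- t)) = exp (log_euler t)"
  proof (rule half_plane_identity[OF _ _ _ assms])
    show "(\<lambda>t. P (exp (- t))) holomorphic_on {t. Re t > 0}"
      by (rule holomorphic_on_compose_gen[OF _ hol, unfolded o_def]) (auto intro!: holomorphic_intros norm_lt)
    show "(\<lambda>t. exp (log_euler t)) holomorphic_on {t. Re t > 0}"
      by (intro holomorphic_intros holomorphic_log_euler)
    fix x :: real assume x: "x > 0"
    have "(\<lambda>n. complex_of_real (real (card (partitions n)) * exp (- x) ^ n)) sums of_real (exp (log_euler x))"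
      using partition_gf_real[OF x] by (rule sums_of_real)
    hence "(\<lambda>n. of_nat (card (partitions n)) * exp (- complex_of_real x) ^ n) sums of_real (exp (log_euler x))"
      by (simp add: exp_of_real flip: of_real_minus)
    thus "P (exp (- complex_of_real x)) = exp (log_euler (complex_of_real x))"
      using x by (simp add: P_def sums_iff log_euler_sums_real(2) exp_of_real)
  qed
  thus ?thesis using conv[OF norm_lt[OF assms]] by simp
qed

section \<open>The circle method for the partition function\<close>

text \<open>The primitive is arbitrary because it will be the imaginary part of a complex primitive
  along the imaginary axis.\<close>

lemma gaussian_antiderivative_limit:
  fixes F :: "real \<Rightarrow> real"
  assumes "\<And>x. (F has_real_derivative exp (- x\<^sup>2)) (at x)"
  shows "(\<lambda>n. F (real n) - F 0) \<longlonglongrightarrow> sqrt pi / 2"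
proof -
  have gauss: "has_bochner_integral lborel (\<lambda>x. indicator {0..} x *\<^sub>R exp (- x\<^sup>2)) (sqrt pi / 2)"
    by (rule gaussian_moment_0)
  have "((\<lambda>y. \<integral>x. indicator {..y} x *\<^sub>R (indicator {0..} x *\<^sub>R exp (- x\<^sup>2)) \<partial>lborel) \<longlongrightarrow> 
          (\<integral>x. indicator {0..} x *\<^sub>R exp (- x\<^sup>2) \<partial>(lborel :: real measure))) at_top"
    using gauss by (intro tendsto_integral_at_top) (auto simp: has_bochner_integral_iff)
  from filterlim_compose[OF this filterlim_real_sequentially]
  have "(\<lambda>n. \<integral>x. indicator {..real n} x *\<^sub>R (indicator {0..} x *\<^sub>R exp (- x\<^sup>2)) \<partial>lborel) \<longlonglongrightarrow> sqrt pi / 2"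
    unfolding has_bochner_integral_integral_eq[OF gauss] .
  also have "(\<lambda>n. \<integral>x. indicator {..real n} x *\<^sub>R (indicator {0..} x *\<^sub>R exp (- x\<^sup>2)) \<partial>lborel) =
      (\<lambda>n. F (real n) - F 0)"
  proof
    fix n :: nat
    have "(\<integral>x. exp (- x\<^sup>2) * indicator {0..real n} x \<partial>lborel) = F (real n) - F 0"
      using assms by (intro integral_FTC_Icc_real) (auto intro!: continuous_intros)
    also have "(\<lambda>x. exp (- x\<^sup>2) * indicator {0..real n} x :: real) =
       (\<lambda>x. indicator {..real n} x *\<^sub>R (indicator {0..} x *\<^sub>R exp (- x\<^sup>2)))"
      by (auto simp: indicator_def fun_eq_iff)
    finally show "(\<integral>x. indicator {..real n} x *\<^sub>R (indicator {0..} x *\<^sub>R exp (- x\<^sup>2)) \<partial>lborel) = F (real n) - F 0" .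
  qed
  finally show ?thesis .
qed

lemma has_integral_exp_period:
  fixes k :: int
  shows "((\<lambda>\<theta>. exp (of_int k * (of_real r + \<i> * of_real \<theta>))) has_integral (if k = 0 then of_real (2 * pi) else 0)) {-pi..pi}"
proof (cases "k = 0")
  case True
  have "((\<lambda>\<theta>::real. 1 :: complex) has_integral of_real (2 * pi)) {-pi..pi}"
    using has_integral_const_real[of "1 :: complex" "-pi" pi] by (simp add: scaleR_conv_of_real)
  thus ?thesis using True by simp
next
  case False
  define G where "G = (\<lambda>z::complex. exp (of_int k * (of_real r + \<i> * z)) / (\<i> * of_int k))"
  have "((\<lambda>\<theta>. exp (of_int k * (of_real r + \<i> * of_real \<theta>))) has_integral (G (of_real pi) - G (of_real (-pi)))) {-pi..pi}"
  proof (rule fundamental_theorem_of_calculus)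
    fix \<theta> :: real
    have "(G has_field_derivative exp (of_int k * (of_real r + \<i> * of_real \<theta>))) (at (of_real \<theta>))"
      unfolding G_def using False by (auto intro!: derivative_eq_intros)
    thus "((\<lambda>\<theta>. G (of_real \<theta>)) has_vector_derivative exp (of_int k * (of_real r + \<i> * of_real \<theta>))) (at \<theta> within {-pi..pi})"
      by (rule has_vector_derivative_real_field)
  qed auto
  moreover have "exp (of_int k * (of_real r + \<i> * of_real pi)) = exp (of_int k * (of_real r + \<i> * of_real (-pi)))"
    unfolding exp_eq by (intro exI[of _ k]) (simp add: algebra_simps)
  ultimately show ?thesis using False by (simp add: G_def)
qed

text \<open>Cauchy's coefficient formula in the variable t, where q = exp(-t): the series converges
  uniformly on the segment with real part \<open>r\<close>, and orthogonality of the exponentials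
  leaves the term m = n.\<close>

lemma partition_coefficient_integral:
  assumes "r > 0"
  shows "((\<lambda>\<theta>. exp (log_euler (of_real r + \<i> * of_real \<theta>)) * exp (of_nat n * (of_real r + \<i> * of_real \<theta>)))
           has_integral of_real (2 * pi * real (card (partitions n)))) {-pi..pi}"
proof -
  define c where "c = (\<lambda>m. card (partitions m))"
  define t where "t = (\<lambda>\<theta>::real. of_real r + \<i> * of_real \<theta> :: complex)"
  define f where "f = (\<lambda>\<theta>. exp (log_euler (t \<theta>)) * exp (of_nat n * t \<theta>))"
  define u where "u = (\<lambda>m \<theta>. of_nat (c m) * exp (- t \<theta>) ^ m * exp (of_nat n * t \<theta>))"
  have Re_t: "Re (t \<theta>) = r" for \<theta> by (simp add: t_def)
  have u_sums: "(\<lambda>m. u m \<theta>) sums f \<theta>" for \<theta>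
    unfolding u_def f_def c_def using assms by (intro sums_mult2 partition_gf) (simp add: Re_t)
  have u_eq: "u m \<theta> = of_nat (c m) * exp (of_int (int n - int m) * t \<theta>)" for m \<theta>
    unfolding u_def exp_of_nat_mult[symmetric] mult.assoc exp_add[symmetric]
    by (simp add: algebra_simps)
  have "uniform_limit {-pi..pi} (\<lambda>N \<theta>. \<Sum>m<N. u m \<theta>) (\<lambda>\<theta>. \<Sum>m. u m \<theta>) sequentially"
  proof (rule Weierstrass_m_test)
    show "norm (u m \<theta>) \<le> real (c m) * exp (- r) ^ m * exp (real n * r)" for m \<theta>
      by (simp add: u_def norm_mult norm_power norm_exp_eq_Re Re_t)
    show "summable (\<lambda>m. real (c m) * exp (- r) ^ m * exp (real n * r))"
      using partition_gf_real[OF assms] unfolding c_def by (intro summable_mult2) (simp add: sums_iff)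
  qed
  moreover have "(\<lambda>\<theta>. \<Sum>m. u m \<theta>) = f" using u_sums by (simp add: fun_eq_iff sums_iff)
  ultimately have lim: "uniform_limit {-pi..pi} (\<lambda>N \<theta>. \<Sum>m<N. u m \<theta>) f sequentially" by simp
  obtain I J where I: "\<And>N. ((\<lambda>\<theta>. \<Sum>m<N. u m \<theta>) has_integral I N) {-pi..pi}" "(f has_integral J) {-pi..pi}" "I \<longlonglongrightarrow> J"
    by (rule uniform_limit_integral[OF lim]) (auto simp: u_def t_def intro!: continuous_intros)
  have term_int: "(u m has_integral (if m = n then of_real (2 * pi * real (c n)) else 0)) {-pi..pi}" for m
  proof -
    have "(u m has_integral of_nat (c m) * (if int n - int m = 0 then of_real (2 * pi) else 0)) {-pi..pi}"
      unfolding u_eq t_def by (intro has_integral_mult_right has_integral_exp_period)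
    moreover have "of_nat (c m) * (if int n - int m = 0 then of_real (2 * pi) else 0 :: complex) =
         (if m = n then of_real (2 * pi * real (c n)) else 0)" by auto
    ultimately show ?thesis by simp
  qed
  have "I N = of_real (2 * pi * real (c n))" if "N > n" for N
  proof -
    have "((\<lambda>\<theta>. \<Sum>m<N. u m \<theta>) has_integral (\<Sum>m<N. if m = n then of_real (2 * pi * real (c n)) else 0)) {-pi..pi}"
      by (intro has_integral_sum term_int) auto
    with I(1)[of N] show ?thesis using that by (simp add: has_integral_unique sum.delta)
  qed
  hence "I \<longlonglongrightarrow> of_real (2 * pi * real (c n))"
    by (intro tendsto_eventually eventually_sequentiallyI[of "Suc n"]) auto
  with I(3) have "J = of_real (2 * pi * real (c n))" by (rule LIMSEQ_unique)
  with I(2) show ?thesis by (simp add: f_def t_def c_def)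
qed

text \<open>Going straight up from \<open>w\<close> shrinks exp(w^2) at least like exp(-s^2), so the
  whole ray costs at most |exp(w^2)| times half the Gaussian integral, and the value at its far end
  does not depend on \<open>w\<close>. Thus \<open>g w\<close> is a constant up to the size of its
  own derivative.\<close>

lemma gaussian_primitive_upper:
  assumes g: "\<And>w. (g has_field_derivative exp (w\<^sup>2)) (at w)" and g0: "g 0 = 0"
    and w: "Im w \<ge> 0"
  shows "norm (g w - \<i> * of_real (sqrt pi / 2)) \<le> sqrt pi / 2 * exp (Re (w\<^sup>2))"
proof -
  define k where "k = (\<lambda>s::real. g (\<i> * of_real s))"
  have k_deriv: "(k has_vector_derivative \<i> * of_real (exp (- s\<^sup>2))) (at s)" for s
  proof -
    have "((\<lambda>z. g (\<i> * z)) has_field_derivative exp ((\<i> * of_real s)\<^sup>2) * \<i>) (at (of_real s))"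
      by (rule DERIV_chain2[OF g]) (auto intro!: derivative_eq_intros)
    from has_vector_derivative_real_field[OF this, of UNIV]
    show ?thesis by (simp add: k_def power_mult_distrib exp_of_real mult.commute flip: of_real_power of_real_minus)
  qed
  \<comment> \<open>On the imaginary axis the primitive is purely imaginary, and its imaginary part
    is a primitive of exp(-s^2).\<close>
  define F where "F = (\<lambda>s. Im (k s))"
  have F: "(F has_real_derivative exp (- s\<^sup>2)) (at s)" "((\<lambda>s. Re (k s)) has_real_derivative 0) (at s)" for s
    using k_deriv[of s] unfolding has_vector_derivative_complex_iff F_def by simp_all
  have k0: "k 0 = 0" by (simp add: k_def g0)
  have k_eq: "k s = \<i> * of_real (F s)" for s
    using DERIV_isconst_all[of "\<lambda>s. Re (k s)" s 0] F(2) k0 by (simp add: complex_eq_iff F_def)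
  have F_lim: "(\<lambda>n. F (real n)) \<longlonglongrightarrow> sqrt pi / 2"
    using gaussian_antiderivative_limit[of F] F(1) k0 by (simp add: F_def)
  have k_lim: "(\<lambda>n. k (real n)) \<longlonglongrightarrow> \<i> * of_real (sqrt pi / 2)"
    unfolding k_eq by (intro tendsto_intros F_lim)
  \<comment> \<open>The ray above \<open>w\<close> and the imaginary axis are compared along the
    segment from i s to w + i s, where the derivative is of order exp(-s^2); so both have the same
    limit.\<close>
  have far: "norm (g (w + \<i> * of_real s) - k s) \<le> exp ((norm w)\<^sup>2 - s\<^sup>2) * norm w" if "s \<ge> 0" for s :: real
  proof -
    have "norm (g (w + \<i> * of_real s) - g (\<i> * of_real s)) \<le>
        exp ((norm w)\<^sup>2 - s\<^sup>2) * norm ((w + \<i> * of_real s) - \<i> * of_real s)"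
    proof (rule field_differentiable_bound[where f' = "\<lambda>w. exp (w\<^sup>2)" and S = "closed_segment (\<i> * of_real s) (w + \<i> * of_real s)"])
      fix z assume "z \<in> closed_segment (\<i> * of_real s) (w + \<i> * of_real s)"
      then obtain v where v: "0 \<le> v" "v \<le> 1" "z = (1 - v) *\<^sub>R (\<i> * of_real s) + v *\<^sub>R (w + \<i> * of_real s)"
        by (auto simp: closed_segment_def)
      hence z: "z = of_real v * w + \<i> * of_real s" by (simp add: scaleR_conv_of_real algebra_simps)
      have "Re (z\<^sup>2) = v\<^sup>2 * Re (w\<^sup>2) - s\<^sup>2 - 2 * v * s * Im w"
        by (simp add: z power2_eq_square algebra_simps)
      also have "\<dots> \<le> (norm w)\<^sup>2 - s\<^sup>2"
      proof -
        have "v\<^sup>2 * Re (w\<^sup>2) \<le> 1 * (norm w)\<^sup>2"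
        proof (rule order.trans[OF mult_left_mono mult_right_mono])
          show "Re (w\<^sup>2) \<le> (norm w)\<^sup>2" using complex_Re_le_cmod[of "w\<^sup>2"] by (simp add: norm_power)
          show "v\<^sup>2 \<le> 1" using v by (simp add: power_le_one)
        qed auto
        moreover have "2 * v * s * Im w \<ge> 0" using v that w by simp
        ultimately show ?thesis by linarith
      qed
      finally show "norm (exp (z\<^sup>2)) \<le> exp ((norm w)\<^sup>2 - s\<^sup>2)" by (simp add: norm_exp_eq_Re)
    qed (auto intro: g[THEN DERIV_subset])
    thus ?thesis by (simp add: k_def)
  qed
  have "(\<lambda>n. g (w + \<i> * of_real (real n)) - k (real n)) \<longlonglongrightarrow> 0"
  proof (rule Lim_null_comparison)
    show "\<forall>\<^sub>F n in sequentially. norm (g (w + \<i> * of_real (real n)) - k (real n)) \<le> exp ((norm w)\<^sup>2 - (real n)\<^sup>2) * norm w"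
      by (intro always_eventually allI far) simp
    show "(\<lambda>n. exp ((norm w)\<^sup>2 - (real n)\<^sup>2) * norm w) \<longlonglongrightarrow> 0" by real_asymp
  qed
  from tendsto_add[OF this k_lim] have lim: "(\<lambda>n. g (w + \<i> * of_real (real n))) \<longlonglongrightarrow> \<i> * of_real (sqrt pi / 2)" by simp
  have near: "norm (g (w + \<i> * of_real s) - g w) \<le> exp (Re (w\<^sup>2)) * F s" if "s \<ge> 0" for s :: real
  proof (cases "s = 0")
    case True
    thus ?thesis using k0 by (simp add: F_def)
  next
    case False
    define h where "h = (\<lambda>s::real. g (w + \<i> * of_real s))"
    have h: "(h has_vector_derivative exp ((w + \<i> * of_real s)\<^sup>2) * \<i>) (at s)" for s
    proof -
      have "((\<lambda>z. g (w + \<i> * z)) has_field_derivative exp ((w + \<i> * of_real s)\<^sup>2) * \<i>) (at (of_real s))"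
        by (rule DERIV_chain2[OF g]) (auto intro!: derivative_eq_intros)
      from has_vector_derivative_real_field[OF this, of UNIV] show ?thesis by (simp add: h_def)
    qed
    define \<phi> where "\<phi> = (\<lambda>s. exp (Re (w\<^sup>2)) * F s)"
    have \<phi>: "(\<phi> has_vector_derivative exp (Re (w\<^sup>2)) * exp (- s\<^sup>2)) (at s)" for s
      unfolding \<phi>_def has_real_derivative_iff_has_vector_derivative[symmetric]
      by (auto intro!: derivative_eq_intros F)
    have "norm (h s - h 0) \<le> \<phi> s - \<phi> 0"
    proof (rule differentiable_bound_general)
      show "0 < s" using that False by simp
      show "continuous_on {0..s} h" "continuous_on {0..s} \<phi>"
        using h \<phi> by (auto intro!: continuous_at_imp_continuous_on has_vector_derivative_continuous)
      fix y assume y: "0 < y" "y < s"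
      show "(h has_vector_derivative exp ((w + \<i> * of_real y)\<^sup>2) * \<i>) (at y)" by (rule h)
      show "(\<phi> has_vector_derivative exp (Re (w\<^sup>2)) * exp (- y\<^sup>2)) (at y)" by (rule \<phi>)
      \<comment> \<open>The cross term has the favourable sign because \<open>Im w\<close> is
        nonnegative.\<close>
      have "Re ((w + \<i> * of_real y)\<^sup>2) = Re (w\<^sup>2) - y\<^sup>2 - 2 * y * Im w"
        by (simp add: power2_eq_square algebra_simps)
      also have "\<dots> \<le> Re (w\<^sup>2) + (- y\<^sup>2)" using y w by simp
      finally show "norm (exp ((w + \<i> * of_real y)\<^sup>2) * \<i>) \<le> exp (Re (w\<^sup>2)) * exp (- y\<^sup>2)"
        by (simp add: norm_mult norm_exp_eq_Re flip: exp_add)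
    qed
    thus ?thesis using k0 by (simp add: h_def \<phi>_def F_def)
  qed
  have "norm (\<i> * of_real (sqrt pi / 2) - g w) \<le> exp (Re (w\<^sup>2)) * (sqrt pi / 2)"
  proof (rule LIMSEQ_le)
    show "(\<lambda>n. norm (g (w + \<i> * of_real (real n)) - g w)) \<longlonglongrightarrow> norm (\<i> * of_real (sqrt pi / 2) - g w)"
      by (intro tendsto_intros lim)
    show "(\<lambda>n. exp (Re (w\<^sup>2)) * F (real n)) \<longlonglongrightarrow> exp (Re (w\<^sup>2)) * (sqrt pi / 2)"
      by (intro tendsto_intros F_lim)
    show "\<exists>N. \<forall>n\<ge>N. norm (g (w + \<i> * of_real (real n)) - g w) \<le> exp (Re (w\<^sup>2)) * F (real n)"
      by (intro exI allI impI near) simp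
  qed
  thus ?thesis by (simp add: norm_minus_commute mult.commute)
qed

lemma gaussian_primitive_lower:
  assumes g: "\<And>w. (g has_field_derivative exp (w\<^sup>2)) (at w)" and g0: "g 0 = 0"
    and w: "Im w \<le> 0"
  shows "norm (g w + \<i> * of_real (sqrt pi / 2)) \<le> sqrt pi / 2 * exp (Re (w\<^sup>2))"
proof -
  have "((\<lambda>w. - g (- w)) has_field_derivative exp (z\<^sup>2)) (at z)" for z
    using DERIV_minus[OF DERIV_chain2[OF g[of "- z"] DERIV_minus[OF DERIV_ident]]] by simp
  from gaussian_primitive_upper[of "\<lambda>w. - g (- w)", OF this, of "- w"] g0 w
  show ?thesis by (simp add: norm_minus_commute) (metis norm_minus_cancel minus_add_distrib uminus_add_conv_diff diff_conv_add_uminus)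
qed

text \<open>The substitution t = 2 pi v^2 turns the integrand into 4 pi v^2 exp(E(v)) dv up to a
  factor i, and E(v) = (a v - b/v)^2 + 2ab = (a v + b/v)^2 - 2ab. So v exp(E(v)) together with the
  primitive of exp(w^2) at these two points gives an antiderivative. At the endpoints each primitive
  is close to plus or minus i sqrt(pi)/2, and these constants make the main term. The hypothesis on
  r/(2 pi) puts a v + b/v into the right half-plane of w there; b >= 1/(2a) makes the coefficient
  \<open>A\<close> nonnegative.\<close>

lemma main_arc_integral:
  fixes a b r T :: real
  defines "u \<equiv> \<lambda>t. csqrt (t / of_real (2 * pi))"
  defines "E \<equiv> \<lambda>v::complex. of_real (a\<^sup>2) * v\<^sup>2 + of_real (b\<^sup>2) / v\<^sup>2"
  defines "u1 \<equiv> u (of_real r + \<i> * of_real T)"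
  defines "K \<equiv> 2 * pi / a\<^sup>2"
  assumes a: "a > 0" and b: "b > 0" and r: "r > 0" and T: "T > 0" and rab: "r / (2 * pi) \<ge> b / a" and ab: "b \<ge> 1 / (2 * a)"
  obtains I where
    "((\<lambda>\<theta>. u (of_real r + \<i> * of_real \<theta>) * exp (E (u (of_real r + \<i> * of_real \<theta>)))) has_integral I) {-T..T}"
    "norm (I - of_real (K * sqrt pi * ((b - 1 / (2 * a)) * exp (2 * a * b) - (b + 1 / (2 * a)) * exp (- (2 * a * b)))))
       \<le> K * exp (Re (E u1)) * (2 * norm u1 + 2 * sqrt pi * b)"
proof -
  have "(\<lambda>w::complex. exp (w\<^sup>2)) holomorphic_on UNIV" by (intro holomorphic_intros)
  hence "\<exists>g0. \<forall>w::complex\<in>UNIV. (g0 has_field_derivative exp (w\<^sup>2)) (at w within UNIV)"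
  proof (rule holomorphic_convex_primitive'[OF convex_UNIV open_UNIV])
    fix g :: "complex \<Rightarrow> complex"
    assume "\<And>x. x \<in> UNIV \<Longrightarrow> (g has_field_derivative exp (x\<^sup>2)) (at x within UNIV)"
    thus ?thesis by blast
  qed
  then obtain g0 where g0: "\<And>w::complex. (g0 has_field_derivative exp (w\<^sup>2)) (at w)" by auto
  define g where "g = (\<lambda>w. g0 w - g0 0)"
  have g: "(g has_field_derivative exp (w\<^sup>2)) (at w)" for w
    unfolding g_def using g0[of w] by (auto intro!: derivative_eq_intros)
  have g_0: "g 0 = 0" by (simp add: g_def)
  \<comment> \<open>The solution of A - B = -1/a and A + B = 2b. These cancel the terms 1 and -2
    b^2/v^2 in the derivative of v exp(E(v)), which is exp(E(v)) (1 + 2 a^2 v^2 - 2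
    b^2/v^2).\<close>
  define A B where "A = b - 1 / (2 * a)" and "B = b + 1 / (2 * a)"
  define w1 w2 where "w1 = (\<lambda>v::complex. of_real a * v - of_real b / v)" and "w2 = (\<lambda>v::complex. of_real a * v + of_real b / v)"
  define H where "H = (\<lambda>v. of_real K * (v * exp (E v) + of_real (A * exp (2 * a * b)) * g (w1 v) - of_real (B * exp (- (2 * a * b))) * g (w2 v)))"
  have w1_sq: "(w1 v)\<^sup>2 = E v - of_real (2 * a * b)" and w2_sq: "(w2 v)\<^sup>2 = E v + of_real (2 * a * b)" if "v \<noteq> 0" for v
    using that by (simp_all add: w1_def w2_def E_def power2_eq_square field_simps)
  have exp_w1: "of_real (exp (2 * a * b)) * exp ((w1 v)\<^sup>2) = exp (E v)"
    and exp_w2: "of_real (exp (- (2 * a * b))) * exp ((w2 v)\<^sup>2) = exp (E v)" if "v \<noteq> 0" for v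
    unfolding w1_sq[OF that] w2_sq[OF that] exp_of_real[symmetric] exp_add[symmetric] by simp_all
  have H_deriv: "(H has_field_derivative of_real (4 * pi) * v\<^sup>2 * exp (E v)) (at v)" if v: "v \<noteq> 0" for v
  proof -
    have dE: "(E has_field_derivative of_real (2 * a\<^sup>2) * v - of_real (2 * b\<^sup>2) / v ^ 3) (at v)"
      unfolding E_def using v by (auto intro!: derivative_eq_intros simp: field_simps power2_eq_square power3_eq_cube)
    have d1: "(w1 has_field_derivative of_real a + of_real b / v\<^sup>2) (at v)"
      unfolding w1_def using v by (auto intro!: derivative_eq_intros simp: field_simps power2_eq_square)
    have d2: "(w2 has_field_derivative of_real a - of_real b / v\<^sup>2) (at v)"
      unfolding w2_def using v by (auto intro!: derivative_eq_intros simp: field_simps power2_eq_square)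
    have "(H has_field_derivative of_real K * (1 * exp (E v) + exp (E v) * (of_real (2 * a\<^sup>2) * v - of_real (2 * b\<^sup>2) / v ^ 3) * v
        + of_real (A * exp (2 * a * b)) * (exp ((w1 v)\<^sup>2) * (of_real a + of_real b / v\<^sup>2))
        - of_real (B * exp (- (2 * a * b))) * (exp ((w2 v)\<^sup>2) * (of_real a - of_real b / v\<^sup>2)))) (at v)"
      unfolding H_def
      by (intro DERIV_cmult DERIV_add DERIV_diff DERIV_mult DERIV_ident DERIV_chain2[OF DERIV_exp dE]
            DERIV_chain2[OF g d1] DERIV_chain2[OF g d2])
    also have "of_real (A * exp (2 * a * b)) * (exp ((w1 v)\<^sup>2) * (of_real a + of_real b / v\<^sup>2)) =
        exp (E v) * (of_real A * (of_real a + of_real b / v\<^sup>2))"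
      unfolding exp_w1[OF v, symmetric] by simp
    also have "of_real (B * exp (- (2 * a * b))) * (exp ((w2 v)\<^sup>2) * (of_real a - of_real b / v\<^sup>2)) =
        exp (E v) * (of_real B * (of_real a - of_real b / v\<^sup>2))"
      unfolding exp_w2[OF v, symmetric] by simp
    also have "of_real K * (1 * exp (E v) + exp (E v) * (of_real (2 * a\<^sup>2) * v - of_real (2 * b\<^sup>2) / v ^ 3) * v
        + exp (E v) * (of_real A * (of_real a + of_real b / v\<^sup>2)) - exp (E v) * (of_real B * (of_real a - of_real b / v\<^sup>2)))
        = of_real K * exp (E v) * (1 + (of_real (2 * a\<^sup>2) * v - of_real (2 * b\<^sup>2) / v ^ 3) * v
        + of_real A * (of_real a + of_real b / v\<^sup>2) - of_real B * (of_real a - of_real b / v\<^sup>2))"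
      by (simp add: algebra_simps)
    also have "1 + (of_real (2 * a\<^sup>2) * v - of_real (2 * b\<^sup>2) / v ^ 3) * v
        + of_real A * (of_real a + of_real b / v\<^sup>2) - of_real B * (of_real a - of_real b / v\<^sup>2) = of_real (2 * a\<^sup>2) * v\<^sup>2"
      using v a by (simp add: A_def B_def field_simps power2_eq_square power3_eq_cube)
    also have "of_real K * exp (E v) * (of_real (2 * a\<^sup>2) * v\<^sup>2) = of_real (4 * pi) * v\<^sup>2 * exp (E v)"
      using a by (simp add: K_def field_simps)
    finally show ?thesis .
  qed
  define t where "t = (\<lambda>\<theta>::real. of_real r + \<i> * of_real \<theta> :: complex)"
  have nonpos: "t \<theta> / of_real (2 * pi) \<notin> \<real>\<^sub>\<le>\<^sub>0" for \<theta>
    using r by (auto simp: t_def complex_nonpos_Reals_iff divide_le_0_iff not_le)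
  have u_nz: "u (t \<theta>) \<noteq> 0" for \<theta>
    using nonpos[of \<theta>] by (auto simp: u_def)
  have u_sq: "(u z)\<^sup>2 = z / of_real (2 * pi)" for z by (simp add: u_def)
  have integral: "((\<lambda>\<theta>. u (t \<theta>) * exp (E (u (t \<theta>)))) has_integral (H (u (t T)) / \<i> - H (u (t (-T))) / \<i>)) {-T..T}"
  proof (rule fundamental_theorem_of_calculus)
    show "-T \<le> T" using T by simp
    fix \<theta> :: real
    define v where "v = u (t \<theta>)"
    have v: "v \<noteq> 0" using u_nz by (simp add: v_def)
    have du: "((\<lambda>z. u (of_real r + \<i> * z)) has_field_derivative (\<i> / of_real (2 * pi)) / (2 * v)) (at (of_real \<theta>))"
      unfolding u_def v_def t_def
      by (rule DERIV_cong[OF has_field_derivative_csqrt'])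
        (use nonpos[of \<theta>] in \<open>auto intro!: derivative_eq_intros simp: t_def\<close>)
    have "((\<lambda>z. H (u (of_real r + \<i> * z)) / \<i>) has_field_derivative
        (of_real (4 * pi) * v\<^sup>2 * exp (E v)) * ((\<i> / of_real (2 * pi)) / (2 * v)) / \<i>) (at (of_real \<theta>))"
      by (intro DERIV_cdivide DERIV_chain2[OF _ du]) (use H_deriv[OF v] in \<open>simp add: v_def t_def\<close>)
    also have "(of_real (4 * pi) * v\<^sup>2 * exp (E v)) * ((\<i> / of_real (2 * pi)) / (2 * v)) / \<i> = v * exp (E v)"
      using v by (simp add: field_simps power2_eq_square)
    finally show "((\<lambda>\<theta>. H (u (t \<theta>)) / \<i>) has_vector_derivative u (t \<theta>) * exp (E (u (t \<theta>)))) (at \<theta> within {-T..T})"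
      unfolding t_def v_def by (rule has_vector_derivative_real_field)
  qed
  define v1 v2 where "v1 = u (t T)" and "v2 = u (t (-T))"
  have v1: "v1 \<noteq> 0" "v2 \<noteq> 0" by (simp_all add: v1_def v2_def u_nz)
  have v2: "v2 = cnj v1"
  proof -
    have "cnj (t T / of_real (2 * pi)) = t (-T) / of_real (2 * pi)" by (simp add: t_def)
    thus ?thesis unfolding v1_def v2_def u_def by (metis cnj_csqrt nonpos)
  qed
  have E_cnj: "E v2 = cnj (E v1)" by (simp add: v2 E_def)
  have Im_sq: "Im (v1\<^sup>2) > 0" using T by (simp add: v1_def u_sq t_def)
  have Re_v1: "Re v1 > 0"
  proof -
    have "Re v1 \<ge> 0" unfolding v1_def u_def using Re_csqrt by blast
    moreover have "Re v1 \<noteq> 0" using Im_sq by (auto simp: power2_eq_square)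
    ultimately show ?thesis by simp
  qed
  have Im_v1: "Im v1 > 0" using Im_sq Re_v1 by (simp add: power2_eq_square zero_less_mult_iff)
  have norm_sq: "(norm v1)\<^sup>2 \<ge> b / a"
  proof -
    have "b / a \<le> r / (2 * pi)" by (rule rab)
    also have "\<dots> = Re (v1\<^sup>2)" by (simp add: v1_def u_sq t_def)
    also have "\<dots> \<le> norm (v1\<^sup>2)" by (rule complex_Re_le_cmod)
    finally show ?thesis by (simp add: norm_power)
  qed
  have Im_inv: "Im (of_real b / v1) = - (b * Im v1 / (norm v1)\<^sup>2)"
    by (simp add: Im_divide cmod_power2)
  have Im_w1: "Im (w1 v1) \<ge> 0"
  proof -
    have "Im (w1 v1) = a * Im v1 + b * Im v1 / (norm v1)\<^sup>2" by (simp add: w1_def Im_inv)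
    thus ?thesis using a b Im_v1 by simp
  qed
  have Im_w2: "Im (w2 v1) \<ge> 0"
  proof -
    have "b / (norm v1)\<^sup>2 \<le> a"
      using norm_sq a v1 by (simp add: field_simps)
    hence "b / (norm v1)\<^sup>2 * Im v1 \<le> a * Im v1" using Im_v1 by (intro mult_right_mono) auto
    moreover have "Im (w2 v1) = a * Im v1 - b / (norm v1)\<^sup>2 * Im v1" by (simp add: w2_def Im_inv)
    ultimately show ?thesis by simp
  qed
  have w_cnj: "w1 v2 = cnj (w1 v1)" "w2 v2 = cnj (w2 v1)" by (simp_all add: v2 w1_def w2_def)
  define c :: complex where "c = \<i> * of_real (sqrt pi / 2)"
  define R where "R = sqrt pi / 2 * exp (Re (E v1))"
  have up: "norm (g w - c) \<le> sqrt pi / 2 * exp (Re (w\<^sup>2))" if "Im w \<ge> 0" for w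
    unfolding c_def by (rule gaussian_primitive_upper[OF g g_0 that])
  have low: "norm (g w + c) \<le> sqrt pi / 2 * exp (Re (w\<^sup>2))" if "Im w \<le> 0" for w
    unfolding c_def by (rule gaussian_primitive_lower[OF g g_0 that])
  have scale1: "exp (2 * a * b) * (sqrt pi / 2 * exp (Re ((w1 v1)\<^sup>2))) = R"
    unfolding w1_sq[OF v1(1)] R_def by (simp flip: exp_add)
  have scale2: "exp (- (2 * a * b)) * (sqrt pi / 2 * exp (Re ((w2 v1)\<^sup>2))) = R"
    unfolding w2_sq[OF v1(1)] R_def by (simp flip: exp_add)
  have Re_cnj_sq: "Re ((cnj w)\<^sup>2) = Re (w\<^sup>2)" for w by (simp add: power2_eq_square)
  have e1: "norm (of_real (exp (2 * a * b)) * (g (w1 v1) - c)) \<le> R"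
    unfolding norm_mult norm_of_real abs_exp_cancel scale1[symmetric] by (intro mult_left_mono up Im_w1) simp
  have "norm (g (w1 v2) + c) \<le> sqrt pi / 2 * exp (Re ((w1 v1)\<^sup>2))"
    using low[of "w1 v2"] Im_w1 unfolding w_cnj Re_cnj_sq by simp
  hence e2: "norm (of_real (exp (2 * a * b)) * (g (w1 v2) + c)) \<le> R"
    unfolding norm_mult norm_of_real abs_exp_cancel scale1[symmetric] by (intro mult_left_mono) auto
  have e3: "norm (of_real (exp (- (2 * a * b))) * (g (w2 v1) - c)) \<le> R"
    unfolding norm_mult norm_of_real abs_exp_cancel scale2[symmetric] by (intro mult_left_mono up Im_w2) simp
  have "norm (g (w2 v2) + c) \<le> sqrt pi / 2 * exp (Re ((w2 v1)\<^sup>2))"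
    using low[of "w2 v2"] Im_w2 unfolding w_cnj Re_cnj_sq by simp
  hence e4: "norm (of_real (exp (- (2 * a * b))) * (g (w2 v2) + c)) \<le> R"
    unfolding norm_mult norm_of_real abs_exp_cancel scale2[symmetric] by (intro mult_left_mono) auto
  have AB: "A \<ge> 0" "B \<ge> 0" using a b ab by (auto simp: A_def B_def intro: add_nonneg_nonneg)
  have K: "K > 0" using a by (simp add: K_def)
  define I where "I = H v1 / \<i> - H v2 / \<i>"
  define M where "M = K * sqrt pi * (A * exp (2 * a * b) - B * exp (- (2 * a * b)))"
  define D1 D2 where "D1 = of_real (exp (2 * a * b)) * (g (w1 v1) - c) - of_real (exp (2 * a * b)) * (g (w1 v2) + c)"
    and "D2 = of_real (exp (- (2 * a * b))) * (g (w2 v1) - c) - of_real (exp (- (2 * a * b))) * (g (w2 v2) + c)"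
  \<comment> \<open>With the constants 2c = i sqrt(pi) split off into \<open>M\<close>, there remain
    the boundary values of v exp(E(v)) and four deviations of the primitive, each of norm at most
    \<open>R\<close>.\<close>
  have "\<i> * (I - of_real M) = of_real K * ((v1 * exp (E v1) - v2 * exp (E v2)) + of_real A * D1 - of_real B * D2)"
    by (simp add: I_def M_def H_def D1_def D2_def c_def algebra_simps)
  hence "norm (\<i> * (I - of_real M)) = norm (of_real K * ((v1 * exp (E v1) - v2 * exp (E v2)) + of_real A * D1 - of_real B * D2))"
    by (rule arg_cong)
  hence "norm (I - of_real M) = K * norm ((v1 * exp (E v1) - v2 * exp (E v2)) + of_real A * D1 - of_real B * D2)"
    using K by (simp only: norm_mult norm_ii mult_1 norm_of_real abs_of_pos)
  also have "\<dots> \<le> K * ((norm v1 * exp (Re (E v1)) + norm v1 * exp (Re (E v1))) + A * (R + R) + B * (R + R))"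
  proof (intro mult_left_mono)
    have "norm (v1 * exp (E v1) - v2 * exp (E v2)) \<le> norm v1 * exp (Re (E v1)) + norm v1 * exp (Re (E v1))"
    proof -
      have "norm (v2 * exp (E v2)) = norm v1 * exp (Re (E v1))"
        unfolding norm_mult norm_exp_eq_Re E_cnj by (simp add: v2)
      moreover have "norm (v1 * exp (E v1)) = norm v1 * exp (Re (E v1))"
        unfolding norm_mult norm_exp_eq_Re ..
      ultimately show ?thesis using norm_triangle_ineq4[of "v1 * exp (E v1)" "v2 * exp (E v2)"] by linarith
    qed
    moreover have "norm (of_real A * D1) \<le> A * (R + R)"
    proof -
      have "norm D1 \<le> R + R" unfolding D1_def by (rule order.trans[OF norm_triangle_ineq4 add_mono[OF e1 e2]])
      thus ?thesis unfolding norm_mult norm_of_real using AB by (simp add: mult_left_mono)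
    qed
    moreover have "norm (of_real B * D2) \<le> B * (R + R)"
    proof -
      have "norm D2 \<le> R + R" unfolding D2_def by (rule order.trans[OF norm_triangle_ineq4 add_mono[OF e3 e4]])
      thus ?thesis unfolding norm_mult norm_of_real using AB by (simp add: mult_left_mono)
    qed
    ultimately show "norm ((v1 * exp (E v1) - v2 * exp (E v2)) + of_real A * D1 - of_real B * D2) \<le>
        (norm v1 * exp (Re (E v1)) + norm v1 * exp (Re (E v1))) + A * (R + R) + B * (R + R)"
      using norm_triangle_ineq4[of "(v1 * exp (E v1) - v2 * exp (E v2)) + of_real A * D1" "of_real B * D2"]
        norm_triangle_ineq[of "v1 * exp (E v1) - v2 * exp (E v2)" "of_real A * D1"] by linarith
  qed (use K in auto)
  also have "\<dots> = K * exp (Re (E v1)) * (2 * norm v1 + 2 * sqrt pi * b)"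
    by (simp add: A_def B_def R_def algebra_simps)
  finally have "norm (I - of_real M) \<le> K * exp (Re (E v1)) * (2 * norm v1 + 2 * sqrt pi * b)" .
  thus ?thesis
    using that[of I] integral by (simp add: I_def M_def v1_def v2_def u1_def t_def A_def B_def)
qed

section \<open>Bounds for the generating function on and off the major arc\<close>

lemma log_euler_real_le:
  fixes t :: real
  assumes "t > 0"
  shows "log_euler t \<le> pi\<^sup>2 / (6 * t)"
proof (rule sums_le[OF _ log_euler_sums_real(1)[OF assms]])
  show "(\<lambda>k. 1 / t * (1 / (real (Suc k))\<^sup>2)) sums (pi\<^sup>2 / (6 * t))"
    using sums_mult[OF inverse_squares_sums, of "1 / t"] by (simp add: add_ac mult.commute)
  fix k
  define m where "m = real (Suc k)"
  have m: "m > 0" by (simp add: m_def)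
  have "m * t \<le> exp (m * t) - 1" using exp_ge_add_one_self[of "m * t"] by linarith
  hence "m * (m * t) \<le> m * (exp (m * t) - 1)" using m by (intro mult_left_mono) auto
  moreover have "m * (m * t) > 0" using m assms by simp
  ultimately have "1 / (m * (exp (m * t) - 1)) \<le> 1 / (m * (m * t))"
    by (intro frac_le) auto
  thus "1 / (real (Suc k) * (exp (real (Suc k) * t) - 1)) \<le> 1 / t * (1 / (real (Suc k))\<^sup>2)"
    unfolding m_def[symmetric] by (simp add: power2_eq_square mult_ac)
qed

text \<open>Only the first term of the Lambert series is allowed to notice that \<open>t\<close> is
  not real; all others are replaced by their values at \<open>r\<close>. The drop of this one term
  from 1/(exp(r) - 1) to 1/d is the whole saving on the minor arc.\<close>

lemma norm_exp_log_euler_le: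
  fixes t :: complex
  assumes r: "Re t = r" "r > 0" and d: "norm (exp t - 1) \<ge> d" "d > 0"
  shows "norm (exp (log_euler t)) \<le> exp (log_euler r - 1 / (exp r - 1) + 1 / d)"
proof -
  define u where "u = (\<lambda>k. 1 / (of_nat (Suc k) * (exp (of_nat (Suc k) * t) - 1)))"
  define v where "v = (\<lambda>k. 1 / (real (Suc k) * (exp (real (Suc k) * r) - 1)))"
  \<comment> \<open>The majorant: \<open>v\<close> with its first entry replaced by
    \<open>1 / d\<close>.\<close>
  define w where "w = (\<lambda>k. v k + (if k = 0 then 1 / d - v 0 else 0))"
  have u: "u sums log_euler t" unfolding u_def using log_euler_sums_complex r by simp
  have "(\<lambda>k. if k = 0 then 1 / d - v 0 else 0) sums (1 / d - v 0)"
    using sums_single[of 0 "\<lambda>_. 1 / d - v 0"] by simp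
  hence w: "w sums (log_euler r + (1 / d - v 0))"
    unfolding w_def v_def using log_euler_sums_real(1)[OF r(2)] by (intro sums_add) auto
  have le: "norm (u k) \<le> w k" for k
  proof (cases "k = 0")
    case True
    have "1 / norm (exp t - 1) \<le> 1 / d" using d by (intro divide_left_mono) (auto intro!: mult_pos_pos)
    thus ?thesis using True by (simp add: u_def w_def norm_divide)
  next
    case False
    define m where "m = real (Suc k)"
    have m: "m > 0" by (simp add: m_def)
    have pos: "exp (m * r) - 1 > 0" using m r by simp
    have "exp (m * r) - 1 \<le> norm (exp (of_real m * t) - 1)"
      using norm_exp_minus_one_ge[of "of_real m * t"] r by simp
    hence "m * (exp (m * r) - 1) \<le> m * norm (exp (of_real m * t) - 1)" using m by (intro mult_left_mono) auto
    moreover have "m * (exp (m * r) - 1) > 0" using m pos by (rule mult_pos_pos)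
    ultimately have "1 / (m * norm (exp (of_real m * t) - 1)) \<le> 1 / (m * (exp (m * r) - 1))"
      by (intro frac_le) auto
    moreover have "norm (u k) = 1 / (m * norm (exp (of_real m * t) - 1))"
      by (simp add: u_def m_def norm_divide norm_mult flip: of_nat_Suc)
    moreover have "w k = 1 / (m * (exp (m * r) - 1))" using False by (simp add: w_def v_def m_def)
    ultimately show ?thesis by simp
  qed
  have "summable (\<lambda>k. norm (u k))"
    using le by (intro summable_comparison_test'[OF sums_summable[OF w]]) auto
  hence "norm (log_euler t) \<le> (\<Sum>k. norm (u k))"
    using summable_norm[of u] u by (simp add: sums_iff)
  also have "\<dots> \<le> (\<Sum>k. w k)"
    using le \<open>summable (\<lambda>k. norm (u k))\<close> w by (intro suminf_le) (auto simp: sums_iff)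
  also have "\<dots> = log_euler r + (1 / d - v 0)" using w by (simp add: sums_iff)
  finally have "Re (log_euler t) \<le> log_euler r - 1 / (exp r - 1) + 1 / d"
    using complex_Re_le_cmod[of "log_euler t"] by (simp add: v_def)
  thus ?thesis by (simp add: norm_exp_eq_Re)
qed

text \<open>Without the constant term the partition series contains only powers exp(-n z) with n >=
  1, and its coefficients are nonnegative. So each term is at most exp(s - Re z) times the
  corresponding term at \<open>s\<close>.\<close>

lemma norm_exp_log_euler_minus_one_le:
  fixes z :: complex
  assumes "0 < s" "s \<le> Re z"
  shows "norm (exp (log_euler z) - 1) \<le> exp (s - Re z) * exp (log_euler s)"
proof -
  define c where "c = (\<lambda>n. card (partitions n))"
  define y where "y = Re z"
  have c0: "c 0 = 1"
  proof -
    have "partitions 0 = {{#}}"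
    proof (intro equalityI subsetI)
      fix l assume "l \<in> partitions 0"
      hence l: "0 \<notin># l" "sum_mset l = 0" by (auto simp: partitions_def)
      have "l = {#}"
      proof (rule ccontr)
        assume "l \<noteq> {#}"
        then obtain i where i: "i \<in># l" by blast
        hence "i \<le> 0" using member_le_sum_mset[OF i] l by simp
        thus False using i l by simp
      qed
      thus "l \<in> {{#}}" by simp
    qed (simp add: partitions_def)
    thus ?thesis by (simp add: c_def)
  qed
  have z: "Re z > 0" using assms by simp
  have 1: "(\<lambda>n. of_nat (c (Suc n)) * exp (- z) ^ Suc n) sums (exp (log_euler z) - 1)"
    using partition_gf[OF z] c0 by (subst sums_Suc_iff) (simp add: c_def)
  have 2: "(\<lambda>n. real (c (Suc n)) * exp (- s) ^ Suc n) sums (exp (log_euler s) - 1)"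
    using partition_gf_real[OF assms(1)] c0 by (subst sums_Suc_iff) (simp add: c_def)
  have 3: "(\<lambda>n. exp (s - y) * (real (c (Suc n)) * exp (- s) ^ Suc n)) sums (exp (s - y) * (exp (log_euler s) - 1))"
    using 2 by (rule sums_mult)
  have le: "norm (of_nat (c (Suc n)) * exp (- z) ^ Suc n) \<le> exp (s - y) * (real (c (Suc n)) * exp (- s) ^ Suc n)" for n
  proof -
    have "norm (of_nat (c (Suc n)) * exp (- z) ^ Suc n) = real (c (Suc n)) * exp (real (Suc n) * (- y))"
      unfolding norm_mult norm_power norm_of_nat norm_exp_eq_Re exp_of_nat_mult by (simp add: y_def)
    also have "\<dots> \<le> real (c (Suc n)) * exp ((s - y) + real (Suc n) * (- s))"
    proof -
      have "real n * s \<le> real n * y" using assms by (intro mult_left_mono) (auto simp: y_def)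
      hence "real (Suc n) * (- y) \<le> (s - y) + real (Suc n) * (- s)" by (simp add: algebra_simps)
      thus ?thesis by (intro mult_left_mono) auto
    qed
    also have "\<dots> = exp (s - y) * (real (c (Suc n)) * exp (- s) ^ Suc n)"
      unfolding exp_add exp_of_nat_mult by simp
    finally show ?thesis .
  qed
  have "norm (exp (log_euler z) - 1) \<le> exp (s - y) * (exp (log_euler s) - 1)"
    using norm_sums_le[OF 1 3 le] .
  also have "\<dots> \<le> exp (s - y) * exp (log_euler s)" by (intro mult_left_mono) auto
  finally show ?thesis by (simp add: y_def)
qed

text \<open>The square of the norm is at least 2(1 - cos \<theta>), which is smallest at the end T =
  30 r of the major arc and there at least T^2 (1 - T^2/12). The condition on \<open>r\<close> says
  exactly that 1 - T^2/12 >= (29/30)^2, since 900 - 841 = 59.\<close>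

lemma norm_exp_minus_one_minor_arc:
  fixes r \<theta> :: real
  assumes r: "r > 0" "75 * r\<^sup>2 \<le> 59 / 900" and \<theta>: "30 * r \<le> \<bar>\<theta>\<bar>" "\<bar>\<theta>\<bar> \<le> pi"
  shows "norm (exp (of_real r + \<i> * of_real \<theta>) - 1) \<ge> 29 * r"
proof (rule power2_le_imp_le)
  have "(norm (exp (of_real r + \<i> * of_real \<theta>) - 1))\<^sup>2 = (exp r * cos \<theta> - 1)\<^sup>2 + (exp r * sin \<theta>)\<^sup>2"
    by (simp add: cmod_power2 Re_exp Im_exp)
  also have "\<dots> = exp r ^ 2 * ((cos \<theta>)\<^sup>2 + (sin \<theta>)\<^sup>2) - 2 * exp r * cos \<theta> + 1"
    by (simp add: power2_eq_square algebra_simps del: sin_cos_squared_add sin_cos_squared_add2 sin_cos_squared_add3)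
  also have "(cos \<theta>)\<^sup>2 + (sin \<theta>)\<^sup>2 = 1" by simp
  also have "exp r ^ 2 * 1 - 2 * exp r * cos \<theta> + 1 = (exp r - 1)\<^sup>2 + 2 * (1 - cos \<theta>) * exp r"
    by (simp add: power2_eq_square algebra_simps)
  finally have eq: "(norm (exp (of_real r + \<i> * of_real \<theta>) - 1))\<^sup>2 = (exp r - 1)\<^sup>2 + 2 * (1 - cos \<theta>) * exp r" .
  define T where "T = 30 * r"
  have T: "0 < T" "T \<le> \<bar>\<theta>\<bar>" using r \<theta> by (auto simp: T_def)
  have "cos \<theta> = cos \<bar>\<theta>\<bar>" by (simp add: abs_if)
  also have "\<dots> \<le> cos T" using T \<theta> by (intro cos_monotone_0_pi_le) auto
  also have "\<dots> \<le> 1 - T\<^sup>2 / 2 + T ^ 4 / 24"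
  proof -
    obtain t where t: "cos T = (\<Sum>m<4. cos_coeff m * T ^ m) + (cos (t + 1 / 2 * real 4 * pi) / fact 4) * T ^ 4"
      using Maclaurin_cos_expansion2[of T 4] T by auto
    have "(cos (t + 1 / 2 * real 4 * pi) / fact 4) * T ^ 4 \<le> (1 / fact 4) * T ^ 4"
      by (intro mult_right_mono divide_right_mono) auto
    moreover have "(\<Sum>m<4. cos_coeff m * T ^ m) = 1 - T\<^sup>2 / 2"
    proof -
      have "{..<4} = {0, 1, 2, 3 :: nat}" by auto
      moreover have "cos_coeff 0 = 1" "cos_coeff 1 = 0" "cos_coeff 2 = - (1 / 2)" "cos_coeff 3 = 0"
        by (simp_all add: cos_coeff_def)
      ultimately show ?thesis by simp
    qed
    moreover have "(fact 4 :: real) = 24" by (simp add: fact_numeral)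
    ultimately show ?thesis using t by simp
  qed
  finally have "2 * (1 - cos \<theta>) \<ge> T\<^sup>2 * (1 - T\<^sup>2 / 12)" by (simp add: eval_nat_numeral algebra_simps)
  moreover have "T\<^sup>2 * (1 - T\<^sup>2 / 12) \<ge> (29 * r)\<^sup>2"
  proof -
    have "(29 * r)\<^sup>2 = T\<^sup>2 * (841 / 900)" by (simp add: T_def power2_eq_square)
    also have "\<dots> \<le> T\<^sup>2 * (1 - T\<^sup>2 / 12)" using r by (intro mult_left_mono) (auto simp: T_def power2_eq_square)
    finally show ?thesis .
  qed
  moreover have "2 * (1 - cos \<theta>) * 1 \<le> 2 * (1 - cos \<theta>) * exp r"
    using r by (intro mult_left_mono) auto
  ultimately show "(29 * r)\<^sup>2 \<le> (norm (exp (of_real r + \<i> * of_real \<theta>) - 1))\<^sup>2"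
    unfolding eq using zero_le_power2[of "exp r - 1"] by linarith
qed auto

text \<open>The partial fraction series has nonnegative terms.\<close>

lemma inverse_exp_minus_one_ge:
  fixes r :: real
  assumes "r > 0"
  shows "1 / (exp r - 1) \<ge> 1 / r - 1 / 2"
proof -
  define x where "x = r / (2 * pi)"
  have x: "x > 0" using assms by (simp add: x_def)
  have "0 \<le> 1 / (exp (2 * pi * x) - 1) - 1 / (2 * pi * x) + 1 / 2"
    by (rule sums_le[OF _ sums_zero inverse_exp_minus_one_partial_fractions[OF x]]) (use x in auto)
  moreover have "2 * pi * x = r" by (simp add: x_def)
  ultimately show ?thesis by simp
qed

text \<open>The exponent 0.2934 is the minor arc saving (28/29)(3/pi^2), rounded down. Taking eighth
  roots leaves a linear function against exp(y), and the tangent of exp at 4.2 settles it, since y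
  >= 4.2 on the range. The constant 101 exceeds 0.5617^(-8).\<close>

lemma exp_ge_power8:
  fixes x :: real
  assumes "x \<ge> 114.9"
  shows "x ^ 8 \<le> 101 * exp (0.2934 * x)"
proof -
  define y where "y = 0.036675 * x"
  have y: "y \<ge> 4.2" using assms by (simp add: y_def)
  \<comment> \<open>4.2 = 42/10, and 1.105 = 1 + 0.1 + 0.1^2/2 is a lower bound for
    exp(0.1).\<close>
  have "66 \<le> (1.105 :: real) ^ 42" by (simp add: power_divide eval_nat_numeral)
  also have "\<dots> \<le> exp (1 / 10) ^ 42"
  proof (rule power_mono)
    show "1.105 \<le> exp (1 / 10 :: real)" using exp_lower_Taylor_quadratic[of "1 / 10 :: real"] by (simp add: power2_eq_square)
  qed auto
  also have "\<dots> = exp 4.2" unfolding exp_of_nat_mult[symmetric] by simp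
  finally have e: "exp (4.2 :: real) \<ge> 66" .
  have "0.5617 * x \<le> 66 * (1 + (y - 4.2))" using assms by (simp add: y_def)
  also have "\<dots> \<le> exp 4.2 * exp (y - 4.2)"
    using e y exp_ge_add_one_self[of "y - 4.2"] by (intro mult_mono) auto
  also have "\<dots> = exp y" by (simp flip: exp_add)
  finally have "(0.5617 * x) ^ 8 \<le> exp y ^ 8" using assms by (intro power_mono) auto
  also have "exp y ^ 8 = exp (0.2934 * x)" unfolding exp_of_nat_mult[symmetric] by (simp add: y_def)
  finally have "0.5617 ^ 8 * x ^ 8 \<le> exp (0.2934 * x)" by (simp only: power_mult_distrib)
  moreover have "(1 / 101) * x ^ 8 \<le> 0.5617 ^ 8 * x ^ 8" using assms by (intro mult_right_mono) (auto simp: power_divide eval_nat_numeral)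
  ultimately show ?thesis by simp
qed

lemma has_integral_norm_bound:
  fixes f :: "real \<Rightarrow> 'b :: real_normed_vector"
  assumes "(f has_integral i) {a..b}" "a \<le> b" "\<And>x. x \<in> {a..b} \<Longrightarrow> norm (f x) \<le> B"
  shows "norm i \<le> B * (b - a)"
proof -
  have "B \<ge> norm (f a)" using assms by auto
  hence "B \<ge> 0" using norm_ge_zero[of "f a"] by linarith
  thus ?thesis using has_integral_bound[of B f i a b] assms by simp
qed

lemma pi_bounds: "3.1415 < pi" "pi < 3.1416" "9.869 < pi\<^sup>2" "pi\<^sup>2 < 9.8697"
proof -
  show pi: "3.1415 < pi" "pi < 3.1416" using pi_approx by auto
  have "pi\<^sup>2 < 3.1416\<^sup>2" using pi by (intro power_strict_mono) auto
  thus "pi\<^sup>2 < 9.8697" by (simp add: power2_eq_square)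
  have "3.1415\<^sup>2 < pi\<^sup>2" using pi by (intro power_strict_mono) auto
  thus "9.869 < pi\<^sup>2" by (simp add: power2_eq_square)
qed

text \<open>At x = \<mu> n this equals exp(x)(1 - 1/x)/(4 sqrt(3)(n - 1/24)), the first term of
  Rademacher's series without its decaying exponential.\<close>

definition partition_main :: "real \<Rightarrow> real" where
  "partition_main x = pi\<^sup>2 / (6 * sqrt 3) * exp x * (1 - 1 / x) / x\<^sup>2"

theorem partition_asymptotic:
  assumes "\<mu> n \<ge> 114.9"
  shows "\<bar>real (card (partitions n)) - partition_main (\<mu> n)\<bar> \<le> 13 / \<mu> n ^ 6 * partition_main (\<mu> n)"
proof -
  define x where "x = \<mu> n"
  have x: "x \<ge> 114.9" "x > 0" using assms by (auto simp: x_def)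
  note pi = pi_bounds(1,2) and pi2 = pi_bounds(3,4)
  have n: "real n = 3 * x\<^sup>2 / (2 * pi\<^sup>2) + 1 / 24"
  proof -
    \<comment> \<open>The square root of a negative real is negative in HOL, so a positive
      \<open>x\<close> excludes n = 0.\<close>
    have "24 * real n - 1 \<ge> 0"
    proof (rule ccontr)
      assume "\<not> 24 * real n - 1 \<ge> 0"
      hence "x \<le> 0" by (simp add: x_def \<mu>_def mult_nonneg_nonpos)
      thus False using x by simp
    qed
    hence "x\<^sup>2 = pi\<^sup>2 * (24 * real n - 1) / 36"
      by (simp add: x_def \<mu>_def power_mult_distrib power_divide)
    thus ?thesis by (simp add: field_simps)
  qed
  \<comment> \<open>The saddle point of (n - 1/24) t + pi^2/(6t), the exponent after the modular
    transformation. The constants \<open>a\<close> and \<open>b\<close> below express this exponent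
    in v, where t = 2 pi v^2, and satisfy 2ab = x.\<close>
  define r where "r = pi\<^sup>2 / (3 * x)"
  \<comment> \<open>Wide enough to lose only the factor 28/29 in the saving off the arc, narrow
    enough for Re(4 pi^2/t) >= 3/2 on it.\<close>
  define T where "T = 30 * r"
  define a where "a = x * sqrt (3 / pi)"
  define b where "b = sqrt (pi / 12)"
  define K where "K = 2 * pi / a\<^sup>2"
  define u where "u = (\<lambda>t. csqrt (t / of_real (2 * pi)))"
  define E where "E = (\<lambda>v::complex. of_real (a\<^sup>2) * v\<^sup>2 + of_real (b\<^sup>2) / v\<^sup>2)"
  define t where "t = (\<lambda>\<theta>::real. of_real r + \<i> * of_real \<theta> :: complex)"
  have r: "r > 0" "r \<le> 0.02864"
  proof -
    show "r > 0" using x by (simp add: r_def)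
    have "r \<le> 9.8697 / (3 * 114.9)" unfolding r_def using x pi2 by (intro frac_le) auto
    thus "r \<le> 0.02864" by simp
  qed
  have T: "T > 0" "T \<le> pi" using r pi by (auto simp: T_def)
  have ab_pos: "a > 0" "b > 0" using x by (auto simp: a_def b_def)
  have a2: "a\<^sup>2 = 3 * x\<^sup>2 / pi" by (simp add: a_def power_mult_distrib)
  have b2: "b\<^sup>2 = pi / 12" by (simp add: b_def)
  have ab: "a * b = x / 2"
  proof -
    have "sqrt (3 / pi) * sqrt (pi / 12) = sqrt ((1 / 2)\<^sup>2)"
      by (simp add: real_sqrt_mult[symmetric] power2_eq_square)
    also have "\<dots> = 1 / 2" by (rule real_sqrt_unique) auto
    finally show ?thesis by (simp add: a_def b_def)
  qed
  have K: "K = 2 * pi\<^sup>2 / (3 * x\<^sup>2)" unfolding K_def a2 by (simp add: power2_eq_square)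
  have inv_a: "1 / (2 * a) = b / x" using ab ab_pos x by (simp add: field_simps)
  have rab: "r / (2 * pi) = pi / (6 * x)" "b / a = pi / (6 * x)"
  proof -
    show "r / (2 * pi) = pi / (6 * x)" by (simp add: r_def power2_eq_square)
    have "b / a = b\<^sup>2 / (a * b)" using ab_pos by (simp add: power2_eq_square)
    also have "\<dots> = pi / (6 * x)" unfolding ab b2 by simp
    finally show "b / a = pi / (6 * x)" .
  qed
  have sqrtpi_b: "sqrt pi * b = pi / (2 * sqrt 3)"
  proof -
    have "sqrt pi * b = sqrt (pi\<^sup>2 / (2\<^sup>2 * 3))" by (simp add: b_def real_sqrt_mult[symmetric] power2_eq_square)
    also have "\<dots> = pi / (2 * sqrt 3)" by (simp only: real_sqrt_divide real_sqrt_mult real_sqrt_abs) simp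
    finally show ?thesis .
  qed
  have "1 / (2 * a) \<le> b" unfolding inv_a using ab_pos x by (simp add: field_simps)
  moreover have "b / a \<le> r / (2 * pi)" by (simp add: rab)
  ultimately obtain I where I:
    "((\<lambda>\<theta>. u (t \<theta>) * exp (E (u (t \<theta>)))) has_integral I) {-T..T}"
    "norm (I - of_real (K * sqrt pi * ((b - 1 / (2 * a)) * exp (2 * a * b) - (b + 1 / (2 * a)) * exp (- (2 * a * b)))))
       \<le> K * exp (Re (E (u (t T)))) * (2 * norm (u (t T)) + 2 * sqrt pi * b)"
    using main_arc_integral[of a b r T] ab_pos r(1) T(1) unfolding u_def E_def t_def K_def by blast
  define f where "f = (\<lambda>\<theta>. exp (log_euler (t \<theta>)) * exp (of_nat n * t \<theta>))"
  define h where "h = (\<lambda>\<theta>. u (t \<theta>) * exp (E (u (t \<theta>))))"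
  define p where "p = real (card (partitions n))"
  have f_int: "(f has_integral of_real (2 * pi * p)) {-pi..pi}"
    unfolding f_def t_def p_def by (rule partition_coefficient_integral) (rule r(1))
  have Re_t: "Re (t \<theta>) = r" and Im_t: "Im (t \<theta>) = \<theta>" for \<theta> by (simp_all add: t_def)
  have t_nz: "t \<theta> \<noteq> 0" for \<theta> using Re_t[of \<theta>] r by auto
  have u_sq: "(u z)\<^sup>2 = z / of_real (2 * pi)" for z by (simp add: u_def)
  have Eu: "E (u (t \<theta>)) = of_real (3 * x\<^sup>2 / (2 * pi\<^sup>2)) * t \<theta> + of_real (pi\<^sup>2 / 6) / t \<theta>" for \<theta>
    unfolding E_def u_sq a2 b2 using t_nz[of \<theta>] by (simp add: field_simps power2_eq_square)
  have f_eq: "f \<theta> = h \<theta> * exp (log_euler (of_real (4 * pi\<^sup>2) / t \<theta>))" for \<theta>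
  proof -
    have "exp (log_euler (t \<theta>)) = u (t \<theta>) * exp (of_real (pi\<^sup>2 / 6) / t \<theta> - t \<theta> / 24) * exp (log_euler (of_real (4 * pi\<^sup>2) / t \<theta>))"
      unfolding u_def by (rule exp_log_euler_modular) (simp add: Re_t r)
    moreover have "exp (of_real (pi\<^sup>2 / 6) / t \<theta> - t \<theta> / 24) * exp (of_nat n * t \<theta>) = exp (E (u (t \<theta>)))"
    proof -
      have "of_nat n = complex_of_real (3 * x\<^sup>2 / (2 * pi\<^sup>2)) + 1 / 24" using n by (metis of_real_of_nat_eq of_real_add of_real_divide of_real_1 of_real_numeral)
      thus ?thesis unfolding Eu exp_add[symmetric] by (simp add: algebra_simps)
    qed
    ultimately show ?thesis unfolding f_def h_def by (simp add: mult_ac)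
  qed
  define s where "s = (\<lambda>\<theta>. 4 * pi\<^sup>2 * r / (r\<^sup>2 + \<theta>\<^sup>2))"
  have Re_inv: "Re (of_real c / t \<theta>) = c * r / (r\<^sup>2 + \<theta>\<^sup>2)" for c \<theta>
    by (simp add: Re_divide Re_t Im_t)
  have Re_z: "Re (of_real (4 * pi\<^sup>2) / t \<theta>) = s \<theta>" for \<theta> unfolding Re_inv s_def ..
  have Re_E: "Re (E (u (t \<theta>))) = x / 2 + s \<theta> / 24" for \<theta>
  proof -
    have "Re (E (u (t \<theta>))) = 3 * x\<^sup>2 / (2 * pi\<^sup>2) * r + pi\<^sup>2 / 6 * r / (r\<^sup>2 + \<theta>\<^sup>2)"
      unfolding Eu plus_complex.sel Re_inv by (simp add: Re_t)
    also have "3 * x\<^sup>2 / (2 * pi\<^sup>2) * r = x / 2" using x by (simp add: r_def power2_eq_square)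
    also have "pi\<^sup>2 / 6 * r / D = 4 * pi\<^sup>2 * r / D / 24" for D by (cases "D = 0") (simp_all add: field_simps)
    finally show ?thesis unfolding s_def .
  qed
  have norm_u: "norm (u (t \<theta>)) \<le> 1" if "\<bar>\<theta>\<bar> \<le> T" for \<theta>
  proof -
    have "norm (t \<theta>) \<le> \<bar>r\<bar> + \<bar>\<theta>\<bar>" using cmod_le[of "t \<theta>"] by (simp add: Re_t Im_t)
    hence "norm (t \<theta>) \<le> 31 * r" using that r by (simp add: T_def)
    also have "\<dots> \<le> 2 * pi" using r pi by simp
    finally have "(norm (u (t \<theta>)))\<^sup>2 \<le> 1\<^sup>2" unfolding norm_power[symmetric] u_sq by (simp add: norm_divide)
    thus ?thesis by (rule power2_le_imp_le) simp
  qed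
  \<comment> \<open>Since r^2 + T^2 = 901 r^2, the minimum is 12 x/901, about 1.53 at x =
    114.9.\<close>
  have s_ge: "s \<theta> \<ge> 3 / 2" if "\<bar>\<theta>\<bar> \<le> T" for \<theta>
  proof -
    have "\<theta>\<^sup>2 \<le> T\<^sup>2" using that T by (intro abs_le_square_iff[THEN iffD1]) auto
    hence "r\<^sup>2 + \<theta>\<^sup>2 \<le> 901 * r\<^sup>2" by (simp add: T_def power_mult_distrib)
    moreover have "r\<^sup>2 + \<theta>\<^sup>2 > 0" using r by (simp add: add_pos_nonneg)
    ultimately have "4 * pi\<^sup>2 * r / (901 * r\<^sup>2) \<le> s \<theta>" unfolding s_def using r by (intro divide_left_mono mult_nonneg_nonneg mult_pos_pos) auto
    moreover have "4 * pi\<^sup>2 * r / (901 * r\<^sup>2) = 12 * x / 901"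
      using x r by (simp add: r_def power2_eq_square field_simps)
    ultimately show ?thesis using x by simp
  qed
  have s_T: "s T = 12 * x / 901"
    using x r by (simp add: s_def T_def r_def power2_eq_square field_simps)
  \<comment> \<open>The dual factor exp(log_euler(4 pi^2/t)) is replaced by 1. The exponent beyond
    x/2 is s/24 + 3/2 - s + log_euler(3/2), decreasing in s and below 1.2 at s = 3/2.\<close>
  have B0: "norm (f \<theta> - h \<theta>) \<le> exp (x / 2 + 1.2)" if "\<theta> \<in> {-T..T}" for \<theta>
  proof -
    have \<theta>: "\<bar>\<theta>\<bar> \<le> T" using that by auto
    have "f \<theta> - h \<theta> = u (t \<theta>) * exp (E (u (t \<theta>))) * (exp (log_euler (of_real (4 * pi\<^sup>2) / t \<theta>)) - 1)"
      unfolding f_eq h_def by (simp add: algebra_simps)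
    hence "norm (f \<theta> - h \<theta>) = norm (u (t \<theta>)) * exp (x / 2 + s \<theta> / 24) * norm (exp (log_euler (of_real (4 * pi\<^sup>2) / t \<theta>)) - 1)"
      by (simp only: norm_mult norm_exp_eq_Re Re_E)
    also have "\<dots> \<le> 1 * exp (x / 2 + s \<theta> / 24) * (exp (3 / 2 - s \<theta>) * exp (log_euler (3 / 2)))"
      using norm_exp_log_euler_minus_one_le[of "3 / 2" "of_real (4 * pi\<^sup>2) / t \<theta>"] s_ge[OF \<theta>] norm_u[OF \<theta>]
      unfolding Re_z by (intro mult_mono) auto
    also have "\<dots> = exp (x / 2 + s \<theta> / 24 + (3 / 2 - s \<theta>) + log_euler (3 / 2))" by (simp only: exp_add mult_1 mult.assoc)
    also have "\<dots> \<le> exp (x / 2 + 1.2)"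
      using log_euler_real_le[of "3 / 2"] pi2 s_ge[OF \<theta>] by simp
    finally show ?thesis .
  qed
  \<comment> \<open>0.06752 bounds sqrt(pi/(6x)), the square root factor of the modular formula.
    1.7525 bounds exp(0.5012), where 1/2 comes from \<open>inverse_exp_minus_one_ge\<close> and
    0.0012 from \<open>log_euler (12 * x)\<close>.\<close>
  define B1 where "B1 = 0.06752 * (1.7525 * exp (x - 0.2934 * x))"
  have B1: "norm (f \<theta>) \<le> B1" if "T \<le> \<bar>\<theta>\<bar>" "\<bar>\<theta>\<bar> \<le> pi" for \<theta>
  proof -
    have r2: "75 * r\<^sup>2 \<le> 59 / 900"
    proof -
      have "r\<^sup>2 \<le> 0.02864\<^sup>2" using r by (intro power_mono) auto
      thus ?thesis by (simp add: power2_eq_square)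
    qed
    have d: "norm (exp (t \<theta>) - 1) \<ge> 29 * r" unfolding t_def
      using that r r2 by (intro norm_exp_minus_one_minor_arc) (auto simp: T_def)
    have "norm (f \<theta>) = norm (exp (log_euler (t \<theta>))) * exp (real n * r)"
      by (simp add: f_def norm_mult norm_exp_eq_Re Re_t)
    also have "\<dots> \<le> exp (log_euler r - 1 / (exp r - 1) + 1 / (29 * r)) * exp (real n * r)"
      using norm_exp_log_euler_le[OF Re_t r(1) d] r by (intro mult_right_mono) auto
    also have "\<dots> \<le> exp (log_euler r + 1 / 2 - 28 / 29 * (1 / r)) * exp (real n * r)"
      using inverse_exp_minus_one_ge[OF r(1)] by (intro mult_right_mono) auto
    also have "\<dots> = exp (log_euler r + 1 / 2 - 28 / 29 * (1 / r) + real n * r)" by (simp only: exp_add)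
    \<comment> \<open>The real modular formula at the saddle point: pi^2/(6r) - r/24 + n r = x, and
      the dual argument 4 pi^2/r is 12 x.\<close>
    also have "log_euler r + 1 / 2 - 28 / 29 * (1 / r) + real n * r =
        ln (pi / (6 * x)) / 2 + (log_euler (12 * x) + 1 / 2 - 28 / 29 * (1 / r) + x)"
    proof -
      have 1: "2 * pi * (r / (2 * pi)) = r" by simp
      have 2: "2 * pi / (r / (2 * pi)) = 12 * x" using x by (simp add: r_def power2_eq_square)
      have 3: "(1 / (2 * pi * (r / (2 * pi))) - (r / (2 * pi)) / (2 * pi)) * (pi\<^sup>2 / 6) = pi\<^sup>2 / (6 * r) - r / 24"
        using r by (simp add: field_simps power2_eq_square)
      have "r / (2 * pi) > 0" using r by simp
      from log_euler_modular_real[OF this, unfolded 3 2, unfolded 1]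
      have "log_euler r - log_euler (12 * x) = pi\<^sup>2 / (6 * r) - r / 24 + ln (pi / (6 * x)) / 2" unfolding rab .
      moreover have "pi\<^sup>2 / (6 * r) - r / 24 + real n * r = x"
        unfolding n r_def using x by (simp add: field_simps power2_eq_square)
      ultimately show ?thesis by linarith
    qed
    also have "exp (ln (pi / (6 * x)) / 2 + (log_euler (12 * x) + 1 / 2 - 28 / 29 * (1 / r) + x)) \<le>
        0.06752 * (1.7525 * exp (x - 0.2934 * x))"
      unfolding exp_add[of "ln (pi / (6 * x)) / 2"]
    proof (rule mult_mono)
      have "exp (ln (pi / (6 * x)) / 2) = sqrt (pi / (6 * x))" using x by (simp add: ln_sqrt[symmetric])
      also have "\<dots> \<le> sqrt (0.06752\<^sup>2)"
      proof (rule real_sqrt_le_mono)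
        have "pi / (6 * x) \<le> 3.1416 / (6 * 114.9)" using x pi by (intro frac_le) auto
        thus "pi / (6 * x) \<le> 0.06752\<^sup>2" by (simp add: power2_eq_square)
      qed
      finally show "exp (ln (pi / (6 * x)) / 2) \<le> 0.06752" by simp
      have "log_euler (12 * x) \<le> pi\<^sup>2 / (6 * (12 * x))" using x by (intro log_euler_real_le) simp
      also have "\<dots> \<le> 9.8697 / (6 * (12 * 114.9))" using x pi2 by (intro frac_le) auto
      finally have L: "log_euler (12 * x) \<le> 0.0012" by simp
      have "28 / 29 * (1 / r) = 84 / 29 * x / pi\<^sup>2" using x by (simp add: r_def)
      also have "\<dots> \<ge> 84 / 29 * x / 9.8697" using x pi2 by (intro divide_left_mono) auto
      finally have "28 / 29 * (1 / r) \<ge> 0.2934 * x" using x by simp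
      hence "exp (log_euler (12 * x) + 1 / 2 - 28 / 29 * (1 / r) + x) \<le> exp (0.5012 + (x - 0.2934 * x))"
        using L by simp
      also have "\<dots> = exp 0.5012 * exp (x - 0.2934 * x)" by (rule exp_add)
      also have "\<dots> \<le> 1.7525 * exp (x - 0.2934 * x)"
        using exp_bound[of "0.5012"] by (intro mult_right_mono) (auto simp: power2_eq_square)
      finally show "exp (log_euler (12 * x) + 1 / 2 - 28 / 29 * (1 / r) + x) \<le> 1.7525 * exp (x - 0.2934 * x)" .
    qed auto
    finally show ?thesis unfolding B1_def .
  qed
  have integrable: "f integrable_on {c..d}" if "-pi \<le> c" "d \<le> pi" for c d
    by (rule integrable_on_subinterval[OF has_integral_integrable[OF f_int]]) (use that in auto)
  define J0 where "J0 = integral {-T..T} f"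
  define J1 where "J1 = integral {-pi..-T} f"
  define J2 where "J2 = integral {T..pi} f"
  have J: "(f has_integral J0) {-T..T}" "(f has_integral J1) {-pi..-T}" "(f has_integral J2) {T..pi}"
    unfolding J0_def J1_def J2_def using T by (auto intro!: integrable_integral integrable)
  have "(f has_integral (J1 + J0 + J2)) {-pi..pi}"
    using T by (intro has_integral_combine[OF _ _ has_integral_combine[OF _ _ J(2) J(1)] J(3)]) auto
  with f_int have sum: "of_real (2 * pi * p) = J1 + J0 + J2" by (rule has_integral_unique)
  have n0: "norm (J0 - I) \<le> exp (x / 2 + 1.2) * (T - (-T))"
    using has_integral_diff[OF J(1) I(1)] B0 T by (intro has_integral_norm_bound) (auto simp: h_def)
  have n1: "norm J1 \<le> B1 * (-T - (-pi))"
    using J(2) T B1 by (intro has_integral_norm_bound) auto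
  have n2: "norm J2 \<le> B1 * (pi - T)"
    using J(3) T B1 by (intro has_integral_norm_bound) auto
  define M where "M = partition_main x"
  define R where "R = K * sqrt pi * b"
  have R: "R = pi ^ 3 / (3 * sqrt 3 * x\<^sup>2)"
    unfolding R_def mult.assoc sqrtpi_b K by (simp add: field_simps power2_eq_square power3_eq_cube)
  \<comment> \<open>Because 2ab = x and 1/(2a) = b/x, the closed form of the arc integral contains
    exactly the factor 1 - 1/x of the main term.\<close>
  have main: "K * sqrt pi * ((b - 1 / (2 * a)) * exp (2 * a * b) - (b + 1 / (2 * a)) * exp (- (2 * a * b)))
     = 2 * pi * M - R * (1 + 1 / x) * exp (- x)"
  proof -
    have ab2: "2 * a * b = x" using ab by simp
    have M: "2 * pi * M = R * (1 - 1 / x) * exp x"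
    proof -
      have "2 * pi * (pi\<^sup>2 / (6 * c) * d * e / x\<^sup>2) = pi ^ 3 / (3 * c * x\<^sup>2) * e * d" for c d e :: real
        by (simp add: power2_eq_square power3_eq_cube mult_ac)
      thus ?thesis unfolding M_def partition_main_def R .
    qed
    show ?thesis unfolding M ab2 inv_a by (simp add: R_def algebra_simps)
  qed
  have K_le: "K \<le> 1 / 4" 
  proof -
    have "114.9\<^sup>2 \<le> x\<^sup>2" using x by (intro power_mono) auto
    hence "2 * pi\<^sup>2 / (3 * x\<^sup>2) \<le> 2 * 9.8697 / (3 * 114.9\<^sup>2)" using pi2 by (intro frac_le) auto
    thus ?thesis unfolding K by (simp add: power2_eq_square)
  qed
  have K_pos: "K > 0" using x by (simp add: K)
  have sqrt3: "sqrt 3 \<ge> 1.732" "sqrt 3 \<le> 1.7321"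
    by (intro real_le_rsqrt real_le_lsqrt; simp add: power2_eq_square)+
  have spb: "sqrt pi * b \<le> 1" unfolding sqrtpi_b using pi sqrt3 by (simp add: field_simps)
  have R_le: "R \<le> 1 / 4" "R \<ge> 0"
    using K_le K_pos spb ab_pos mult_mono[of K "1/4" "sqrt pi * b" 1] by (auto simp: R_def mult.assoc)
  have e1: "norm (I - of_real (2 * pi * M - R * (1 + 1 / x) * exp (- x))) \<le> exp (x / 2 + x / 1802)"
  proof -
    have "K * exp (Re (E (u (t T)))) * (2 * norm (u (t T)) + 2 * sqrt pi * b) \<le> 1 / 4 * exp (x / 2 + x / 1802) * 4"
    proof (intro mult_mono)
      show "exp (Re (E (u (t T)))) \<le> exp (x / 2 + x / 1802)" unfolding Re_E s_T by simp
      show "2 * norm (u (t T)) + 2 * sqrt pi * b \<le> 4" using norm_u[of T] T spb by simp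
    qed (use K_le ab_pos in auto)
    with I(2) show ?thesis unfolding main by simp
  qed
  have n4: "norm (J0 - I) \<le> 2 * exp (x / 2 + 1.2)"
  proof -
    have "exp (x / 2 + 1.2) * (T - (-T)) \<le> exp (x / 2 + 1.2) * 2"
      using r by (intro mult_left_mono) (auto simp: T_def)
    from order.trans[OF n0 this] show ?thesis by (simp only: mult.commute)
  qed
  have n5: "norm (of_real (R * (1 + 1 / x) * exp (- x)) :: complex) \<le> exp (x / 2)"
  proof -
    have "R * (1 + 1 / x) * exp (- x) \<le> (1 / 4 * 2) * exp (x / 2)"
      using R_le x by (intro mult_mono) auto
    moreover have "R * (1 + 1 / x) * exp (- x) \<ge> 0" using R_le x by (intro mult_nonneg_nonneg) auto
    ultimately show ?thesis unfolding norm_of_real using exp_gt_zero[of "x / 2"] by linarith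
  qed
  have n6: "norm J1 + norm J2 \<le> 2 * pi * B1"
  proof -
    have "B1 * T \<ge> 0" using T by (simp add: B1_def)
    with n1 n2 show ?thesis by (simp add: algebra_simps)
  qed
  have "2 * pi * \<bar>p - M\<bar> = norm (of_real (2 * pi * p - 2 * pi * M) :: complex)"
    unfolding norm_of_real by (simp add: abs_mult flip: right_diff_distrib)
  also have "of_real (2 * pi * p - 2 * pi * M) = (J0 - I) + (J1 + J2) + (I - of_real (2 * pi * M - R * (1 + 1 / x) * exp (- x)))
       - of_real (R * (1 + 1 / x) * exp (- x))" unfolding of_real_diff sum by simp
  also have "norm \<dots> \<le> norm (J0 - I) + (norm J1 + norm J2) + norm (I - of_real (2 * pi * M - R * (1 + 1 / x) * exp (- x)))
       + norm (of_real (R * (1 + 1 / x) * exp (- x)) :: complex)"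
  proof -
    have "norm (c1 + (c2 + c3) + c4 - c5) \<le> norm c1 + (norm c2 + norm c3) + norm c4 + norm c5" for c1 c2 c3 c4 c5 :: complex
      using norm_triangle_ineq4[of "c1 + (c2 + c3) + c4" c5] norm_triangle_ineq[of "c1 + (c2 + c3)" c4]
        norm_triangle_ineq[of c1 "c2 + c3"] norm_triangle_ineq[of c2 c3] by linarith
    thus ?thesis .
  qed
  finally have tot: "2 * pi * \<bar>p - M\<bar> \<le> 2 * exp (x / 2 + 1.2) + 2 * pi * B1 + exp (x / 2 + x / 1802) + exp (x / 2)"
    using n4 n5 n6 e1 by linarith
  define Q where "Q = exp (x - 0.2934 * x)"
  \<comment> \<open>\<open>Q\<close> is the order of the minor arc. The other errors will be
    collected into 20 exp(0.51 x), and 0.1966 = 1 - 0.2934 - 0.51 leaves a factor of at least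
    exp(22).\<close>
  have small: "2000 * exp (0.51 * x) \<le> Q"
  proof -
    have "(2000 :: real) \<le> 2 ^ 22" by simp
    also have "\<dots> \<le> exp 1 ^ 22" using exp_ge_add_one_self[of 1] by (intro power_mono) auto
    also have "\<dots> = exp 22" unfolding exp_of_nat_mult[symmetric] by simp
    also have "\<dots> \<le> exp (0.1966 * x)" using x by simp
    finally have "2000 * exp (0.51 * x) \<le> exp (0.1966 * x) * exp (0.51 * x)" by (intro mult_right_mono) auto
    also have "\<dots> = Q" by (simp add: Q_def flip: exp_add)
    finally show ?thesis .
  qed
  have "exp (x / 2 + 1.2) \<le> 9 * exp (0.51 * x)"
  proof -
    have "exp (x / 2 + 1.2) \<le> exp (0.51 * x + 2)" using x by simp
    also have "\<dots> = exp 1 ^ 2 * exp (0.51 * x)" by (simp add: exp_add exp_of_nat_mult[symmetric])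
    also have "\<dots> \<le> 3\<^sup>2 * exp (0.51 * x)" using exp_le by (intro mult_right_mono power_mono) auto
    finally show ?thesis by simp
  qed
  moreover have "exp (x / 2 + x / 1802) \<le> exp (0.51 * x)" "exp (x / 2) \<le> exp (0.51 * x)" using x by auto
  ultimately have "2 * pi * \<bar>p - M\<bar> \<le> 20 * exp (0.51 * x) + 2 * pi * B1" using tot by linarith
  \<comment> \<open>The minor arc takes 2 pi * 0.1183288 < 0.7435, and the small terms take 20/2000
    = 0.01.\<close>
  also have "\<dots> \<le> 7535 / 10000 * Q"
  proof -
    have "2 * pi * B1 \<le> 2 * (31416 / 10000) * B1" using pi by (intro mult_right_mono) (auto simp: B1_def)
    moreover have "B1 = 1183288 / 10000000 * Q" by (simp add: B1_def Q_def)
    moreover have "Q > 0" by (simp add: Q_def)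
    ultimately show ?thesis using small by linarith
  qed
  also have "\<dots> \<le> 7535 / 10000 * (101 * (exp x / x ^ 8))"
  proof -
    have "Q * x ^ 8 \<le> Q * (101 * exp (0.2934 * x))" using exp_ge_power8[OF x(1)] by (intro mult_left_mono) (auto simp: Q_def)
    also have "\<dots> = 101 * exp x" by (simp add: Q_def flip: exp_add)
    finally show ?thesis using x by (simp add: field_simps)
  qed
  \<comment> \<open>The constant 13 arises here: 0.7535 * 101 < 13 * 5.9, and 5.9 is a lower bound
    for pi^3/(3 sqrt(3)) times 1 - 1/x.\<close>
  also have "\<dots> \<le> 13 * (59 / 10) * (exp x / x ^ 8)"
  proof -
    have "exp x / x ^ 8 \<ge> 0" using x by simp
    thus ?thesis by linarith
  qed
  also have "\<dots> \<le> 13 / x ^ 6 * (2 * pi * M)"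
  proof -
    have "pi ^ 3 \<ge> 3.1415 ^ 3" using pi by (intro power_mono) auto
    hence "5.96 \<le> pi ^ 3 / (3 * sqrt 3)" using sqrt3 by (simp add: field_simps power3_eq_cube)
    moreover have "0.9912 \<le> 1 - 1 / x" using x by (simp add: field_simps)
    ultimately have "5.96 * 0.9912 \<le> pi ^ 3 / (3 * sqrt 3) * (1 - 1 / x)" by (intro mult_mono) auto
    hence "5.9 * (13 * exp x / x ^ 8) \<le> (pi ^ 3 / (3 * sqrt 3) * (1 - 1 / x)) * (13 * exp x / x ^ 8)"
      using x by (intro mult_right_mono) auto
    also have "\<dots> = 13 / x ^ 6 * (2 * pi * M)"
      using x by (simp add: M_def partition_main_def field_simps eval_nat_numeral)
    finally show ?thesis by simp
  qed
  finally have "2 * pi * \<bar>p - M\<bar> \<le> 2 * pi * (13 / x ^ 6 * M)" by (simp add: mult_ac)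
  hence "\<bar>p - M\<bar> \<le> 13 / x ^ 6 * M" by (rule mult_left_le_imp_le) auto
  thus ?thesis by (simp add: p_def M_def x_def)
qed

section \<open>The parity of the crank\<close>

definition parity_sign :: "int \<Rightarrow> real" where
  "parity_sign k = (if even k then 1 else -1)"

lemma parity_sign_of_nat: "parity_sign (int a) = (-1) ^ a"
  by (simp add: parity_sign_def)

lemma parity_sign_diff: "parity_sign (int a - int b) = (-1) ^ b * (-1) ^ a"
  by (cases "even a"; cases "even b") (simp_all add: parity_sign_def)

definition crank_parity :: "nat \<Rightarrow> real" where
  "crank_parity n = (\<Sum>l\<in>partitions n. parity_sign (crank l))"

lemma M_eq_card_crank_parity:
  "real (M 0 n) = (real (card (partitions n)) + crank_parity n) / 2"
  "real (M 1 n) = (real (card (partitions n)) - crank_parity n) / 2"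
proof -
  define A where "A = {l \<in> partitions n. crank l mod 2 = int 0}"
  define B where "B = {l \<in> partitions n. crank l mod 2 = int 1}"
  have AB: "partitions n = A \<union> B" "A \<inter> B = {}" by (auto simp: A_def B_def)
  have fin: "finite A" "finite B" by (simp_all add: A_def B_def finite_partitions)
  have "card (partitions n) = card A + card B" unfolding AB(1) using fin AB(2) by (rule card_Un_disjoint)
  moreover have "crank_parity n = (\<Sum>l\<in>A. parity_sign (crank l)) + (\<Sum>l\<in>B. parity_sign (crank l))"
    unfolding crank_parity_def AB(1) using fin AB(2) by (rule sum.union_disjoint)
  moreover have "(\<Sum>l\<in>A. parity_sign (crank l)) = (\<Sum>l\<in>A. 1)"
    by (intro sum.cong) (auto simp: A_def parity_sign_def)
  moreover have "(\<Sum>l\<in>B. parity_sign (crank l)) = (\<Sum>l\<in>B. -1)"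
    by (intro sum.cong) (auto simp: B_def parity_sign_def)
  moreover have "M 0 n = card A" "M 1 n = card B" by (simp_all only: M_def A_def B_def)
  ultimately show "real (M 0 n) = (real (card (partitions n)) + crank_parity n) / 2"
    "real (M 1 n) = (real (card (partitions n)) - crank_parity n) / 2"
    by simp_all
qed

text \<open>The weight of a part in a partition with \<open>j\<close> ones: multiplied over all
  parts it is the parity sign of \<open>num_large\<close>.\<close>

definition large_sign :: "nat \<Rightarrow> nat \<Rightarrow> real" where
  "large_sign j i = (if i > j then -1 else 1)"

lemma prod_large_sign: "(\<Prod>i\<in>#l. large_sign j i) = (-1) ^ size {#i \<in># l. i > j#}"
  by (induction l) (auto simp: large_sign_def)

text \<open>A partition with j > 0 ones is given by j and its parts above 1, and its crank has the
  parity of j plus the number of parts above j. The bound \<open>N\<close> on the parts is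
  independent of j so that all j can share one product later.\<close>

lemma sum_crank_ones:
  assumes "n \<le> N"
  shows "(\<Sum>l\<in>{l \<in> partitions n. num_ones l > 0}. parity_sign (crank l)) =
     (\<Sum>j=1..n. (-1) ^ j * partition_weight (large_sign j) {2..N} (n - j))"
proof -
  have "(\<Sum>j=1..n. (-1) ^ j * partition_weight (large_sign j) {2..N} (n - j)) =
    (\<Sum>(j, l)\<in>(SIGMA j:{1..n}. {l \<in> partitions (n - j). set_mset l \<subseteq> {2..N}}). (-1) ^ j * (\<Prod>i\<in>#l. large_sign j i))"
    unfolding partition_weight_def sum_distrib_left by (rule sum.Sigma) (auto simp: finite_partitions)
  also have "\<dots> = (\<Sum>l\<in>{l \<in> partitions n. num_ones l > 0}. parity_sign (crank l))"
  proof (rule sum.reindex_bij_witness[of _ "\<lambda>l. (num_ones l, filter_mset (\<lambda>i. i \<noteq> 1) l)" "\<lambda>(j, l). l + replicate_mset j 1"], goal_cases)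
    case (1 jl)
    then obtain j l where jl: "jl = (j, l)" "j \<in> {1..n}" "l \<in> partitions (n - j)" "set_mset l \<subseteq> {2..N}" by auto
    have c: "count l 1 = 0" using jl(4) by (auto simp: count_eq_zero_iff)
    have "filter_mset (\<lambda>i. i \<noteq> 1) l = l" using jl(4) by (subst filter_mset_eq_conv) auto
    moreover have "filter_mset (\<lambda>i. i \<noteq> 1) (replicate_mset j (1::nat)) = {#}" by (induction j) auto
    ultimately show ?case using c by (simp add: jl num_ones_def)
  next
    case (2 jl)
    then obtain j l where jl: "jl = (j, l)" "j \<in> {1..n}" "l \<in> partitions (n - j)" "set_mset l \<subseteq> {2..N}" by auto
    have "sum_mset (replicate_mset j (1::nat)) = j" by (induction j) auto
    thus ?case using jl by (auto simp: partitions_def num_ones_def)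
  next
    case (3 l)
    show ?case by (auto simp: num_ones_def intro!: multiset_eqI)
  next
    case (4 l)
    hence l: "0 \<notin># l" "sum_mset l = n" "num_ones l > 0" by (auto simp: partitions_def)
    have eq: "l = filter_mset (\<lambda>i. i \<noteq> 1) l + replicate_mset (num_ones l) 1"
      by (auto simp: num_ones_def intro!: multiset_eqI)
    have "sum_mset (replicate_mset j (1::nat)) = j" for j by (induction j) auto
    with arg_cong[OF eq, of sum_mset] l have s: "sum_mset (filter_mset (\<lambda>i. i \<noteq> 1) l) + num_ones l = n" by simp
    have "i \<in> {2..N}" if "i \<in># l" "i \<noteq> 1" for i
    proof -
      have "i \<noteq> 0" using that l by metis
      moreover have "i \<le> n" using member_le_sum_mset[OF that(1)] l by simp
      ultimately show ?thesis using that assms by auto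
    qed
    thus ?case using l s by (auto simp: partitions_def)
  next
    case (5 jl)
    then obtain j l where jl: "jl = (j, l)" "j \<in> {1..n}" "l \<in> partitions (n - j)" "set_mset l \<subseteq> {2..N}" by auto
    have c: "count l 1 = 0" using jl(4) by (auto simp: count_eq_zero_iff)
    hence ones: "num_ones (l + replicate_mset j 1) = j" by (simp add: num_ones_def)
    have none: "filter_mset (\<lambda>i. i > j) (replicate_mset j' (1::nat)) = {#}" for j' using jl(2) by (induction j') auto
    have "num_large (l + replicate_mset j 1) = size {#i \<in># l. i > j#}"
      unfolding num_large_def ones filter_union_mset none by simp
    moreover have "crank (l + replicate_mset j 1) = int (num_large (l + replicate_mset j 1)) - int j"
      using jl(2) unfolding crank_def ones by auto
    ultimately show ?case by (simp add: jl(1) prod_large_sign parity_sign_diff)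
  qed
  finally show ?thesis by simp
qed

text \<open>Without ones the crank is the largest part m, and deleting it leaves parts between 2 and
  m. Positivity of n excludes the empty partition, whose crank is set separately.\<close>

lemma sum_crank_no_ones:
  assumes "n > 0"
  shows "(\<Sum>l\<in>{l \<in> partitions n. num_ones l = 0}. parity_sign (crank l)) =
     (\<Sum>m=2..n. (-1) ^ m * partition_weight (\<lambda>_. 1) {2..m} (n - m))"
proof -
  have "(\<Sum>m=2..n. (-1) ^ m * partition_weight (\<lambda>_. 1) {2..m} (n - m)) =
    (\<Sum>(m, l)\<in>(SIGMA m:{2..n}. {l \<in> partitions (n - m). set_mset l \<subseteq> {2..m}}). (-1) ^ m * (\<Prod>i\<in>#l. 1 :: real))"
    unfolding partition_weight_def sum_distrib_left by (rule sum.Sigma) (auto simp: finite_partitions)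
  also have "\<dots> = (\<Sum>l\<in>{l \<in> partitions n. num_ones l = 0}. parity_sign (crank l))"
  proof (rule sum.reindex_bij_witness[of _ "\<lambda>l. (Max_mset l, l - {#Max_mset l#})" "\<lambda>(m, l). add_mset m l"], goal_cases)
    case (1 ml)
    then obtain m l where ml: "ml = (m, l)" "m \<in> {2..n}" "l \<in> partitions (n - m)" "set_mset l \<subseteq> {2..m}" by auto
    have "Max (insert m (set_mset l)) = m" using ml(4) by (intro Max_eqI) auto
    thus ?case by (simp add: ml(1))
  next
    case (2 ml)
    then obtain m l where ml: "ml = (m, l)" "m \<in> {2..n}" "l \<in> partitions (n - m)" "set_mset l \<subseteq> {2..m}" by auto
    have "count l 1 = 0" using ml(4) by (auto simp: count_eq_zero_iff)
    thus ?case using ml by (auto simp: partitions_def num_ones_def)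
  next
    case (3 l)
    hence "l \<noteq> {#}" using assms by (auto simp: partitions_def)
    hence "Max_mset l \<in># l" by (intro Max_in) auto
    thus ?case by simp
  next
    case (4 l)
    hence l: "0 \<notin># l" "sum_mset l = n" "count l 1 = 0" by (auto simp: partitions_def num_ones_def)
    hence ne: "l \<noteq> {#}" using assms by auto
    define m where "m = Max_mset l"
    have m: "m \<in># l" unfolding m_def using ne by (intro Max_in) auto
    have le: "i \<le> m" if "i \<in># l" for i unfolding m_def using that by (intro Max_ge) auto
    have ge: "i \<ge> 2" if "i \<in># l" for i
    proof -
      have "i \<noteq> 0" using that l by metis
      moreover have "i \<noteq> 1" using that l(3) by (metis count_eq_zero_iff)
      ultimately show ?thesis by simp
    qed
    obtain l' where l': "l = add_mset m l'" using m by (metis insert_DiffM)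
    have "l' \<in> partitions (n - m)" "m \<le> n" using l l' by (auto simp: partitions_def)
    moreover have "set_mset l' \<subseteq> {2..m}" using le ge l' by auto
    moreover have "l - {#m#} = l'" using l' by simp
    ultimately show ?case using ge[OF m] unfolding m_def[symmetric] by (simp only:) simp
  next
    case (5 ml)
    then obtain m l where ml: "ml = (m, l)" "m \<in> {2..n}" "l \<in> partitions (n - m)" "set_mset l \<subseteq> {2..m}" by auto
    have "Max (insert m (set_mset l)) = m" using ml(4) by (intro Max_eqI) auto
    moreover have "num_ones (add_mset m l) = 0" using ml by (auto simp: num_ones_def count_eq_zero_iff)
    ultimately have "crank (add_mset m l) = int m" by (simp add: crank_def)
    thus ?case by (simp add: ml(1) parity_sign_of_nat)
  qed
  finally show ?thesis by simp
qed

lemma crank_parity_eq: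
  assumes "0 < n" "n \<le> N"
  shows "crank_parity n = (\<Sum>m=2..n. (-1) ^ m * partition_weight (\<lambda>_. 1) {2..m} (n - m)) +
     (\<Sum>j=1..n. (-1) ^ j * partition_weight (large_sign j) {2..N} (n - j))"
proof -
  have split: "partitions n = {l \<in> partitions n. num_ones l = 0} \<union> {l \<in> partitions n. num_ones l > 0}" by auto
  have "crank_parity n = (\<Sum>l\<in>{l \<in> partitions n. num_ones l = 0}. parity_sign (crank l)) +
      (\<Sum>l\<in>{l \<in> partitions n. num_ones l > 0}. parity_sign (crank l))"
    unfolding crank_parity_def by (subst split, rule sum.union_disjoint) (auto simp: finite_partitions)
  thus ?thesis unfolding sum_crank_ones[OF assms(2)] sum_crank_no_ones[OF assms(1)] .
qed

section \<open>Truncated q-series identities\<close>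

definition partition_fps :: "(nat \<Rightarrow> real) \<Rightarrow> nat set \<Rightarrow> real fps" where
  "partition_fps g S = Abs_fps (partition_weight g S)"

lemma partition_fps_prod:
  assumes "finite S" "0 \<notin> S"
  shows "(\<Prod>i\<in>S. 1 - fps_const (g i) * fps_X ^ i) * partition_fps g S = 1"
  using assms
proof (induction S rule: finite_induct)
  case empty
  show ?case by (simp add: partition_fps_def fps_eq_iff partition_weight_empty)
next
  case (insert i S)
  have "(1 - fps_const (g i) * fps_X ^ i) * partition_fps g (insert i S) = partition_fps g S"
  proof (rule fps_ext)
    fix n
    have "fps_nth (fps_X ^ i * partition_fps g (insert i S)) n =
        (if n < i then 0 else partition_weight g (insert i S) (n - i))"
      by (simp add: fps_X_power_mult_nth partition_fps_def)
    hence "fps_nth ((1 - fps_const (g i) * fps_X ^ i) * partition_fps g (insert i S)) n =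
       partition_weight g (insert i S) n - g i * (if n < i then 0 else partition_weight g (insert i S) (n - i))"
      by (simp add: left_diff_distrib mult.assoc partition_fps_def)
    also have "\<dots> = partition_weight g S n"
      using partition_weight_insert[of i S g n] insert by auto
    finally show "fps_nth ((1 - fps_const (g i) * fps_X ^ i) * partition_fps g (insert i S)) n = fps_nth (partition_fps g S) n"
      by (simp add: partition_fps_def)
  qed
  moreover have "(\<Prod>i\<in>insert i S. 1 - fps_const (g i) * fps_X ^ i) * partition_fps g (insert i S) =
      (\<Prod>i\<in>S. 1 - fps_const (g i) * fps_X ^ i) * ((1 - fps_const (g i) * fps_X ^ i) * partition_fps g (insert i S))"
    unfolding prod.insert[OF insert.hyps(1,2)] by (simp only: mult_ac)
  moreover have "(\<Prod>i\<in>S. 1 - fps_const (g i) * fps_X ^ i) * partition_fps g S = 1" using insert by simp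
  ultimately show ?case by (simp only:)
qed

text \<open>Congruence modulo q^(N+1), where q is \<open>fps_X\<close>. Stated as divisibility, it
  is transitive and compatible with products by ring facts alone, and it lets finite products stand
  in for infinite ones.\<close>

definition fps_eq_upto :: "nat \<Rightarrow> real fps \<Rightarrow> real fps \<Rightarrow> bool" where
  "fps_eq_upto N f g \<longleftrightarrow> fps_X ^ Suc N dvd f - g"

lemma fps_eq_upto_nth: "fps_eq_upto N f g \<Longrightarrow> i \<le> N \<Longrightarrow> fps_nth f i = fps_nth g i"
proof -
  assume "fps_eq_upto N f g" "i \<le> N"
  then obtain h where h: "f - g = fps_X ^ Suc N * h" by (auto simp: fps_eq_upto_def dvd_def)
  have "fps_nth (fps_X ^ Suc N * h) i = 0" unfolding fps_X_power_mult_nth using \<open>i \<le> N\<close> by simp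
  hence "fps_nth (f - g) i = 0" unfolding h .
  thus ?thesis by simp
qed

lemma fps_eq_upto_refl [simp, intro]: "fps_eq_upto N f f"
  by (simp add: fps_eq_upto_def)

lemma fps_eq_upto_sym: "fps_eq_upto N f g \<Longrightarrow> fps_eq_upto N g f"
  unfolding fps_eq_upto_def by (subst minus_diff_eq[symmetric], subst dvd_minus_iff)

lemma fps_eq_upto_trans [trans]: "fps_eq_upto N f g \<Longrightarrow> fps_eq_upto N g h \<Longrightarrow> fps_eq_upto N f h"
  unfolding fps_eq_upto_def using dvd_add[of "fps_X ^ Suc N" "f - g" "g - h"] by simp

lemma fps_eq_upto_mult: "fps_eq_upto N f g \<Longrightarrow> fps_eq_upto N (f * h) (g * h)"
  unfolding fps_eq_upto_def by (simp only: left_diff_distrib[symmetric] dvd_mult2)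

lemma fps_eq_upto_mult_left: "fps_eq_upto N f g \<Longrightarrow> fps_eq_upto N (h * f) (h * g)"
  unfolding fps_eq_upto_def by (simp only: right_diff_distrib[symmetric] dvd_mult)

lemma fps_X_power_dvd: "N < k \<Longrightarrow> fps_X ^ Suc N dvd (fps_X :: real fps) ^ k"
  by (intro le_imp_power_dvd) auto

text \<open>The q-Pochhammer symbol (q;q)_n; \<open>qpoch_plus\<close> is (-q;q)_n.\<close>

definition qpoch_minus :: "nat \<Rightarrow> real fps" where
  "qpoch_minus n = (\<Prod>i=1..n. 1 - fps_X ^ i)"

definition qpoch_plus :: "nat \<Rightarrow> real fps" where
  "qpoch_plus n = (\<Prod>i=1..n. 1 + fps_X ^ i)"

lemma qpoch_0 [simp]: "qpoch_minus 0 = 1" "qpoch_plus 0 = 1"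
  by (simp_all add: qpoch_minus_def qpoch_plus_def)

lemma qpoch_Suc:
  "qpoch_minus (Suc n) = qpoch_minus n * (1 - fps_X ^ Suc n)"
  "qpoch_plus (Suc n) = qpoch_plus n * (1 + fps_X ^ Suc n)"
  by (simp_all add: qpoch_minus_def qpoch_plus_def)

lemma qpoch_nth_0: "fps_nth (qpoch_minus n) 0 = 1" "fps_nth (qpoch_plus n) 0 = 1"
  by (induction n) (simp_all add: qpoch_Suc del: power_Suc)

definition inv_minus :: "nat \<Rightarrow> real fps" where "inv_minus n = inverse (qpoch_minus n)"
definition inv_plus :: "nat \<Rightarrow> real fps" where "inv_plus n = inverse (qpoch_plus n)"

lemma inv_minus: "inv_minus n * qpoch_minus n = 1"
  and inv_plus: "inv_plus n * qpoch_plus n = 1"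
  by (simp_all add: inv_minus_def inv_plus_def inverse_mult_eq_1 qpoch_nth_0)

lemma fps_mult_cancel_unit:
  fixes a b c d :: "real fps"
  assumes "d * c = 1" "a * c = b * c"
  shows "a = b"
proof -
  have "a * (d * c) = b * (d * c)" using assms(2) by (metis mult.assoc mult.commute)
  thus ?thesis using assms(1) by simp
qed

lemma inv_minus_Suc: "inv_minus (Suc n) * (1 - fps_X ^ Suc n) = inv_minus n"
proof (rule fps_mult_cancel_unit[OF inv_minus[of n]])
  show "inv_minus (Suc n) * (1 - fps_X ^ Suc n) * qpoch_minus n = inv_minus n * qpoch_minus n"
    using inv_minus[of "Suc n"] unfolding inv_minus[of n] qpoch_Suc by (simp only: mult_ac)
qed

text \<open>The coefficient (-q;q)_j/(q;q)_j of the q-binomial series with parameter -q.\<close>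

definition qratio :: "nat \<Rightarrow> real fps" where "qratio j = qpoch_plus j * inv_minus j"

lemma qratio_Suc: "qratio (Suc j) * (1 - fps_X ^ Suc j) = qratio j * (1 + fps_X ^ Suc j)"
proof -
  have "qratio (Suc j) * (1 - fps_X ^ Suc j) = qpoch_plus (Suc j) * (inv_minus (Suc j) * (1 - fps_X ^ Suc j))"
    by (simp only: qratio_def mult.assoc)
  thus ?thesis unfolding inv_minus_Suc qpoch_Suc qratio_def by (simp only: mult_ac)
qed

lemma qratio_0 [simp]: "qratio 0 = 1"
  using inv_minus[of 0] by (simp add: qratio_def)

text \<open>Here and in the next lemma the sum is viewed as a power series in \<open>t = - q\<^sup>k\<^sup>+\<^sup>1\<close> at \<open>k = 0\<close>;
  its functional equation under \<open>t \<mapsto> q t\<close> is iterated up to \<open>k = N\<close>, where the series is \<open>1\<close>.\<close>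
lemma euler_sum:
  "fps_eq_upto N ((\<Sum>m\<le>N. (-1) ^ m * fps_X ^ m * inv_minus m) * qpoch_plus N) 1"
proof -
  define e where "e = (\<lambda>k m. (-1) ^ m * fps_X ^ (m * Suc k) * inv_minus m)"
  define T where "T = (\<lambda>k. \<Sum>m\<le>N. e k m)"
  have step: "fps_eq_upto N (T k * (1 + fps_X ^ Suc k)) (T (Suc k))" for k
  proof -
    have "e k m - e (Suc k) m = (-1) ^ m * fps_X ^ (m * Suc k) * ((1 - fps_X ^ m) * inv_minus m)" for m
      by (simp add: e_def algebra_simps power_add)
    moreover have "(-1) ^ Suc m * fps_X ^ (Suc m * Suc k) * ((1 - fps_X ^ Suc m) * inv_minus (Suc m)) = - (fps_X ^ Suc k) * e k m" for m
    proof -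
      have "(1 - fps_X ^ Suc m) * inv_minus (Suc m) = inv_minus m" using inv_minus_Suc[of m] by (simp only: mult.commute)
      moreover have "fps_X ^ (Suc m * Suc k) = fps_X ^ Suc k * (fps_X ^ (m * Suc k) :: real fps)"
        by (simp only: mult_Suc power_add)
      ultimately show ?thesis by (simp add: e_def mult_ac)
    qed
    ultimately have eSuc: "e k (Suc m) - e (Suc k) (Suc m) = - (fps_X ^ Suc k) * e k m" for m by simp
    have "T k - T (Suc k) = (\<Sum>m\<le>N. e k m - e (Suc k) m)" by (simp add: T_def sum_subtractf)
    also have "\<dots> = (e k 0 - e (Suc k) 0) + (\<Sum>m<N. e k (Suc m) - e (Suc k) (Suc m))"
      unfolding lessThan_Suc_atMost[symmetric] by (rule sum.lessThan_Suc_shift)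
    also have "\<dots> = - (fps_X ^ Suc k) * (\<Sum>m<N. e k m)"
      unfolding eSuc sum_distrib_left by (simp add: e_def)
    also have "(\<Sum>m<N. e k m) = T k - e k N"
      by (simp add: T_def lessThan_Suc_atMost[symmetric])
    finally have "T k * (1 + fps_X ^ Suc k) - T (Suc k) = fps_X ^ Suc k * e k N"
      by (simp add: algebra_simps)
    \<comment> \<open>Only the top term of the truncated sum violates the functional equation, and
      its exponent (N + 1)(k + 1) exceeds N.\<close>
    also have "\<dots> = fps_X ^ (Suc k + N * Suc k) * ((-1) ^ N * inv_minus N)"
      by (simp add: e_def power_add mult_ac)
    finally have eq: "T k * (1 + fps_X ^ Suc k) - T (Suc k) = fps_X ^ (Suc k + N * Suc k) * ((-1) ^ N * inv_minus N)" .
    show ?thesis unfolding fps_eq_upto_def eq by (intro dvd_mult2 fps_X_power_dvd) simp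
  qed
  have "fps_eq_upto N (T 0 * qpoch_plus k) (T k)" for k
  proof (induction k)
    case (Suc k)
    have "fps_eq_upto N (T 0 * qpoch_plus k * (1 + fps_X ^ Suc k)) (T k * (1 + fps_X ^ Suc k))"
      using Suc by (rule fps_eq_upto_mult)
    also have "fps_eq_upto N (T k * (1 + fps_X ^ Suc k)) (T (Suc k))" by (rule step)
    finally show ?case by (simp only: qpoch_Suc mult.assoc)
  qed auto
  also have "fps_eq_upto N (T N) 1"
  proof -
    have "T N - 1 = (\<Sum>m<N. e N (Suc m))"
    proof -
      have "T N = e N 0 + (\<Sum>m<N. e N (Suc m))"
        unfolding T_def lessThan_Suc_atMost[symmetric] by (rule sum.lessThan_Suc_shift)
      moreover have "e N 0 = 1" using inv_minus[of 0] by (simp add: e_def)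
      ultimately show ?thesis by simp
    qed
    moreover have "fps_X ^ Suc N dvd e N (Suc m)" for m
    proof -
      have "fps_X ^ Suc N dvd fps_X ^ (Suc m * Suc N) * ((-1) ^ Suc m * inv_minus (Suc m))"
        by (intro dvd_mult2 fps_X_power_dvd) auto
      thus ?thesis by (simp only: e_def mult_ac)
    qed
    ultimately show ?thesis unfolding fps_eq_upto_def by (auto intro!: dvd_sum)
  qed
  finally show ?thesis by (simp add: T_def e_def)
qed

lemma cauchy_sum:
  "fps_eq_upto N ((1 - fps_X) * (\<Sum>j\<le>N. (-1) ^ j * fps_X ^ j * qratio j) * qpoch_plus N) (qpoch_minus N)"
proof -
  define e where "e = (\<lambda>k m. (-1) ^ m * fps_X ^ (m * Suc k) * qratio m)"
  define S where "S = (\<lambda>k. \<Sum>m\<le>N. e k m)"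
  have step: "fps_eq_upto N (S k * (1 + fps_X ^ Suc k)) (S (Suc k) * (1 - fps_X ^ Suc (Suc k)))" for k
  proof -
    have "e k m - e (Suc k) m = (-1) ^ m * fps_X ^ (m * Suc k) * (qratio m * (1 - fps_X ^ m))" for m
      by (simp add: e_def algebra_simps power_add)
    moreover have "(-1) ^ Suc m * fps_X ^ (Suc m * Suc k) * (qratio (Suc m) * (1 - fps_X ^ Suc m)) =
         - (fps_X ^ Suc k) * (e k m + fps_X * e (Suc k) m)" for m
    proof -
      have 1: "fps_X ^ (Suc m * Suc k) = fps_X ^ Suc k * (fps_X ^ (m * Suc k) :: real fps)"
        by (simp only: mult_Suc power_add)
      have 2: "fps_X ^ (m * Suc k) * fps_X ^ Suc m = fps_X * (fps_X ^ (m * Suc (Suc k)) :: real fps)"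
        by (simp add: power_add algebra_simps)
      have "(-1) ^ Suc m * fps_X ^ (Suc m * Suc k) * (qratio (Suc m) * (1 - fps_X ^ Suc m)) =
         - (fps_X ^ Suc k) * ((-1) ^ m * qratio m * (fps_X ^ (m * Suc k) + fps_X ^ (m * Suc k) * fps_X ^ Suc m))"
        unfolding 1 qratio_Suc by (simp add: algebra_simps)
      thus ?thesis unfolding 2 by (simp add: e_def algebra_simps)
    qed
    ultimately have eSuc: "e k (Suc m) - e (Suc k) (Suc m) = - (fps_X ^ Suc k) * (e k m + fps_X * e (Suc k) m)" for m by simp
    have "S k - S (Suc k) = (\<Sum>m\<le>N. e k m - e (Suc k) m)" by (simp add: S_def sum_subtractf)
    also have "\<dots> = (e k 0 - e (Suc k) 0) + (\<Sum>m<N. e k (Suc m) - e (Suc k) (Suc m))"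
      unfolding lessThan_Suc_atMost[symmetric] by (rule sum.lessThan_Suc_shift)
    also have "\<dots> = - (fps_X ^ Suc k) * ((\<Sum>m<N. e k m) + fps_X * (\<Sum>m<N. e (Suc k) m))"
      unfolding eSuc sum_distrib_left sum.distrib[symmetric] by (simp add: e_def)
    also have "(\<Sum>m<N. e k m) = S k - e k N"
      by (simp add: S_def lessThan_Suc_atMost[symmetric])
    also have "(\<Sum>m<N. e (Suc k) m) = S (Suc k) - e (Suc k) N"
      by (simp add: S_def lessThan_Suc_atMost[symmetric])
    finally have "S k * (1 + fps_X ^ Suc k) - S (Suc k) * (1 - fps_X ^ Suc (Suc k)) = fps_X ^ Suc k * (e k N + fps_X * e (Suc k) N)"
      by (simp add: algebra_simps)
    also have "\<dots> = fps_X ^ (Suc k + N * Suc k) * ((-1) ^ N * qratio N * (1 + fps_X ^ Suc N))"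
      by (simp add: e_def power_add algebra_simps)
    finally have eq: "S k * (1 + fps_X ^ Suc k) - S (Suc k) * (1 - fps_X ^ Suc (Suc k)) =
       fps_X ^ (Suc k + N * Suc k) * ((-1) ^ N * qratio N * (1 + fps_X ^ Suc N))" .
    show ?thesis unfolding fps_eq_upto_def eq by (intro dvd_mult2 fps_X_power_dvd) simp
  qed
  \<comment> \<open>This is the q-binomial theorem with parameter and argument both -q. The product
    generated by the iteration begins with 1 - q^2; the factor 1 - q in front completes it to
    (q;q)_(k+1).\<close>
  have "fps_eq_upto N ((1 - fps_X) * S 0 * qpoch_plus k) (S k * qpoch_minus (Suc k))" for k
  proof (induction k)
    case 0
    show ?case by (simp add: qpoch_Suc mult.commute)
  next
    case (Suc k)
    have "fps_eq_upto N ((1 - fps_X) * S 0 * qpoch_plus k * (1 + fps_X ^ Suc k)) (S k * qpoch_minus (Suc k) * (1 + fps_X ^ Suc k))"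
      using Suc by (rule fps_eq_upto_mult)
    also have "S k * qpoch_minus (Suc k) * (1 + fps_X ^ Suc k) = S k * (1 + fps_X ^ Suc k) * qpoch_minus (Suc k)"
      by (simp only: mult_ac)
    also have "fps_eq_upto N (S k * (1 + fps_X ^ Suc k) * qpoch_minus (Suc k)) (S (Suc k) * (1 - fps_X ^ Suc (Suc k)) * qpoch_minus (Suc k))"
      by (intro fps_eq_upto_mult step)
    also have "S (Suc k) * (1 - fps_X ^ Suc (Suc k)) * qpoch_minus (Suc k) = S (Suc k) * qpoch_minus (Suc (Suc k))"
      unfolding qpoch_Suc(1)[of "Suc k"] by (simp only: mult_ac)
    finally show ?case by (simp only: qpoch_Suc(2) mult.assoc)
  qed
  also have "fps_eq_upto N (S N * qpoch_minus (Suc N)) (1 * qpoch_minus (Suc N))"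
  proof (rule fps_eq_upto_mult)
    have "S N - 1 = (\<Sum>m<N. e N (Suc m))"
    proof -
      have "S N = e N 0 + (\<Sum>m<N. e N (Suc m))"
        unfolding S_def lessThan_Suc_atMost[symmetric] by (rule sum.lessThan_Suc_shift)
      moreover have "e N 0 = 1" by (simp add: e_def)
      ultimately show ?thesis by simp
    qed
    moreover have "fps_X ^ Suc N dvd e N (Suc m)" for m
    proof -
      have "fps_X ^ Suc N dvd fps_X ^ (Suc m * Suc N) * ((-1) ^ Suc m * qratio (Suc m))"
        by (intro dvd_mult2 fps_X_power_dvd) auto
      thus ?thesis by (simp only: e_def mult_ac)
    qed
    ultimately show "fps_eq_upto N (S N) 1" unfolding fps_eq_upto_def by (auto intro!: dvd_sum)
  qed
  also have "fps_eq_upto N (1 * qpoch_minus (Suc N)) (qpoch_minus N)"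
    unfolding fps_eq_upto_def qpoch_Suc by (simp add: algebra_simps)
  finally show ?thesis by (simp add: S_def e_def)
qed

section \<open>Gauss' theta series as a quotient of products\<close>

definition theta :: "nat \<Rightarrow> real fps" where
  "theta n = 1 + 2 * (\<Sum>s=1..n. (-1) ^ s * fps_X ^ (s\<^sup>2))"

text \<open>The ring identity behind the telescoping below, with a = q^n, b = q^s and
  \<open>c\<close>, \<open>d\<close> consecutive values of \<open>qratio\<close>. In this form the
  inverses of power series are just letters \<open>v\<close>, \<open>w\<close> with their defining
  equations.\<close>

lemma shanks_step:
  fixes a b v w c d P :: "'a :: comm_ring_1"
  assumes "v * (1 + a) = 1" "w * (1 + b) = 1" "d * (1 - b) = c * (1 + b)"
  shows "(1 - a) * v * b * d * w - d * w = - v * (c + a * d)"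
proof -
  have "d * w = d * w * (v * (1 + a))" using assms(1) by simp
  hence "(1 - a) * v * b * d * w - d * w = (1 - a) * v * b * d * w - d * w * (v * (1 + a))" by simp
  also have "\<dots> = - v * (w * (d * (1 - b)) + a * d * (w * (1 + b)))" by (simp add: algebra_simps)
  also have "w * (d * (1 - b)) = c * (w * (1 + b))" unfolding assms(3) by (simp only: mult_ac)
  finally show ?thesis unfolding assms(2) by simp
qed

text \<open>A finite form of Gauss' theta identity, in the style of Shanks: the right-hand side is
  designed so that consecutive differences telescope.\<close>
lemma gauss_finite:
  "theta n = qpoch_minus n * inv_plus n * (1 + 2 * (\<Sum>s=1..n. (-1) ^ s * qratio s * inverse (1 + fps_X ^ s) * fps_X ^ (s * Suc n)))"
proof (induction n)
  case 0
  show ?case using inv_plus[of 0] by (simp add: theta_def)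
next
  case (Suc k)
  define n where "n = Suc k"
  define v where "v = (\<lambda>s. inverse (1 + fps_X ^ s) :: real fps)"
  have v: "v s * (1 + fps_X ^ s) = 1" if "s > 0" for s
    unfolding v_def using that by (intro inverse_mult_eq_1) simp
  define P where "P = (\<lambda>n. qpoch_minus n * inv_plus n)"
  have inv_plus_Suc: "inv_plus n = inv_plus k * v n"
  proof (rule fps_mult_cancel_unit[OF inv_plus[of n]])
    have "inv_plus k * v n * qpoch_plus n = (inv_plus k * qpoch_plus k) * (v n * (1 + fps_X ^ n))"
      unfolding n_def qpoch_Suc by (simp only: mult_ac)
    moreover have "v n * (1 + fps_X ^ n) = 1" by (rule v) (simp add: n_def)
    ultimately show "inv_plus n * qpoch_plus n = inv_plus k * v n * qpoch_plus n"
      by (simp only: inv_plus mult_1)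
  qed
  have P_Suc: "P n = P k * (1 - fps_X ^ n) * v n"
    unfolding P_def inv_plus_Suc unfolding n_def qpoch_Suc by (simp only: mult_ac)
  have Pd: "P n * qratio n = 1"
  proof -
    have "P n * qratio n = (inv_minus n * qpoch_minus n) * (inv_plus n * qpoch_plus n)"
      by (simp only: P_def qratio_def mult_ac)
    thus ?thesis by (simp only: inv_minus inv_plus mult_1)
  qed
  \<comment> \<open>The telescoping quantity: when k is replaced by n = k + 1, the summand with s =
    r + 1 changes by U(r) - U(r+1), up to the common factor \<open>- P k * v n\<close>.\<close>
  define U where "U = (\<lambda>r. (-1) ^ Suc r * fps_X ^ (Suc r * n) * qratio r)"
  define \<tau> where "\<tau> = (\<lambda>n s. (-1) ^ s * qratio s * v s * fps_X ^ (s * Suc n))"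
  have \<tau>_step: "P n * \<tau> n (Suc r) - P k * \<tau> k (Suc r) = - P k * v n * (U r - U (Suc r))" for r
  proof -
    define s where "s = Suc r"
    have *: "(1 - fps_X ^ n) * v n * fps_X ^ s * qratio s * v s - qratio s * v s = - v n * (qratio r + fps_X ^ n * qratio s)"
      by (rule shanks_step) (use v[of n] v[of s] qratio_Suc[of r] in \<open>simp_all only: n_def s_def zero_less_Suc\<close>)
    have "fps_X ^ (s * Suc n) = fps_X ^ (s * n) * (fps_X ^ s :: real fps)" by (simp add: power_add mult.commute)
    moreover have "fps_X ^ (Suc s * n) = fps_X ^ (s * n) * (fps_X ^ n :: real fps)" by (simp add: power_add mult.commute)
    moreover have "s * Suc k = s * n" by (simp only: n_def)
    ultimately have A: "P n * \<tau> n s - P k * \<tau> k s = P k * ((-1) ^ s * fps_X ^ (s * n)) * ((1 - fps_X ^ n) * v n * fps_X ^ s * qratio s * v s - qratio s * v s)"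
      and B: "- P k * v n * (U r - U s) = P k * ((-1) ^ s * fps_X ^ (s * n)) * (- v n * (qratio r + fps_X ^ n * qratio s))"
      unfolding P_Suc \<tau>_def U_def s_def[symmetric] by (simp_all only: ring_distribs power_Suc mult_minus_left mult_minus_right mult_1 mult_ac minus_minus diff_conv_add_uminus minus_add_distrib)
    have "P n * \<tau> n s - P k * \<tau> k s = - P k * v n * (U r - U s)" unfolding A B * ..
    thus ?thesis unfolding s_def .
  qed
  have idx: "(\<Sum>s=1..m. h s) = (\<Sum>r<m. h (Suc r))" for h :: "nat \<Rightarrow> real fps" and m
    by (rule sum.reindex_bij_witness[of _ Suc "\<lambda>s. s - 1"]) auto
  have "P n * (\<Sum>s=1..n. \<tau> n s) - P k * (\<Sum>s=1..k. \<tau> k s) =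
      P n * \<tau> n n + (\<Sum>r<k. P n * \<tau> n (Suc r) - P k * \<tau> k (Suc r))"
    unfolding idx n_def by (simp add: sum_distrib_left sum_subtractf distrib_left)
  also have "(\<Sum>r<k. P n * \<tau> n (Suc r) - P k * \<tau> k (Suc r)) = - P k * v n * (\<Sum>r<k. U r - U (Suc r))"
    unfolding \<tau>_step sum_distrib_left ..
  also have "(\<Sum>r<k. U r - U (Suc r)) = U 0 - U k" by (rule sum_lessThan_telescope')
  also have "U 0 = - (fps_X ^ n)" by (simp add: U_def)
  also have "P n * \<tau> n n = (-1) ^ n * v n * fps_X ^ (n * Suc n)"
  proof -
    have "P n * \<tau> n n = (P n * qratio n) * ((-1) ^ n * v n * fps_X ^ (n * Suc n))" by (simp only: \<tau>_def mult_ac)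
    thus ?thesis unfolding Pd by simp
  qed
  finally have diff: "P n * (\<Sum>s=1..n. \<tau> n s) - P k * (\<Sum>s=1..k. \<tau> k s) =
     (-1) ^ n * v n * fps_X ^ (n * Suc n) + P k * v n * (fps_X ^ n + U k)" by (simp add: algebra_simps)
  have Uk: "P k * U k = (-1) ^ n * fps_X ^ (n * n)"
  proof -
    have "P k * U k = ((-1) ^ n * fps_X ^ (n * n)) * ((inv_minus k * qpoch_minus k) * (inv_plus k * qpoch_plus k))"
      by (simp only: P_def U_def qratio_def n_def mult_ac)
    thus ?thesis by (simp only: inv_minus inv_plus mult_1_right)
  qed
  have Pdiff: "P n - P k = - 2 * P k * v n * fps_X ^ n"
  proof -
    have "P n - P k * (v n * (1 + fps_X ^ n)) = - 2 * P k * v n * fps_X ^ n"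
      unfolding P_Suc by (simp add: algebra_simps)
    thus ?thesis using v[of n] by (simp add: n_def)
  qed
  \<comment> \<open>The boundary term U(0) cancels P(n) - P(k). The boundary term U(k) and the new
    summand s = n give q^(n^2) and q^(n^2 + n), both times \<open>v n\<close> and the same sign,
    which add up to the single theta term q^(n^2).\<close>
  have "P n * (1 + 2 * (\<Sum>s=1..n. \<tau> n s)) - P k * (1 + 2 * (\<Sum>s=1..k. \<tau> k s)) =
     (P n - P k) + 2 * (P n * (\<Sum>s=1..n. \<tau> n s) - P k * (\<Sum>s=1..k. \<tau> k s))" by (simp add: algebra_simps)
  also have "\<dots> = 2 * ((-1) ^ n * v n * fps_X ^ (n * Suc n) + v n * (P k * U k))"
    unfolding diff Pdiff by (simp add: algebra_simps)
  also have "\<dots> = 2 * ((-1) ^ n * fps_X ^ (n * n) * (v n * (1 + fps_X ^ n)))"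
    unfolding Uk by (simp add: algebra_simps power_add)
  also have "\<dots> = 2 * ((-1) ^ n * fps_X ^ (n\<^sup>2))" using v[of n] by (simp add: n_def power2_eq_square)
  finally have "P n * (1 + 2 * (\<Sum>s=1..n. \<tau> n s)) = P k * (1 + 2 * (\<Sum>s=1..k. \<tau> k s)) + 2 * ((-1) ^ n * fps_X ^ (n\<^sup>2))"
    by (simp add: algebra_simps)
  also have "P k * (1 + 2 * (\<Sum>s=1..k. \<tau> k s)) = theta k" using Suc by (simp only: P_def \<tau>_def v_def)
  also have "theta k + 2 * ((-1) ^ n * fps_X ^ (n\<^sup>2)) = theta n"
    unfolding theta_def n_def by (simp only: sum.nat_ivl_Suc' ) (simp add: algebra_simps)
  finally show ?case by (simp only: P_def \<tau>_def v_def n_def)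
qed

text \<open>Every correction term in \<open>gauss_finite\<close> carries the power q^(s(n+1)) with s
  >= 1.\<close>

lemma gauss_theta: "fps_eq_upto n (theta n) (qpoch_minus n * inv_plus n)"
proof -
  have "theta n - qpoch_minus n * inv_plus n =
    (\<Sum>s=1..n. fps_X ^ (s * Suc n) * (2 * (qpoch_minus n * inv_plus n) * ((-1) ^ s * qratio s * inverse (1 + fps_X ^ s))))"
    unfolding gauss_finite by (simp add: algebra_simps sum_distrib_left)
  also have "fps_X ^ Suc n dvd \<dots>"
  proof (intro dvd_sum dvd_mult2 fps_X_power_dvd)
    fix s assume "s \<in> {1..n}"
    thus "n < s * Suc n" by (cases s) auto
  qed
  finally show ?thesis unfolding fps_eq_upto_def .
qed

section \<open>Generating function of the crank parity\<close>

lemma qpoch_minus_split: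
  assumes "m \<ge> 1"
  shows "qpoch_minus m = (1 - fps_X) * (\<Prod>i=2..m. 1 - fps_X ^ i)"
  unfolding qpoch_minus_def using assms by (subst prod.atLeast_Suc_atMost) (auto simp: numeral_2_eq_2)

lemma partition_fps_one:
  assumes "m \<ge> 1"
  shows "partition_fps (\<lambda>_. 1) {2..m} = (1 - fps_X) * inv_minus m"
proof -
  define C :: "real fps" where "C = (\<Prod>i=2..m. 1 - fps_X ^ i)"
  have 1: "partition_fps (\<lambda>_. 1) {2..m} * C = 1"
    using partition_fps_prod[of "{2..m}" "\<lambda>_. 1"] by (simp add: C_def mult.commute)
  show ?thesis
  proof (rule fps_mult_cancel_unit[OF 1])
    have "(1 - fps_X) * inv_minus m * C = inv_minus m * ((1 - fps_X) * C)" by (simp only: mult_ac)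
    also have "(1 - fps_X) * C = qpoch_minus m" using assms by (simp only: C_def qpoch_minus_split)
    finally show "partition_fps (\<lambda>_. 1) {2..m} * C = (1 - fps_X) * inv_minus m * C" unfolding 1 inv_minus by simp
  qed
qed

text \<open>Parts up to j contribute 1/(1 - q^i), larger ones 1/(1 + q^i). Completing the second
  product to all i <= N moves (-q;q)_j into the numerator, and the absence of parts equal to 1
  leaves the factor 1 - q.\<close>

lemma partition_fps_large_sign:
  assumes "1 \<le> j" "j \<le> N"
  shows "partition_fps (large_sign j) {2..N} = (1 - fps_X) * qratio j * inv_plus N"
proof -
  define C where "C = (\<Prod>i=2..N. 1 - fps_const (large_sign j i) * fps_X ^ i)"
  define D :: "real fps" where "D = (\<Prod>i=Suc j..N. 1 + fps_X ^ i)"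
  have 1: "partition_fps (large_sign j) {2..N} * C = 1"
    using partition_fps_prod[of "{2..N}" "large_sign j"] by (simp add: C_def mult.commute)
  have eq: "{2..N} = {2..j} \<union> {Suc j..N}" using assms by auto
  have "C = (\<Prod>i=2..j. 1 - fps_const (large_sign j i) * fps_X ^ i) * (\<Prod>i=Suc j..N. 1 - fps_const (large_sign j i) * fps_X ^ i)"
    unfolding C_def eq by (rule prod.union_disjoint) auto
  also have "(\<Prod>i=2..j. 1 - fps_const (large_sign j i) * fps_X ^ i) = (\<Prod>i=2..j. 1 - fps_X ^ i)"
    by (intro prod.cong) (auto simp: large_sign_def)
  also have "(\<Prod>i=Suc j..N. 1 - fps_const (large_sign j i) * fps_X ^ i) = D"
    unfolding D_def by (intro prod.cong) (auto simp: large_sign_def fps_const_neg[symmetric] simp del: fps_const_neg)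
  finally have C: "(1 - fps_X) * C = qpoch_minus j * D"
    unfolding qpoch_minus_split[OF assms(1)] by (simp only: mult.assoc)
  have eq: "{1..N} = {1..j} \<union> {Suc j..N}" using assms by auto
  have qN: "qpoch_plus N = qpoch_plus j * D"
    unfolding qpoch_plus_def D_def eq by (rule prod.union_disjoint) auto
  show ?thesis
  proof (rule fps_mult_cancel_unit[OF 1])
    have "(1 - fps_X) * qratio j * inv_plus N * C = qratio j * inv_plus N * ((1 - fps_X) * C)" by (simp only: mult_ac)
    also have "\<dots> = (inv_minus j * qpoch_minus j) * (inv_plus N * qpoch_plus N)"
      unfolding C qN qratio_def by (simp only: mult_ac)
    also have "\<dots> = 1" unfolding inv_minus inv_plus by simp
    finally show "partition_fps (large_sign j) {2..N} * C = (1 - fps_X) * qratio j * inv_plus N * C" unfolding 1 by simp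
  qed
qed

definition odd_prod :: "nat \<Rightarrow> real fps" where
  "odd_prod N = (\<Prod>i\<in>{i\<in>{1..N}. odd i}. 1 - fps_X ^ i)"

lemma fps_eq_upto_prod_one:
  assumes "finite S" "\<And>i. i \<in> S \<Longrightarrow> fps_eq_upto N (f i) 1"
  shows "fps_eq_upto N (\<Prod>i\<in>S. f i) 1"
  using assms
proof (induction S rule: finite_induct)
  case (insert i S)
  have "fps_eq_upto N (f i * (\<Prod>i\<in>S. f i)) (1 * (\<Prod>i\<in>S. f i))" by (intro fps_eq_upto_mult insert.prems) simp
  also have "fps_eq_upto N (1 * (\<Prod>i\<in>S. f i)) 1" using insert by simp
  finally show ?case using insert.hyps by simp
qed simp

text \<open>Euler's theorem on odd and distinct parts. The product (q;q)_N (-q;q)_N has the factors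
  1 - q^(2i): those with 2i > N are trivial modulo q^(N+1), and the others are the even factors of
  (q;q)_N, which cancel.\<close>

lemma odd_prod_eq_upto: "fps_eq_upto N (odd_prod N) (inv_plus N)"
proof -
  define ev :: "real fps" where "ev = (\<Prod>i\<in>{i\<in>{1..N}. even i}. 1 - fps_X ^ i)"
  have eq: "{1..N} = {i\<in>{1..N}. odd i} \<union> {i\<in>{1..N}. even i}" by auto
  have qm: "qpoch_minus N = odd_prod N * ev"
    unfolding qpoch_minus_def odd_prod_def ev_def by (subst eq, rule prod.union_disjoint) auto
  have nth0: "fps_nth (\<Prod>i\<in>S. 1 - fps_X ^ i :: real fps) 0 = 1" if "finite S" "0 \<notin> S" for S
    using that by (induction S rule: finite_induct) auto
  have ev_unit: "inverse ev * ev = 1"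
    unfolding ev_def by (intro inverse_mult_eq_1) (subst nth0, auto)
  have sq: "(1 - x) * (1 + x) = 1 - x * x" for x :: "real fps" by (simp add: algebra_simps)
  have "qpoch_minus N * qpoch_plus N = (\<Prod>i=1..N. 1 - fps_X ^ (2 * i))"
    unfolding qpoch_minus_def qpoch_plus_def prod.distrib[symmetric] sq mult_2 power_add ..
  also have "{1..N} = {i\<in>{1..N}. 2 * i \<le> N} \<union> {i\<in>{1..N}. 2 * i > N}" by auto
  also have "(\<Prod>i\<in>{i\<in>{1..N}. 2 * i \<le> N} \<union> {i\<in>{1..N}. 2 * i > N}. 1 - fps_X ^ (2 * i) :: real fps) =
     (\<Prod>i\<in>{i\<in>{1..N}. 2 * i \<le> N}. 1 - fps_X ^ (2 * i)) * (\<Prod>i\<in>{i\<in>{1..N}. 2 * i > N}. 1 - fps_X ^ (2 * i))"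
    by (rule prod.union_disjoint) auto
  also have "(\<Prod>i\<in>{i\<in>{1..N}. 2 * i \<le> N}. 1 - fps_X ^ (2 * i)) = ev"
    unfolding ev_def by (rule prod.reindex_bij_witness[of _ "\<lambda>i. i div 2" "\<lambda>i. 2 * i"]) auto
  finally have prod: "qpoch_minus N * qpoch_plus N = ev * (\<Prod>i\<in>{i\<in>{1..N}. 2 * i > N}. 1 - fps_X ^ (2 * i))" .
  have "fps_eq_upto N (\<Prod>i\<in>{i\<in>{1..N}. 2 * i > N}. 1 - fps_X ^ (2 * i)) 1"
  proof (rule fps_eq_upto_prod_one)
    fix i assume "i \<in> {i\<in>{1..N}. 2 * i > N}"
    hence "fps_X ^ Suc N dvd (fps_X :: real fps) ^ (2 * i)" by (intro fps_X_power_dvd) auto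
    thus "fps_eq_upto N (1 - fps_X ^ (2 * i)) 1" by (simp add: fps_eq_upto_def del: power_Suc)
  qed auto
  from fps_eq_upto_mult_left[OF this, of ev]
  have "fps_eq_upto N (qpoch_minus N * qpoch_plus N) ev" unfolding prod by simp
  from fps_eq_upto_mult[OF this, of "inverse ev * inv_plus N"]
  have "fps_eq_upto N (qpoch_minus N * qpoch_plus N * (inverse ev * inv_plus N)) (ev * (inverse ev * inv_plus N))" .
  also have "ev * (inverse ev * inv_plus N) = (inverse ev * ev) * inv_plus N" by (simp only: mult_ac)
  also have "\<dots> = inv_plus N" unfolding ev_unit by simp
  also have "qpoch_minus N * qpoch_plus N * (inverse ev * inv_plus N) = odd_prod N * ((inverse ev * ev) * (inv_plus N * qpoch_plus N))"
    unfolding qm by (simp only: mult_ac)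
  also have "\<dots> = odd_prod N" unfolding ev_unit inv_plus by simp
  finally show ?thesis .
qed

text \<open>The two crank sums start at m = 2 and j = 1. Completed to start at 0 they are the sums
  of \<open>euler_sum\<close> and \<open>cauchy_sum\<close>: the added term j = 0 cancels the first
  of these, and the added terms m = 0, 1 leave -1 + 2q, which does not reach the coefficients from n
  = 2 on.\<close>

lemma crank_parity_eq_nth:
  assumes "n \<ge> 2"
  shows "crank_parity n = fps_nth (theta n * odd_prod n) n"
proof -
  define T where "T = (\<Sum>m\<le>n. (-1) ^ m * fps_X ^ m * inv_minus m)"
  define S where "S = (\<Sum>j\<le>n. (-1) ^ j * fps_X ^ j * qratio j)"
  define A where "A = (\<Sum>m=2..n. (-1) ^ m * fps_X ^ m * ((1 - fps_X) * inv_minus m))"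
  define B where "B = (\<Sum>j=1..n. (-1) ^ j * fps_X ^ j * ((1 - fps_X) * qratio j * inv_plus n))"
  have nth: "fps_nth ((-1) ^ m * fps_X ^ m * G) n = (-1) ^ m * fps_nth G (n - m)" if "m \<le> n" for m and G :: "real fps"
  proof -
    show ?thesis using that by (cases "even m") (simp_all add: fps_X_power_mult_nth)
  qed
  have "crank_parity n = fps_nth A n + fps_nth B n"
  proof -
    have "fps_nth A n = (\<Sum>m=2..n. (-1) ^ m * partition_weight (\<lambda>_. 1) {2..m} (n - m))"
      unfolding A_def fps_sum_nth
      by (intro sum.cong refl) (simp add: nth partition_fps_one[symmetric] partition_fps_def)
    moreover have "fps_nth B n = (\<Sum>j=1..n. (-1) ^ j * partition_weight (large_sign j) {2..n} (n - j))"
      unfolding B_def fps_sum_nth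
      by (intro sum.cong refl) (simp add: nth partition_fps_large_sign[symmetric] partition_fps_def)
    ultimately show ?thesis using crank_parity_eq[of n n] assms by simp
  qed
  also have "\<dots> = fps_nth (A + B) n" by simp
  also have "\<dots> = fps_nth (theta n * odd_prod n - 1 + 2 * fps_X) n"
  proof (rule fps_eq_upto_nth)
    have T: "T = 1 + - fps_X * inv_minus 1 + (\<Sum>m=2..n. (-1) ^ m * fps_X ^ m * inv_minus m)"
    proof -
      have "{..n} = insert 0 (insert 1 {2..n})" using assms by auto
      thus ?thesis using inv_minus[of 0] unfolding T_def by (simp add: add.assoc)
    qed
    have "(1 - fps_X) * inv_minus 1 = 1" using inv_minus_Suc[of 0] inv_minus[of 0] by (simp add: mult.commute)
    hence "(1 - fps_X) * T = (1 - fps_X) - fps_X + A"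
      unfolding T A_def distrib_left sum_distrib_left
      by (simp add: mult.left_commute[of "1 - fps_X"] mult.commute[of "1 - fps_X"] mult.assoc)
    hence A: "A = (1 - fps_X) * T - 1 + 2 * fps_X" by (simp add: algebra_simps)
    have "S = 1 + (\<Sum>j=1..n. (-1) ^ j * fps_X ^ j * qratio j)"
    proof -
      have "{..n} = insert 0 {1..n}" by auto
      thus ?thesis unfolding S_def by simp
    qed
    hence B: "B = (1 - fps_X) * S * inv_plus n - (1 - fps_X) * inv_plus n"
      unfolding B_def by (simp add: distrib_left distrib_right sum_distrib_left sum_distrib_right mult_ac)
    have 1: "fps_eq_upto n ((1 - fps_X) * T) ((1 - fps_X) * inv_plus n)"
    proof -
      have "fps_eq_upto n (T * qpoch_plus n * ((1 - fps_X) * inv_plus n)) (1 * ((1 - fps_X) * inv_plus n))"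
        unfolding T_def by (intro fps_eq_upto_mult euler_sum)
      also have "T * qpoch_plus n * ((1 - fps_X) * inv_plus n) = (1 - fps_X) * T * (inv_plus n * qpoch_plus n)"
        by (simp only: mult_ac)
      finally show ?thesis unfolding inv_plus by simp
    qed
    \<comment> \<open>The left side is (q;q)_n divided twice by (-q;q)_n: one division gives the
      theta series, the other the product over odd exponents.\<close>
    have 2: "fps_eq_upto n ((1 - fps_X) * S * inv_plus n) (theta n * odd_prod n)"
    proof -
      have "fps_eq_upto n ((1 - fps_X) * S * qpoch_plus n * inv_plus n * inv_plus n) (qpoch_minus n * inv_plus n * inv_plus n)"
        unfolding S_def by (intro fps_eq_upto_mult cauchy_sum)
      also have "(1 - fps_X) * S * qpoch_plus n * inv_plus n * inv_plus n = (1 - fps_X) * S * inv_plus n * (inv_plus n * qpoch_plus n)"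
        by (simp only: mult_ac)
      also have "\<dots> = (1 - fps_X) * S * inv_plus n" unfolding inv_plus by simp
      also have "fps_eq_upto n (qpoch_minus n * inv_plus n * inv_plus n) (theta n * inv_plus n)"
        by (intro fps_eq_upto_mult fps_eq_upto_sym[OF gauss_theta])
      also have "fps_eq_upto n (theta n * inv_plus n) (theta n * odd_prod n)"
        by (intro fps_eq_upto_mult_left fps_eq_upto_sym[OF odd_prod_eq_upto])
      finally show ?thesis .
    qed
    have "A + B - (theta n * odd_prod n - 1 + 2 * fps_X) =
       ((1 - fps_X) * T - (1 - fps_X) * inv_plus n) + ((1 - fps_X) * S * inv_plus n - theta n * odd_prod n)"
      unfolding A B by (simp add: algebra_simps)
    thus "fps_eq_upto n (A + B) (theta n * odd_prod n - 1 + 2 * fps_X)"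
      using 1 2 unfolding fps_eq_upto_def by (metis dvd_add)
  qed simp
  also have "\<dots> = fps_nth (theta n * odd_prod n) n"
  proof -
    have "fps_nth (2 * fps_X :: real fps) n = 0"
      using assms by (simp add: numeral_fps_const)
    thus ?thesis using assms by simp
  qed
  finally show ?thesis .
qed

section \<open>Size of the coefficients\<close>

lemma prod_one_minus_coeff_sum:
  fixes \<rho> :: real
  assumes "finite S" "0 \<le> \<rho>"
  shows "(\<Sum>m<K. \<bar>fps_nth (\<Prod>i\<in>S. 1 - fps_X ^ i) m\<bar> * \<rho> ^ m) \<le> (\<Prod>i\<in>S. 1 + \<rho> ^ i)"
  using assms(1)
proof (induction S arbitrary: K rule: finite_induct)
  case empty
  have "(\<Sum>m<K. \<bar>fps_nth (1 :: real fps) m\<bar> * \<rho> ^ m) = (\<Sum>m\<in>{..<K} \<inter> {0}. 1)"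
    by (intro sum.mono_neutral_cong_right) auto
  also have "\<dots> \<le> 1" by (cases "K = 0") auto
  finally show ?case by simp
next
  case (insert i S)
  define f :: "real fps" where "f = (\<Prod>i\<in>S. 1 - fps_X ^ i)"
  define B where "B = (\<Prod>i\<in>S. 1 + \<rho> ^ i)"
  have IH: "(\<Sum>m<K. \<bar>fps_nth f m\<bar> * \<rho> ^ m) \<le> B" for K using insert.IH by (simp add: f_def B_def)
  have nth: "fps_nth ((1 - fps_X ^ i) * f) m = fps_nth f m - (if m < i then 0 else fps_nth f (m - i))" for m
    by (simp add: left_diff_distrib fps_X_power_mult_nth)
  have "(\<Sum>m<K. \<bar>fps_nth ((1 - fps_X ^ i) * f) m\<bar> * \<rho> ^ m) \<le>
     (\<Sum>m<K. \<bar>fps_nth f m\<bar> * \<rho> ^ m + (if m < i then 0 else \<bar>fps_nth f (m - i)\<bar> * \<rho> ^ m))"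
  proof (rule sum_mono)
    fix m
    have "\<bar>fps_nth ((1 - fps_X ^ i) * f) m\<bar> * \<rho> ^ m \<le> (\<bar>fps_nth f m\<bar> + (if m < i then 0 else \<bar>fps_nth f (m - i)\<bar>)) * \<rho> ^ m"
      unfolding nth using assms(2) by (intro mult_right_mono) auto
    thus "\<bar>fps_nth ((1 - fps_X ^ i) * f) m\<bar> * \<rho> ^ m \<le> \<bar>fps_nth f m\<bar> * \<rho> ^ m + (if m < i then 0 else \<bar>fps_nth f (m - i)\<bar> * \<rho> ^ m)"
      by (auto simp: distrib_right)
  qed
  also have "\<dots> = (\<Sum>m<K. \<bar>fps_nth f m\<bar> * \<rho> ^ m) + (\<Sum>m<K. if m < i then 0 else \<bar>fps_nth f (m - i)\<bar> * \<rho> ^ m)"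
    by (rule sum.distrib)
  also have "(\<Sum>m<K. if m < i then 0 else \<bar>fps_nth f (m - i)\<bar> * \<rho> ^ m) = (\<Sum>m<K - i. \<rho> ^ i * (\<bar>fps_nth f m\<bar> * \<rho> ^ m))"
  proof -
    have "(\<Sum>m<K. if m < i then 0 else \<bar>fps_nth f (m - i)\<bar> * \<rho> ^ m) = (\<Sum>m\<in>{i..<K}. \<bar>fps_nth f (m - i)\<bar> * \<rho> ^ m)"
      by (intro sum.mono_neutral_cong_right) auto
    also have "\<dots> = (\<Sum>m<K - i. \<rho> ^ i * (\<bar>fps_nth f m\<bar> * \<rho> ^ m))"
      by (rule sum.reindex_bij_witness[of _ "\<lambda>m. m + i" "\<lambda>m. m - i"]) (auto simp flip: power_add)
    finally show ?thesis .
  qed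
  also have "\<dots> = \<rho> ^ i * (\<Sum>m<K - i. \<bar>fps_nth f m\<bar> * \<rho> ^ m)" by (simp only: sum_distrib_left)
  also have "(\<Sum>m<K. \<bar>fps_nth f m\<bar> * \<rho> ^ m) + \<rho> ^ i * (\<Sum>m<K - i. \<bar>fps_nth f m\<bar> * \<rho> ^ m) \<le> B + \<rho> ^ i * B"
    using assms(2) by (intro add_mono mult_left_mono IH) auto
  also have "\<dots> = (1 + \<rho> ^ i) * B" by (simp add: algebra_simps)
  finally show ?case using insert.hyps by (simp add: f_def B_def)
qed

text \<open>With \<rho> = exp(-t), one coefficient times \<rho>^m is at most the product of 1 +
  \<rho>^i over odd i, hence at most the exponential of \<rho>/(1 - \<rho>^2) = 1/(exp(t) - exp(-t))
  <= 1/(2t).\<close>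

lemma odd_prod_coeff_bound:
  assumes "t > 0"
  shows "\<bar>fps_nth (odd_prod N) m\<bar> \<le> exp (real m * t + 1 / (2 * t))"
proof -
  define \<rho> where "\<rho> = exp (- t)"
  have \<rho>: "0 < \<rho>" "\<rho> < 1" using assms by (auto simp: \<rho>_def)
  have \<rho>2: "\<rho>\<^sup>2 < 1" using \<rho> by (simp add: power_less_one_iff)
  define S where "S = {i\<in>{1..N}. odd i}"
  have "\<bar>fps_nth (odd_prod N) m\<bar> * \<rho> ^ m \<le> (\<Sum>m<Suc m. \<bar>fps_nth (odd_prod N) m\<bar> * \<rho> ^ m)"
    using \<rho> by (intro member_le_sum) auto
  also have "\<dots> \<le> (\<Prod>i\<in>S. 1 + \<rho> ^ i)"
    unfolding odd_prod_def S_def using \<rho> by (intro prod_one_minus_coeff_sum) auto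
  also have "\<dots> \<le> (\<Prod>i\<in>S. exp (\<rho> ^ i))"
    using \<rho> by (intro prod_mono) (auto intro: exp_ge_add_one_self add_nonneg_nonneg)
  also have "\<dots> = exp (\<Sum>i\<in>S. \<rho> ^ i)" by (subst exp_sum) (auto simp: S_def)
  also have "(\<Sum>i\<in>S. \<rho> ^ i) \<le> 1 / (2 * t)"
  proof -
    have "(\<Sum>i\<in>S. \<rho> ^ i) = (\<Sum>k\<in>{k. 2 * k + 1 \<le> N}. \<rho> ^ (2 * k + 1))"
      unfolding S_def by (rule sum.reindex_bij_witness[of _ "\<lambda>k. 2 * k + 1" "\<lambda>i. i div 2"]) (auto elim!: oddE)
    also have "\<dots> \<le> (\<Sum>k<N. \<rho> ^ (2 * k + 1))"
      using \<rho> by (intro sum_mono2) auto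
    also have "\<dots> = \<rho> * (\<Sum>k<N. (\<rho>\<^sup>2) ^ k)" by (simp add: sum_distrib_left power_mult)
    also have "\<dots> \<le> \<rho> * (1 / (1 - \<rho>\<^sup>2))"
    proof (intro mult_left_mono)
      have "(\<lambda>k. (\<rho>\<^sup>2) ^ k) sums (1 / (1 - \<rho>\<^sup>2))" using \<rho> \<rho>2 by (intro geometric_sums) auto
      thus "(\<Sum>k<N. (\<rho>\<^sup>2) ^ k) \<le> 1 / (1 - \<rho>\<^sup>2)"
        using sum_le_suminf[of "\<lambda>k. (\<rho>\<^sup>2) ^ k" "{..<N}"] by (auto simp: sums_iff)
    qed (use \<rho> in auto)
    also have "\<dots> = 1 / (1 / \<rho> - \<rho>)" using \<rho> by (simp add: field_simps power2_eq_square)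
    also have "\<dots> \<le> 1 / (2 * t)"
    proof (intro divide_left_mono)
      have "1 / \<rho> \<ge> 1 + t + t\<^sup>2 / 2"
        using exp_lower_Taylor_quadratic[of t] assms by (simp add: \<rho>_def exp_minus inverse_eq_divide)
      moreover have "\<rho> \<le> 1 - t + t\<^sup>2 / 2"
      proof -
        \<comment> \<open>The quadratic Taylor polynomials of exp(t) and exp(-t) have product at
          least 1, which converts the lower bound for exp(t) into an upper bound for
          exp(-t).\<close>
        have "(1 - t + t\<^sup>2 / 2) * (1 + t + t\<^sup>2 / 2) = 1 + (t\<^sup>2)\<^sup>2 / 4"
          by (simp add: algebra_simps power2_eq_square)
        hence "1 \<le> (1 - t + t\<^sup>2 / 2) * (1 + t + t\<^sup>2 / 2)" by simp
        also have "\<dots> \<le> (1 - t + t\<^sup>2 / 2) * (1 / \<rho>)"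
        proof (rule mult_left_mono)
          have "0 \<le> (1 - t)\<^sup>2 + 1" by simp
          thus "0 \<le> 1 - t + t\<^sup>2 / 2" by (simp add: power2_eq_square algebra_simps)
        qed fact
        finally show ?thesis using \<rho> by (simp add: field_simps)
      qed
      ultimately show "2 * t \<le> 1 / \<rho> - \<rho>" by linarith
      thus "0 < (1 / \<rho> - \<rho>) * (2 * t)" using assms by (intro mult_pos_pos) auto
    qed auto
    finally show ?thesis .
  qed
  finally have "\<bar>fps_nth (odd_prod N) m\<bar> * \<rho> ^ m \<le> exp (1 / (2 * t))" by simp
  moreover have "\<rho> ^ m * exp (real m * t) = 1"
    by (simp add: \<rho>_def exp_of_nat_mult[symmetric] flip: exp_add)
  ultimately have "\<bar>fps_nth (odd_prod N) m\<bar> * \<rho> ^ m * exp (real m * t) \<le> exp (1 / (2 * t)) * exp (real m * t)"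
    by (intro mult_right_mono) auto
  hence "\<bar>fps_nth (odd_prod N) m\<bar> * (\<rho> ^ m * exp (real m * t)) \<le> exp (real m * t) * exp (1 / (2 * t))"
    by (simp only: mult_ac)
  thus ?thesis unfolding \<open>\<rho> ^ m * exp (real m * t) = 1\<close> exp_add by simp
qed

theorem crank_parity_bound:
  assumes "n \<ge> 2"
  shows "\<bar>crank_parity n\<bar> \<le> (2 * real n + 1) * exp (sqrt (2 * real n))"
proof -
  \<comment> \<open>The minimizer of n t + 1/(2t), with minimum sqrt(2n). The factor 2n + 1 in the
    bound is the sum of the absolute values of the coefficients of \<open>theta n\<close>.\<close>
  define t where "t = 1 / sqrt (2 * real n)"
  have t: "t > 0" using assms by (simp add: t_def)
  define B where "B = exp (sqrt (2 * real n))"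
  have B: "\<bar>fps_nth (odd_prod n) m\<bar> \<le> B" if "m \<le> n" for m
  proof -
    have "real m * t + 1 / (2 * t) \<le> real n * t + 1 / (2 * t)" using that t by (intro add_mono mult_right_mono) auto
    also have "\<dots> = sqrt (2 * real n)"
    proof -
      define w where "w = sqrt (2 * real n)"
      have w: "w > 0" "w * w = 2 * real n" using assms by (auto simp: w_def)
      have "real n * t = w / 2" "1 / (2 * t) = w / 2"
        using w by (simp_all add: t_def w_def[symmetric] divide_simps)
      thus ?thesis by (simp add: w_def)
    qed
    finally show ?thesis using odd_prod_coeff_bound[OF t, of n m] unfolding B_def by (meson exp_le_cancel_iff order_trans)
  qed
  have term_bound: "\<bar>fps_nth ((-1) ^ s * fps_X ^ (s\<^sup>2) * odd_prod n) n\<bar> \<le> B" for s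
  proof -
    have "fps_nth ((-1) ^ s * fps_X ^ (s\<^sup>2) * odd_prod n) n = (-1) ^ s * (if n < s\<^sup>2 then 0 else fps_nth (odd_prod n) (n - s\<^sup>2))"
      by (cases "even s") (simp_all add: fps_X_power_mult_nth)
    moreover have "B \<ge> 0" by (simp add: B_def)
    ultimately show ?thesis using B[of "n - s\<^sup>2"] by (simp add: abs_mult)
  qed
  have "crank_parity n = fps_nth (odd_prod n) n + 2 * (\<Sum>s=1..n. fps_nth ((-1) ^ s * fps_X ^ (s\<^sup>2) * odd_prod n) n)"
  proof -
    have "theta n * odd_prod n = odd_prod n + fps_const 2 * (\<Sum>s=1..n. (-1) ^ s * fps_X ^ (s\<^sup>2) * odd_prod n)"
      unfolding theta_def by (simp add: distrib_right sum_distrib_right mult.assoc numeral_fps_const)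
    thus ?thesis unfolding crank_parity_eq_nth[OF assms] by (simp add: fps_sum_nth)
  qed
  hence "\<bar>crank_parity n\<bar> \<le> \<bar>fps_nth (odd_prod n) n\<bar> + 2 * \<bar>\<Sum>s=1..n. fps_nth ((-1) ^ s * fps_X ^ (s\<^sup>2) * odd_prod n) n\<bar>"
    by linarith
  also have "\<bar>\<Sum>s=1..n. fps_nth ((-1) ^ s * fps_X ^ (s\<^sup>2) * odd_prod n) n\<bar> \<le> (\<Sum>s=1..n. B)"
    by (intro order.trans[OF sum_abs] sum_mono term_bound)
  finally show ?thesis using B[of n] by (simp add: B_def algebra_simps)
qed

section \<open>The quotient of consecutive values\<close>

lemma exp_minus_bounds:
  fixes y :: real
  assumes "y \<ge> 0"
  shows "1 - y + y\<^sup>2 / 2 - y ^ 3 / 6 \<le> exp (- y)" "exp (- y) \<le> 1 - y + y\<^sup>2 / 2"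
proof -
  obtain t where "exp (- y) = (\<Sum>m<4. (- y) ^ m / fact m) + exp t / fact 4 * (- y) ^ 4"
    using Maclaurin_exp_le[of "- y" 4] by auto
  moreover have "exp t / fact 4 * (- y) ^ 4 \<ge> 0" by simp
  moreover have "(\<Sum>m<4. (- y) ^ m / fact m) = 1 - y + y\<^sup>2 / 2 - y ^ 3 / 6"
    by (simp add: eval_nat_numeral)
  ultimately show "1 - y + y\<^sup>2 / 2 - y ^ 3 / 6 \<le> exp (- y)" by linarith
next
  obtain t where "exp (- y) = (\<Sum>m<3. (- y) ^ m / fact m) + exp t / fact 3 * (- y) ^ 3"
    using Maclaurin_exp_le[of "- y" 3] by auto
  moreover have "exp t / fact 3 * (- y) ^ 3 \<le> 0" using assms by (simp add: mult_nonneg_nonpos)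
  moreover have "(\<Sum>m<3. (- y) ^ m / fact m) = 1 - y + y\<^sup>2 / 2"
    by (simp add: eval_nat_numeral)
  ultimately show "exp (- y) \<le> 1 - y + y\<^sup>2 / 2" by linarith
qed

text \<open>Here x, xm, xp are the values of \<mu> at n and its two neighbours, and \<open>B\<close>
  is the quotient of the main terms. Since (xm xp)^2 = x^4 - h^2, everything can be expanded in v =
  1/x and q = k v^4; square roots are estimated by comparing squares. The exponential contributes -k
  v^3/4, the cube 3 k v^4/2, and the linear factors -k v^4/2 - 3 k v^5/4.\<close>

lemma main_ratio_bounds:
  fixes x h xm xp :: real
  defines "k \<equiv> h\<^sup>2" and "v \<equiv> 1 / x"
  defines "B \<equiv> (xm - 1) * (xp - 1) / (x - 1)\<^sup>2 * (x\<^sup>2 / (xm * xp)) ^ 3 * exp (xm + xp - 2 * x)"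
  assumes x: "x \<ge> 115" and k: "(4328 / 100) \<le> k" "k \<le> (433 / 10)" and pos: "xm > 0" "xp > 0"
    and sq: "xm\<^sup>2 = x\<^sup>2 - h" "xp\<^sup>2 = x\<^sup>2 + h"
  shows "B \<le> 1 - k / 4 * v ^ 3 + k * v ^ 4 - 3 / 4 * k * v ^ 5 + 60 * v ^ 6"
    and "B \<ge> 1 - k / 4 * v ^ 3 + k * v ^ 4 - 3 / 4 * k * v ^ 5 - (38 / 10) * v ^ 6"
proof -
  have x0: "x > 0" using x by simp
  have xv: "x * v = 1" using x0 by (simp add: v_def)
  have v: "0 < v" "v \<le> 1 / 115" using x by (auto simp: v_def field_simps)
  define q where "q = k * v ^ 4"
  have v4: "v ^ 4 \<le> (1 / 115) ^ 4" using v by (intro power_mono) auto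
  have q: "0 < q" "q \<le> 1 / 1000000"
  proof -
    show "q > 0" using v k by (simp add: q_def)
    have "q \<le> (433 / 10) * (1 / 115) ^ 4" unfolding q_def using k v4 v by (intro mult_mono) auto
    also have "\<dots> \<le> 1 / 1000000" by (simp add: power_divide)
    finally show "q \<le> 1 / 1000000" .
  qed
  define p where "p = xm * xp"
  define r where "r = p * v\<^sup>2"
  have p0: "p > 0" using pos by (simp add: p_def)
  have p_sq: "p\<^sup>2 = x ^ 4 - k"
  proof -
    have "p\<^sup>2 = (x\<^sup>2 - h) * (x\<^sup>2 + h)" unfolding p_def power_mult_distrib sq ..
    thus ?thesis by (simp add: k_def algebra_simps power2_eq_square power4_eq_xxxx)
  qed
  have r0: "r > 0" using p0 v by (simp add: r_def)
  have p_r: "p = r * x\<^sup>2" using xv by (simp add: r_def power2_eq_square algebra_simps)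
  have r_sq: "r\<^sup>2 = 1 - q"
  proof -
    have "r\<^sup>2 = p\<^sup>2 * v ^ 4" by (simp add: r_def power_mult_distrib flip: power_mult)
    also have "\<dots> = (x * v) ^ 4 - q" unfolding p_sq q_def by (simp add: algebra_simps power_mult_distrib)
    finally show ?thesis using xv by simp
  qed
  have qq: "q\<^sup>2 \<ge> 0" "q ^ 3 \<le> q\<^sup>2 / 1000000" "q ^ 3 \<ge> 0" "q ^ 4 \<le> q\<^sup>2 / 1000000" "q ^ 4 \<ge> 0"
  proof -
    have "q\<^sup>2 * q \<le> q\<^sup>2 * (1 / 1000000)" using q by (intro mult_left_mono) auto
    thus "q ^ 3 \<le> q\<^sup>2 / 1000000" by (simp add: power3_eq_cube power2_eq_square)
    have "q\<^sup>2 * q\<^sup>2 \<le> q\<^sup>2 * (1 / 1000000)\<^sup>2" using q by (intro mult_left_mono power_mono) auto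
    also have "\<dots> \<le> q\<^sup>2 * (1 / 1000000)" by (intro mult_left_mono) (auto simp: power2_eq_square)
    finally show "q ^ 4 \<le> q\<^sup>2 / 1000000" by (simp add: power4_eq_xxxx power2_eq_square mult_ac)
  qed (use q in auto)
  have r_le: "r \<le> 1 - q / 2"
  proof (rule power2_le_imp_le)
    show "r\<^sup>2 \<le> (1 - q / 2)\<^sup>2" unfolding r_sq by (simp add: power2_eq_square algebra_simps)
  qed (use q in auto)
  have r_ge: "r \<ge> 1 - q / 2 - q\<^sup>2 / 4"
  proof (rule power2_le_imp_le)
    have "(1 - q / 2 - q\<^sup>2 / 4)\<^sup>2 = 1 - q - q\<^sup>2 / 4 + q ^ 3 / 4 + q ^ 4 / 16"
      by (simp add: eval_nat_numeral algebra_simps)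
    thus "(1 - q / 2 - q\<^sup>2 / 4)\<^sup>2 \<le> r\<^sup>2" unfolding r_sq using qq by linarith
  qed (use r0 in auto)
  define S where "S = xm + xp"
  define d where "d = 2 * x - S"
  have S0: "S > 0" using pos by (simp add: S_def)
  have S_sq: "S\<^sup>2 = 2 * x\<^sup>2 * (1 + r)"
  proof -
    have "S\<^sup>2 = xm\<^sup>2 + xp\<^sup>2 + 2 * p" by (simp add: S_def p_def power2_eq_square algebra_simps)
    thus ?thesis unfolding sq p_r by (simp add: algebra_simps)
  qed
  have xq: "x * q = k * v ^ 3"
  proof -
    have "x * q = k * v ^ 3 * (x * v)" by (simp add: q_def eval_nat_numeral)
    thus ?thesis using xv by simp
  qed
  have x2q: "x\<^sup>2 * q = k * v\<^sup>2"
  proof -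
    have "x\<^sup>2 * q = k * v\<^sup>2 * (x * v)\<^sup>2" by (simp add: q_def eval_nat_numeral)
    thus ?thesis using xv by simp
  qed
  \<comment> \<open>To first order d = x q/4 = k v^3/4; the true value exceeds this by a relative
    error of at most q.\<close>
  define dl where "dl = k * v ^ 3 / 4"
  define du where "du = k * v ^ 3 / 4 * (1 + q)"
  have d_ge: "dl \<le> d"
  proof -
    have "S \<le> 2 * x - x * q / 4"
    proof (rule power2_le_imp_le)
      have "S\<^sup>2 \<le> 2 * x\<^sup>2 * (1 + (1 - q / 2))" unfolding S_sq using r_le by (intro mult_left_mono) auto
      also have "\<dots> \<le> 2 * x\<^sup>2 * (1 + (1 - q / 2)) + (x * q / 4)\<^sup>2" by simp
      also have "\<dots> = (2 * x - x * q / 4)\<^sup>2" by (simp add: power2_eq_square algebra_simps)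
      finally show "S\<^sup>2 \<le> (2 * x - x * q / 4)\<^sup>2" .
      have "x * q \<le> x * 1" using q x0 by (intro mult_left_mono) auto
      thus "0 \<le> 2 * x - x * q / 4" using x0 by simp
    qed
    thus ?thesis by (simp add: d_def dl_def xq)
  qed
  have d_le: "d \<le> du"
  proof -
    have "2 * x - x * q / 4 * (1 + q) \<le> S"
    proof (rule power2_le_imp_le)
      have "(2 * x - x * q / 4 * (1 + q))\<^sup>2 = x\<^sup>2 * (4 - q - 15 / 16 * q\<^sup>2 + q ^ 3 / 8 + q ^ 4 / 16)"
        by (simp add: eval_nat_numeral algebra_simps)
      also have "\<dots> \<le> x\<^sup>2 * (4 - q - q\<^sup>2 / 2)"
      proof (rule mult_left_mono)
        show "4 - q - 15 / 16 * q\<^sup>2 + q ^ 3 / 8 + q ^ 4 / 16 \<le> 4 - q - q\<^sup>2 / 2"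
          using qq by linarith
      qed simp
      also have "\<dots> = x\<^sup>2 * (2 * (1 + (1 - q / 2 - q\<^sup>2 / 4)))" by (simp add: algebra_simps)
      also have "\<dots> \<le> x\<^sup>2 * (2 * (1 + r))" using r_ge by (intro mult_left_mono) auto
      also have "\<dots> = S\<^sup>2" unfolding S_sq by simp
      finally show "(2 * x - x * q / 4 * (1 + q))\<^sup>2 \<le> S\<^sup>2" .
    qed (use S0 in auto)
    thus ?thesis by (simp add: d_def du_def xq)
  qed
  define R where "R = (x\<^sup>2 / (xm * xp)) ^ 3"
  \<comment> \<open>R = r^(-3) and (1 - q)^2 = r^4, so the negative power of r is traded for r
    itself, which is already bounded on both sides.\<close>
  have R_eq: "R * (1 - q)\<^sup>2 = r"
  proof -
    have "x\<^sup>2 / (xm * xp) = 1 / r" using x0 p0 unfolding p_def[symmetric] p_r by simp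
    hence "R = 1 / r ^ 3" by (simp add: R_def power_one_over)
    thus ?thesis unfolding r_sq[symmetric] using r0 by (simp add: eval_nat_numeral)
  qed
  have R0: "R \<ge> 0" using pos x0 by (simp add: R_def)
  have q1: "(1 - q)\<^sup>2 > 0" using q by simp
  have R_ge: "R \<ge> 1 + 3 / 2 * q"
  proof -
    have "(1 + 3 / 2 * q) * (1 - q)\<^sup>2 = 1 - q / 2 - 2 * q\<^sup>2 + 3 / 2 * q ^ 3"
      by (simp add: eval_nat_numeral algebra_simps)
    also have "\<dots> \<le> R * (1 - q)\<^sup>2" unfolding R_eq using r_ge qq by linarith
    finally show ?thesis using q1 by (rule mult_right_le_imp_le)
  qed
  have R_le: "R \<le> 1 + 3 / 2 * q + 3 * q\<^sup>2"
  proof -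
    have "R * (1 - q)\<^sup>2 \<le> 1 - q / 2 + q\<^sup>2 - 9 / 2 * q ^ 3 + 3 * q ^ 4" unfolding R_eq using r_le qq by linarith
    also have "\<dots> = (1 + 3 / 2 * q + 3 * q\<^sup>2) * (1 - q)\<^sup>2"
      by (simp add: eval_nat_numeral algebra_simps)
    finally show ?thesis using q1 by (rule mult_right_le_imp_le)
  qed
  \<comment> \<open>The relative defect of (xm - 1)(xp - 1) against (x - 1)^2. Its numerator
    combines x^2 - p, about k v^2/2, with d, about k v^3/4.\<close>
  define g where "g = (x\<^sup>2 - p - d) / (x - 1)\<^sup>2"
  have A: "(xm - 1) * (xp - 1) / (x - 1)\<^sup>2 = 1 - g"
  proof -
    have "(xm - 1) * (xp - 1) = (x - 1)\<^sup>2 - (x\<^sup>2 - p - d)"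
      by (simp add: p_def d_def S_def power2_eq_square algebra_simps)
    moreover have "(x - 1)\<^sup>2 > 0" using x by simp
    ultimately show ?thesis by (simp add: g_def diff_divide_distrib)
  qed
  have g_eq: "g * (1 - v)\<^sup>2 = v\<^sup>2 * (x\<^sup>2 - p - d)"
  proof -
    have "1 - v = v * (x - 1)" using xv by (simp add: algebra_simps)
    hence "(1 - v)\<^sup>2 = v\<^sup>2 * (x - 1)\<^sup>2" by (simp add: power_mult_distrib)
    moreover have "(x - 1)\<^sup>2 > 0" using x by simp
    ultimately show ?thesis by (simp add: g_def)
  qed
  have v1: "(1 - v)\<^sup>2 > 0" using v by simp
  have vv: "v\<^sup>2 \<ge> 0" "v ^ 3 \<le> v\<^sup>2 / 115" "v ^ 3 \<ge> 0" "v ^ 4 \<ge> 0"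
  proof -
    have "v\<^sup>2 * v \<le> v\<^sup>2 * (1 / 115)" using v by (intro mult_left_mono) auto
    thus "v ^ 3 \<le> v\<^sup>2 / 115" by (simp add: power3_eq_cube power2_eq_square)
  qed (use v in auto)
  have xp_ge: "x\<^sup>2 - p \<ge> k * v\<^sup>2 / 2" and xp_le: "x\<^sup>2 - p \<le> k * v\<^sup>2 * (1 / 2 + q / 4)"
  proof -
    have eq: "x\<^sup>2 - p = x\<^sup>2 * (1 - r)" by (simp add: p_r algebra_simps)
    have "x\<^sup>2 * (q / 2) \<le> x\<^sup>2 * (1 - r)" using r_le by (intro mult_left_mono) auto
    thus "x\<^sup>2 - p \<ge> k * v\<^sup>2 / 2" unfolding eq using x2q by simp
    have "x\<^sup>2 * (1 - r) \<le> x\<^sup>2 * (q * (1 / 2 + q / 4))" using r_ge by (intro mult_left_mono) (auto simp: power2_eq_square algebra_simps)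
    also have "\<dots> = k * v\<^sup>2 * (1 / 2 + q / 4)" unfolding x2q[symmetric] by simp
    finally show "x\<^sup>2 - p \<le> k * v\<^sup>2 * (1 / 2 + q / 4)" unfolding eq .
  qed
  have k4: "k * v ^ 4 \<ge> 0" using k v by simp
  have g_ge: "g \<ge> k * v ^ 4 * (1 / 2 + 3 / 4 * v)"
  proof -
    have qv: "v * q \<le> v * v"
    proof -
      have "q = v * (k * v ^ 3)" by (simp add: q_def eval_nat_numeral)
      also have "\<dots> \<le> v * 1"
      proof (intro mult_left_mono)
        have "k * v ^ 3 \<le> (433 / 10) * (1 / 115) ^ 3" using k v by (intro mult_mono power_mono) auto
        also have "\<dots> \<le> 1" by (simp add: power_divide)
        finally show "k * v ^ 3 \<le> 1" .
      qed (use v in auto)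
      finally show ?thesis using v by (intro mult_left_mono) auto
    qed
    have "(1 / 2 + 3 / 4 * v) * (1 - v)\<^sup>2 = 1 / 2 - v / 4 - v\<^sup>2 + 3 / 4 * v ^ 3"
      by (simp add: power2_eq_square power3_eq_cube field_simps)
    hence "k * v ^ 4 * (1 / 2 + 3 / 4 * v) * (1 - v)\<^sup>2 = k * v ^ 4 * (1 / 2 - v / 4 - v\<^sup>2 + 3 / 4 * v ^ 3)"
      by (simp only: mult.assoc)
    also have "\<dots> \<le> k * v ^ 4 * (1 / 2 - v / 4 * (1 + q))"
    proof (rule mult_left_mono[OF _ k4])
      have "v\<^sup>2 = v * v" by (rule power2_eq_square)
      moreover have "v / 4 * (1 + q) = v / 4 + v * q / 4" by (simp add: algebra_simps)
      ultimately show "1 / 2 - v / 4 - v\<^sup>2 + 3 / 4 * v ^ 3 \<le> 1 / 2 - v / 4 * (1 + q)" using qv vv by linarith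
    qed
    also have "\<dots> = v\<^sup>2 * (k * v\<^sup>2 / 2 - du)" by (simp add: du_def eval_nat_numeral algebra_simps)
    also have "\<dots> \<le> v\<^sup>2 * (x\<^sup>2 - p - d)" using xp_ge d_le by (intro mult_left_mono) auto
    also have "\<dots> = g * (1 - v)\<^sup>2" by (rule g_eq[symmetric])
    finally show ?thesis using v1 by (rule mult_right_le_imp_le)
  qed
  have g_le: "g \<le> k * v ^ 4 * (1 / 2 + 3 / 4 * v + (102 / 100) * v\<^sup>2 + (52 / 100) * q)"
  proof -
    have "g * (1 - v)\<^sup>2 = v\<^sup>2 * (x\<^sup>2 - p - d)" by (rule g_eq)
    also have "\<dots> \<le> v\<^sup>2 * (k * v\<^sup>2 * (1 / 2 + q / 4) - dl)" using xp_le d_ge by (intro mult_left_mono) auto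
    also have "\<dots> = k * v ^ 4 * (1 / 2 - v / 4 + q / 4)" by (simp add: dl_def eval_nat_numeral algebra_simps)
    also have "\<dots> \<le> k * v ^ 4 * ((1 / 2 + 3 / 4 * v + (102 / 100) * v\<^sup>2 + (52 / 100) * q) * (1 - v)\<^sup>2)"
    proof (rule mult_left_mono[OF _ k4])
      have "(1 - v)\<^sup>2 \<ge> (1 - 1 / 115)\<^sup>2" using v by (intro power_mono) auto
      hence "(1 - v)\<^sup>2 \<ge> 1 / 2" by (simp add: power2_eq_square)
      hence "q * (1 / 2) \<le> q * (1 - v)\<^sup>2" using q by (intro mult_left_mono) auto
      moreover have "(1 / 2 + 3 / 4 * v + 102 / 100 * v\<^sup>2 + 52 / 100 * q) * (1 - v)\<^sup>2 =
          1 / 2 - v / 4 + 2 / 100 * v\<^sup>2 - 129 / 100 * v ^ 3 + 102 / 100 * v ^ 4 + 52 / 100 * (q * (1 - v)\<^sup>2)"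
        by (simp add: eval_nat_numeral field_simps)
      ultimately show "1 / 2 - v / 4 + q / 4 \<le> (1 / 2 + 3 / 4 * v + (102 / 100) * v\<^sup>2 + (52 / 100) * q) * (1 - v)\<^sup>2"
        using vv q by linarith
    qed
    finally have "g * (1 - v)\<^sup>2 \<le> k * v ^ 4 * (1 / 2 + 3 / 4 * v + (102 / 100) * v\<^sup>2 + (52 / 100) * q) * (1 - v)\<^sup>2" by simp
    thus ?thesis using v1 by (rule mult_right_le_imp_le)
  qed
  have B: "B = (1 - g) * R * exp (- d)" unfolding B_def A R_def by (simp add: d_def S_def)
  have g0: "g \<ge> 0"
  proof -
    have "0 \<le> k * v ^ 4 * (1 / 2 + 3 / 4 * v)" by (rule mult_nonneg_nonneg[OF k4]) (use v in auto)
    thus ?thesis using g_ge by linarith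
  qed
  have g_half: "g \<le> k * v ^ 4"
  proof -
    have "1 / 2 + 3 / 4 * v + (102 / 100) * v\<^sup>2 + (52 / 100) * q \<le> 1"
    proof -
      have "v\<^sup>2 \<le> (1 / 115)\<^sup>2" using v by (intro power_mono) auto
      thus ?thesis using v q by (simp add: power2_eq_square)
    qed
    hence "k * v ^ 4 * (1 / 2 + 3 / 4 * v + (102 / 100) * v\<^sup>2 + (52 / 100) * q) \<le> k * v ^ 4 * 1" by (rule mult_left_mono[OF _ k4])
    thus ?thesis using g_le by simp
  qed
  have g1: "g \<le> 1" using g_half q by (simp add: q_def)
  have dl0: "dl \<ge> 0" using k v by (simp add: dl_def)
  have kv: "k\<^sup>2 \<le> 1875" "k\<^sup>2 \<ge> 1873"
  proof -
    have "k\<^sup>2 \<le> (433 / 10)\<^sup>2" using k by (intro power_mono) auto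
    thus "k\<^sup>2 \<le> 1875" by (simp add: power2_eq_square)
    have "k\<^sup>2 \<ge> (4328 / 100)\<^sup>2" using k by (intro power_mono) auto
    thus "k\<^sup>2 \<ge> 1873" by (simp add: power2_eq_square)
  qed
  have v6: "v ^ 6 > 0" using v by simp
  have v7: "v ^ 7 \<le> v ^ 6 / 115" and v8: "v ^ 8 \<le> v ^ 6 / 13225" and v9: "v ^ 9 \<le> v ^ 6 / 1000000"
  proof -
    have "v ^ 6 * v ^ j \<le> v ^ 6 * (1 / 115) ^ j" for j
      by (rule mult_left_mono, rule power_mono) (use v v6 in auto)
    note step = this
    have e: "v ^ 7 = v ^ 6 * v ^ 1" "v ^ 8 = v ^ 6 * v ^ 2" "v ^ 9 = v ^ 6 * v ^ 3"
      by (simp_all add: eval_nat_numeral)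
    show "v ^ 7 \<le> v ^ 6 / 115" unfolding e using step[of 1] by simp
    have "v ^ 6 * v ^ 2 \<le> v ^ 6 * (1 / 13225)" using step[of 2] by (simp only: power_divide) simp
    thus "v ^ 8 \<le> v ^ 6 / 13225" unfolding e by simp
    have "v ^ 6 * v ^ 3 \<le> v ^ 6 * (1 / 1520875)" using step[of 3] by (simp only: power_divide) simp
    thus "v ^ 9 \<le> v ^ 6 / 1000000" unfolding e using v6 by linarith
  qed
  show "B \<le> 1 - k / 4 * v ^ 3 + k * v ^ 4 - 3 / 4 * k * v ^ 5 + 60 * v ^ 6"
  proof -
    define E where "E = dl - dl\<^sup>2 / 2"
    define b where "b = 3 / 2 * q + 3 * q\<^sup>2"
    have dl1: "dl \<le> 1" 
    proof -
      have "k * v ^ 3 \<le> (433 / 10) * (1 / 115) ^ 3" using k v by (intro mult_mono power_mono) auto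
      thus ?thesis by (simp add: dl_def power_divide)
    qed
    have E0: "E \<ge> 0" 
    proof -
      have "dl * dl \<le> dl * 1" using dl0 dl1 by (intro mult_left_mono) auto
      thus ?thesis using dl0 by (simp add: E_def power2_eq_square)
    qed
    have "exp (- d) \<le> exp (- dl)" using d_ge by simp
    also have "\<dots> \<le> 1 - E" using exp_minus_bounds(2)[OF dl0] by (simp add: E_def)
    finally have e: "exp (- d) \<le> 1 - E" .
    have "(1 - g) * R \<le> (1 - g) * (1 + b)" using R_le g1 by (intro mult_left_mono) (auto simp: b_def)
    also have "\<dots> = 1 + b - g - g * b" by (simp add: algebra_simps)
    also have "\<dots> \<le> 1 + b - g" using g0 q by (simp add: b_def)
    finally have gR: "(1 - g) * R \<le> 1 + b - g" .
    have "g \<le> q" using g_half by (simp add: q_def)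
    hence bg: "b - g \<ge> 0" using q qq(1) unfolding b_def by linarith
    have "B \<le> (1 + b - g) * (1 - E)"
      unfolding B using gR e bg by (intro mult_mono) auto
    also have "\<dots> = 1 + b - g - E - (b - g) * E" by (simp add: algebra_simps)
    also have "\<dots> \<le> 1 + b - g - E" using bg E0 by simp
    also have "\<dots> \<le> 1 + b - k * v ^ 4 * (1 / 2 + 3 / 4 * v) - E" using g_ge by simp
    also have "\<dots> = 1 - k / 4 * v ^ 3 + k * v ^ 4 - 3 / 4 * k * v ^ 5 + k\<^sup>2 * (v ^ 6 / 32 + 3 * v ^ 8)"
      by (simp add: b_def E_def dl_def q_def eval_nat_numeral algebra_simps)
    \<comment> \<open>The sixth order term k^2/32 is half the square of \<open>dl\<close>; it
      dominates, with 1875/32 about 58.6. The bound for \<open>g\<close> used here stops at fifth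
      order.\<close>
    also have "k\<^sup>2 * (v ^ 6 / 32 + 3 * v ^ 8) \<le> 1875 * (v ^ 6 / 32 + 3 * (v ^ 6 / 13225))"
      using kv v8 v6 v by (intro mult_mono add_mono) auto
    also have "\<dots> \<le> 60 * v ^ 6" using v6 by simp
    finally show ?thesis by simp
  qed
  show "B \<ge> 1 - k / 4 * v ^ 3 + k * v ^ 4 - 3 / 4 * k * v ^ 5 - (38 / 10) * v ^ 6"
  proof -
    define E where "E = du - du\<^sup>2 / 2 + du ^ 3 / 6"
    define b where "b = 3 / 2 * q"
    have du_bounds: "dl \<le> du" "du \<le> (109 / 10) * v ^ 3" "du \<le> 1"
    proof -
      have "k * v ^ 3 / 4 * 1 \<le> du" unfolding du_def using k v q by (intro mult_left_mono) auto
      thus "dl \<le> du" by (simp add: dl_def)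
      have "du \<le> (433 / 10) * v ^ 3 / 4 * (1 + 1 / 1000000)"
        unfolding du_def using k v q by (intro mult_mono divide_right_mono add_mono) auto
      also have "\<dots> \<le> (109 / 10) * v ^ 3" using vv by simp
      finally show *: "du \<le> (109 / 10) * v ^ 3" .
      have "v ^ 3 \<le> (1 / 115) ^ 3" using v by (intro power_mono) auto
      hence "(109 / 10) * v ^ 3 \<le> 1" by (simp add: power_divide)
      with * show "du \<le> 1" by linarith
    qed
    have du0: "du \<ge> 0" using dl0 du_bounds by simp
    have E_le: "E \<le> du"
    proof -
      have "du\<^sup>2 * du \<le> du\<^sup>2 * 1" using du_bounds by (intro mult_left_mono) auto
      moreover have "du ^ 3 = du\<^sup>2 * du" by (simp add: eval_nat_numeral)
      moreover have "du\<^sup>2 \<ge> 0" by simp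
      ultimately show ?thesis unfolding E_def by linarith
    qed
    have E0: "E \<ge> 0"
    proof -
      have "du * du \<le> du * 1" using du0 du_bounds by (intro mult_left_mono) auto
      moreover have "du ^ 3 \<ge> 0" using du0 by simp
      ultimately show ?thesis using du0 by (simp add: E_def power2_eq_square)
    qed
    have "1 - E \<le> exp (- du)" using exp_minus_bounds(1)[OF du0] by (simp add: E_def)
    also have "\<dots> \<le> exp (- d)" using d_le by simp
    finally have e: "1 - E \<le> exp (- d)" .
    have b0: "b \<ge> 0" using q by (simp add: b_def)
    have "(1 - g) * (1 + b) * (1 - E) \<le> B"
      unfolding B using R_ge e g1 R0 b0 E_le du_bounds by (intro mult_mono) (auto simp: b_def)
    also have "(1 - g) * (1 + b) * (1 - E) = 1 + b - g - E - g * b - E * b + g * E + g * b * E" by (simp add: algebra_simps)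
    finally have "1 + b - g - E - g * b - E * b + g * E + g * b * E \<le> B" .
    moreover have "g * E \<ge> 0" "g * b * E \<ge> 0" using g0 E0 b0 by auto
    moreover have "g * b \<le> (25 / 100) * v ^ 6"
    proof -
      have "g * b \<le> (k * v ^ 4) * b" using g_half b0 by (rule mult_right_mono)
      also have "\<dots> = k\<^sup>2 * (3 / 2 * v ^ 8)" by (simp add: b_def q_def eval_nat_numeral)
      also have "\<dots> \<le> 1875 * (3 / 2 * (v ^ 6 / 13225))" using kv v8 v by (intro mult_mono) auto
      also have "\<dots> \<le> (25 / 100) * v ^ 6" using v6 by simp
      finally show ?thesis .
    qed
    moreover have "E * b \<le> (62 / 10) * v ^ 6"
    proof -
      have "E * b \<le> ((109 / 10) * v ^ 3) * (3 / 2 * ((433 / 10) * v ^ 4))"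
        unfolding b_def q_def using E_le du_bounds E0 k v by (intro mult_mono) auto
      also have "\<dots> = (707955 / 1000) * v ^ 7" by (simp add: eval_nat_numeral)
      also have "\<dots> \<le> (707955 / 1000) * (v ^ 6 / 115)" using v7 by (intro mult_left_mono) auto
      also have "\<dots> \<le> (62 / 10) * v ^ 6" using v6 by simp
      finally show ?thesis .
    qed
    moreover have "g \<le> k * v ^ 4 / 2 + 3 / 4 * k * v ^ 5 + (4425 / 100) * v ^ 6"
    proof -
      have "k * v ^ 4 * (1 / 2 + 3 / 4 * v + (102 / 100) * v\<^sup>2 + (52 / 100) * q) =
         k * v ^ 4 / 2 + 3 / 4 * k * v ^ 5 + (102 / 100) * k * v ^ 6 + (52 / 100) * (k\<^sup>2 * v ^ 8)"
        by (simp add: q_def eval_nat_numeral algebra_simps)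
      moreover have "k * v ^ 6 \<le> (433 / 10) * v ^ 6" using k v6 by (intro mult_right_mono) auto
      moreover have "k\<^sup>2 * v ^ 8 \<le> 1875 * (v ^ 6 / 13225)" using kv v8 v by (intro mult_mono) auto
      ultimately show ?thesis using g_le v6 by linarith
    qed
    moreover have "E \<le> k / 4 * v ^ 3 - (543 / 10) * v ^ 6"
    proof -
      have "du = k / 4 * v ^ 3 + k\<^sup>2 * v ^ 7 / 4" by (simp add: du_def q_def eval_nat_numeral algebra_simps)
      moreover have "k\<^sup>2 * v ^ 7 \<le> 1875 * (v ^ 6 / 115)" using kv v7 v by (intro mult_mono) auto
      moreover have "du\<^sup>2 / 2 \<ge> (585 / 10) * v ^ 6"
      proof -
        have "1873 * v ^ 6 \<le> k\<^sup>2 * v ^ 6" using kv v6 by (intro mult_right_mono) auto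
        moreover have "(k * v ^ 3 / 4)\<^sup>2 / 2 = k\<^sup>2 * v ^ 6 / 32"
          by (simp add: power_mult_distrib power_divide flip: power_mult)
        ultimately have "(585 / 10) * v ^ 6 \<le> (k * v ^ 3 / 4)\<^sup>2 / 2" using v6 by linarith
        also have "\<dots> \<le> du\<^sup>2 / 2" using du_bounds dl0 by (intro divide_right_mono power_mono) (auto simp: dl_def)
        finally show ?thesis .
      qed
      moreover have "du ^ 3 / 6 \<le> (1 / 1000) * v ^ 6"
      proof -
        have "du ^ 3 \<le> ((109 / 10) * v ^ 3) ^ 3" using du_bounds du0 by (intro power_mono) auto
        also have "\<dots> = (1295029 / 1000) * v ^ 9" by (simp add: eval_nat_numeral)
        also have "\<dots> \<le> (1295029 / 1000) * (v ^ 6 / 1000000)" using v9 by (intro mult_left_mono) auto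
        finally show ?thesis using v6 by linarith
      qed
      ultimately show ?thesis unfolding E_def using v6 by linarith
    qed
    moreover have "b = 3 / 2 * (k * v ^ 4)" by (simp add: b_def q_def)
    \<comment> \<open>Balance at sixth order: 54.3 gained from \<open>E\<close> against 44.25 from
      \<open>g\<close>, 0.25 from \<open>g * b\<close> and 6.2 from \<open>E * b\<close>, which
      stays above -3.8.\<close>
    ultimately show ?thesis using v6 by linarith
  qed
qed

section \<open>Errors at the three arguments and the final estimate\<close>

lemma mu_sq:
  assumes "n \<ge> 1"
  shows "(\<mu> n)\<^sup>2 = pi\<^sup>2 * (24 * real n - 1) / 36" "\<mu> n > 0"
  using assms by (simp_all add: \<mu>_def power_mult_distrib power_divide)

lemma partition_main_pos: "x > 1 \<Longrightarrow> partition_main x > 0"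
  by (simp add: partition_main_def)

text \<open>The exponent sqrt(2n) is about (sqrt(3)/pi) x, below 0.5516 x. The rest of exp(x)
  absorbs the powers: 0.2934 for x^8 and 0.1467 for the polynomial factor, and 0.5516 + 0.2934 +
  0.1467 = 0.9917 < 1.\<close>

lemma crank_parity_small:
  assumes "\<mu> n \<ge> 114.9"
  shows "\<bar>crank_parity n\<bar> \<le> 1 / \<mu> n ^ 6 * partition_main (\<mu> n)"
proof -
  define x where "x = \<mu> n"
  have x: "x \<ge> 114.9" "x > 0" using assms by (auto simp: x_def)
  note pi = pi_bounds(1,2) and pi2 = pi_bounds(3,4)
  \<comment> \<open>At n = 0 the radicand is -1, whose square root in HOL is -1, so \<mu> 0 is
    negative.\<close>
  have n1: "n \<ge> 1"
  proof (rule ccontr)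
    assume "\<not> n \<ge> 1"
    hence "n = 0" by simp
    hence "\<mu> n = - pi / 6" by (simp add: \<mu>_def real_sqrt_minus)
    thus False using assms pi by simp
  qed
  have x2: "x\<^sup>2 \<ge> 13202" 
  proof -
    have "x\<^sup>2 \<ge> 114.9\<^sup>2" using x by (intro power_mono) auto
    thus ?thesis by (simp add: power2_eq_square)
  qed
  have n: "real n = 3 * x\<^sup>2 / (2 * pi\<^sup>2) + 1 / 24"
    using mu_sq(1)[OF n1] by (simp add: x_def field_simps)
  have ub: "3 * x\<^sup>2 / pi\<^sup>2 \<le> 30399 / 100000 * x\<^sup>2"
  proof -
    have "3 * x\<^sup>2 / pi\<^sup>2 \<le> 3 * x\<^sup>2 / (9869 / 1000)" using pi2 by (intro divide_left_mono) auto
    thus ?thesis using x2 by simp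
  qed
  have lb: "3 * x\<^sup>2 / pi\<^sup>2 \<ge> 30 / 100 * x\<^sup>2"
  proof -
    have "3 * x\<^sup>2 / (987 / 100) \<le> 3 * x\<^sup>2 / pi\<^sup>2" using pi2 by (intro divide_left_mono) auto
    thus ?thesis using x2 by simp
  qed
  have n2: "2 * real n = 3 * x\<^sup>2 / pi\<^sup>2 + 1 / 12" unfolding n by simp
  have "n \<ge> 2" using n2 lb x2 by linarith
  from crank_parity_bound[OF this]
  have "\<bar>crank_parity n\<bar> \<le> (2 * real n + 1) * exp (sqrt (2 * real n))" .
  also have "\<dots> \<le> (31 / 100 * x\<^sup>2) * exp (5516 / 10000 * x)"
  proof (rule mult_mono)
    show "2 * real n + 1 \<le> 31 / 100 * x\<^sup>2" using n2 ub x2 by linarith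
    have "sqrt (2 * real n) \<le> 5516 / 10000 * x"
    proof (rule real_le_lsqrt)
      have "(5516 / 10000 * x)\<^sup>2 = 30426256 / 100000000 * x\<^sup>2" by (simp add: power_mult_distrib power_divide)
      thus "2 * real n \<le> (5516 / 10000 * x)\<^sup>2" using n2 ub x2 by linarith
    qed (use x in auto)
    thus "exp (sqrt (2 * real n)) \<le> exp (5516 / 10000 * x)" by simp
  qed auto
  also have "\<dots> \<le> 9 / 10 * (exp x / x ^ 8)"
  proof -
    have x8: "x ^ 8 \<le> 101 * exp (2934 / 10000 * x)" using exp_ge_power8[OF x(1)] by simp
    \<comment> \<open>Square root of the bound for x^8, with 101 enlarged to 121. Dividing by x^2 >=
      13202 then gives x^2 the small constant 1/1000.\<close>
    have "x ^ 4 \<le> 11 * exp (1467 / 10000 * x)"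
    proof (rule power2_le_imp_le)
      have "(x ^ 4)\<^sup>2 = x ^ 8" by (simp flip: power_mult)
      also have "\<dots> \<le> 121 * exp (2934 / 10000 * x)" using x8 exp_gt_zero[of "2934 / 10000 * x"] by linarith
      also have "\<dots> = (11 * exp (1467 / 10000 * x))\<^sup>2"
        by (simp add: power_mult_distrib exp_of_nat_mult[symmetric])
      finally show "(x ^ 4)\<^sup>2 \<le> (11 * exp (1467 / 10000 * x))\<^sup>2" .
    qed simp
    moreover have "13202 * x\<^sup>2 \<le> x ^ 4"
    proof -
      have "13202 * x\<^sup>2 \<le> x\<^sup>2 * x\<^sup>2" using x2 by (intro mult_right_mono) auto
      thus ?thesis by (simp add: power2_eq_square power4_eq_xxxx)
    qed
    ultimately have "x\<^sup>2 \<le> 1 / 1000 * exp (1467 / 10000 * x)" using exp_gt_zero[of "1467 / 10000 * x"] by linarith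
    hence "31 / 100 * x\<^sup>2 * x ^ 8 \<le> 31 / 100 * (1 / 1000 * exp (1467 / 10000 * x)) * (101 * exp (2934 / 10000 * x))"
      using x8 by (intro mult_mono mult_left_mono) auto
    also have "\<dots> \<le> 9 / 10 * exp (4401 / 10000 * x)" by (simp flip: exp_add)
    finally have "31 / 100 * x\<^sup>2 * x ^ 8 * exp (5516 / 10000 * x) \<le> 9 / 10 * exp (4401 / 10000 * x) * exp (5516 / 10000 * x)"
      by (rule mult_right_mono) simp
    also have "\<dots> = 9 / 10 * exp (9917 / 10000 * x)" by (simp flip: exp_add)
    also have "\<dots> \<le> 9 / 10 * exp x" using x by simp
    finally have "31 / 100 * x\<^sup>2 * exp (5516 / 10000 * x) * x ^ 8 \<le> 9 / 10 * exp x" by (simp only: mult_ac)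
    hence "31 / 100 * x\<^sup>2 * exp (5516 / 10000 * x) \<le> 9 / 10 * exp x / x ^ 8"
      using x by (intro mult_imp_le_div_pos) auto
    thus ?thesis by simp
  qed
  also have "\<dots> \<le> 1 / x ^ 6 * partition_main x"
  proof -
    have s: "sqrt 3 \<le> (17321 / 10000)" by (rule real_le_lsqrt) (auto simp: power2_eq_square)
    have "(9869 / 1000) / (6 * (17321 / 10000)) \<le> pi\<^sup>2 / (6 * sqrt 3)" using s pi2 by (intro frac_le) auto
    moreover have "98 / 100 \<le> 1 - 1 / x" using x by (simp add: field_simps)
    ultimately have "(9869 / 1000) / (6 * (17321 / 10000)) * (98 / 100) \<le> pi\<^sup>2 / (6 * sqrt 3) * (1 - 1 / x)"
      by (intro mult_mono) auto
    moreover have "9 / 10 \<le> (9869 / 1000) / (6 * (17321 / 10000)) * (98 / 100 :: real)" by simp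
    ultimately have "9 / 10 \<le> pi\<^sup>2 / (6 * sqrt 3) * (1 - 1 / x)" by (rule order.trans[rotated])
    hence "9 / 10 * (exp x / x ^ 8) \<le> pi\<^sup>2 / (6 * sqrt 3) * (1 - 1 / x) * (exp x / x ^ 8)"
      using x by (intro mult_right_mono) auto
    also have "\<dots> = 1 / x ^ 6 * partition_main x"
      unfolding partition_main_def using x by (simp add: field_simps eval_nat_numeral)
    finally show ?thesis .
  qed
  finally show ?thesis by (simp add: x_def)
qed

text \<open>The relative error 14 is 13 from the partition function plus 1 from the crank
  parity.\<close>

lemma M_asymptotic:
  assumes "k = 0 \<or> k = 1" "\<mu> n \<ge> 114.9"
  shows "\<bar>real (M k n) - partition_main (\<mu> n) / 2\<bar> \<le> 14 / \<mu> n ^ 6 * (partition_main (\<mu> n) / 2)"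
  using partition_asymptotic[OF assms(2)] crank_parity_small[OF assms(2)] M_eq_card_crank_parity[of n] assms(1)
  by (auto simp: abs_le_iff)

text \<open>To first order the four factors give 1 + 4e and 1 - 4e. The bound on \<open>e\<close>
  pushes the quadratic remainder of the upper estimate below e/1000; in the lower one it has the
  right sign.\<close>

lemma relative_error_product:
  fixes a0 a1 a2 f0 f1 f2 e :: real
  assumes f: "f0 > 0" "f1 > 0" "f2 > 0" and e: "0 \<le> e" "e \<le> 1 / 1000000"
    and a: "\<bar>a0 - f0\<bar> \<le> e * f0" "\<bar>a1 - f1\<bar> \<le> e * f1" "\<bar>a2 - f2\<bar> \<le> e * f2"
  shows "a1 * a2 / a0\<^sup>2 \<le> f1 * f2 / f0\<^sup>2 * (1 + 4001 / 1000 * e)"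
    and "a1 * a2 / a0\<^sup>2 \<ge> f1 * f2 / f0\<^sup>2 * (1 - 4 * e)"
proof -
  have bounds: "(1 - e) * f0 \<le> a0" "a0 \<le> (1 + e) * f0" "(1 - e) * f1 \<le> a1" "a1 \<le> (1 + e) * f1"
    "(1 - e) * f2 \<le> a2" "a2 \<le> (1 + e) * f2"
    using a by (auto simp: abs_le_iff algebra_simps)
  have e1: "1 - e > 0" "1 + e > 0" using e by auto
  have pos: "(1 - e) * f0 > 0" "(1 - e) * f1 > 0" "(1 - e) * f2 > 0" using e1 f by auto
  have a0: "a0 > 0" "a1 > 0" "a2 > 0" using pos bounds by linarith+
  define F where "F = f1 * f2 / f0\<^sup>2"
  have F: "F > 0" using f by (simp add: F_def)
  have ee: "e * e \<le> e / 1000000" "e * e \<ge> 0"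
  proof -
    have "e * e \<le> e * (1 / 1000000)" using e by (intro mult_left_mono) auto
    thus "e * e \<le> e / 1000000" by simp
  qed simp
  have nn: "0 \<le> (1 + e) * f1" "0 \<le> (1 + e) * f2" using a0 bounds by linarith+
  have up: "a1 * a2 \<le> ((1 + e) * f1) * ((1 + e) * f2)"
    by (rule mult_mono[OF bounds(4,6) nn(1) less_imp_le[OF a0(3)]])
  have lo: "((1 - e) * f1) * ((1 - e) * f2) \<le> a1 * a2"
    by (rule mult_mono[OF bounds(3,5) less_imp_le[OF a0(2)] less_imp_le[OF pos(3)]])
  have sq: "((1 - e) * f0)\<^sup>2 \<le> a0\<^sup>2" "a0\<^sup>2 \<le> ((1 + e) * f0)\<^sup>2"
    by (rule power_mono[OF bounds(1) less_imp_le[OF pos(1)]], rule power_mono[OF bounds(2) less_imp_le[OF a0(1)]])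
  have "a1 * a2 / a0\<^sup>2 \<le> ((1 + e) * f1) * ((1 + e) * f2) / ((1 - e) * f0)\<^sup>2"
    by (rule frac_le[OF mult_nonneg_nonneg[OF nn] up zero_less_power[OF pos(1)] sq(1)])
  also have "\<dots> = F * ((1 + e)\<^sup>2 / (1 - e)\<^sup>2)"
    by (simp add: F_def power2_eq_square mult_ac)
  also have "\<dots> \<le> F * (1 + 4001 / 1000 * e)"
  proof (rule mult_left_mono)
    have "(1 + e)\<^sup>2 \<le> (1 + 4001 / 1000 * e) * (1 - 2 * e)"
    proof -
      have "(1 + 4001 / 1000 * e) * (1 - 2 * e) = 1 + 2001 / 1000 * e - 8002 / 1000 * (e * e)" by (simp add: field_simps)
      moreover have "(1 + e)\<^sup>2 = 1 + 2 * e + e * e" by (simp add: power2_eq_square algebra_simps)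
      ultimately show ?thesis using ee e by linarith
    qed
    also have "\<dots> \<le> (1 + 4001 / 1000 * e) * (1 - e)\<^sup>2"
      using e by (intro mult_left_mono) (auto simp: power2_eq_square algebra_simps)
    finally show "(1 + e)\<^sup>2 / (1 - e)\<^sup>2 \<le> 1 + 4001 / 1000 * e" using e1 by (simp add: pos_divide_le_eq)
  qed (use F in auto)
  finally show "a1 * a2 / a0\<^sup>2 \<le> f1 * f2 / f0\<^sup>2 * (1 + 4001 / 1000 * e)" by (simp add: F_def)
  have "F * (1 - 4 * e) \<le> F * ((1 - e)\<^sup>2 / (1 + e)\<^sup>2)"
  proof (rule mult_left_mono)
    have "(1 - 4 * e) * (1 + e)\<^sup>2 = 1 - 2 * e - 7 * (e * e) - 4 * e * (e * e)" by (simp add: power2_eq_square algebra_simps)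
    also have "\<dots> \<le> 1 - 2 * e + e * e" using ee e mult_nonneg_nonneg[OF e(1) ee(2)] by linarith
    also have "\<dots> = (1 - e)\<^sup>2" by (simp add: power2_eq_square algebra_simps)
    finally show "1 - 4 * e \<le> (1 - e)\<^sup>2 / (1 + e)\<^sup>2" using e1 by (simp add: pos_le_divide_eq)
  qed (use F in auto)
  also have "\<dots> = ((1 - e) * f1) * ((1 - e) * f2) / ((1 + e) * f0)\<^sup>2"
    by (simp add: F_def power2_eq_square mult_ac)
  also have "\<dots> \<le> a1 * a2 / a0\<^sup>2"
    by (rule frac_le[OF mult_nonneg_nonneg[OF less_imp_le[OF a0(2)] less_imp_le[OF a0(3)]] lo zero_less_power[OF a0(1)] sq(2)])
  finally show "a1 * a2 / a0\<^sup>2 \<ge> f1 * f2 / f0\<^sup>2 * (1 - 4 * e)" by (simp add: F_def)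
qed

theorem theorem1p5:
  fixes k n :: nat
  assumes "k = 0 \<or> k = 1" and "n \<ge> 1" and "\<mu> n \<ge> 115"
  shows "Y k n < 1 - pi ^ 4 / (9 * \<mu> n ^ 3) + 4 * pi ^ 4 / (9 * \<mu> n ^ 4)
                   - pi ^ 4 / (3 * \<mu> n ^ 5) + (pi ^ 8 / 81 + 5) / \<mu> n ^ 6 \<and>
         Y k n > 1 - pi ^ 4 / (9 * \<mu> n ^ 3) + 4 * pi ^ 4 / (9 * \<mu> n ^ 4)
                   - pi ^ 4 / (3 * \<mu> n ^ 5) - 60 / \<mu> n ^ 6"
proof -
  define x xm xp where "x = \<mu> n" and "xm = \<mu> (n - 1)" and "xp = \<mu> (n + 1)"
  \<comment> \<open>The square of \<mu> is linear in n, with this slope.\<close>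
  define h where "h = 2 * pi\<^sup>2 / 3"
  define c where "c = h\<^sup>2"
  define v where "v = 1 / x"
  have x: "x \<ge> 115" "x > 0" using assms(3) by (auto simp: x_def)
  note pi = pi_bounds(1,2) and pi2 = pi_bounds(3,4)
  have pi4: "pi ^ 4 > (9739 / 100)" "pi ^ 4 < (97412 / 1000)"
  proof -
    have "(pi\<^sup>2)\<^sup>2 > (9869 / 1000)\<^sup>2" using pi2 by (intro power_strict_mono) auto
    thus "pi ^ 4 > (9739 / 100)" by (simp add: power2_eq_square power4_eq_xxxx mult.assoc)
    have "(pi\<^sup>2)\<^sup>2 < (98697 / 10000)\<^sup>2" using pi2 by (intro power_strict_mono) auto
    thus "pi ^ 4 < (97412 / 1000)" by (simp add: power2_eq_square power4_eq_xxxx mult.assoc)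
  qed
  have c_pi: "c = 4 / 9 * pi ^ 4" by (simp add: c_def h_def power_mult_distrib power_divide flip: power_mult)
  have c: "(4328 / 100) \<le> c" "c \<le> 43.3" using pi4 by (simp_all add: c_pi)
  have h: "h \<le> (658 / 100)" using pi2 by (simp add: h_def)
  have x2: "x\<^sup>2 = pi\<^sup>2 * (24 * real n - 1) / 36" unfolding x_def using mu_sq[OF assms(2)] by simp
  have x2_ge: "x\<^sup>2 \<ge> 13225"
  proof -
    have "x\<^sup>2 \<ge> 115\<^sup>2" using x by (intro power_mono) auto
    thus ?thesis by simp
  qed
  have n2: "n \<ge> 2"
  proof (rule ccontr)
    assume "\<not> n \<ge> 2"
    hence "n = 1" using assms(2) by simp
    hence "x\<^sup>2 \<le> 10" using x2 pi2 by simp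
    thus False using x2_ge by simp
  qed
  have n1: "n - 1 \<ge> 1" "real (n - 1) = real n - 1" using n2 by (simp_all add: of_nat_diff)
  have xm_sq: "xm\<^sup>2 = x\<^sup>2 - h"
    unfolding xm_def x2 h_def mu_sq(1)[OF n1(1)] n1(2) by (simp add: field_simps)
  have xm0: "xm > 0" unfolding xm_def by (rule mu_sq(2)[OF n1(1)])
  have xp_sq: "xp\<^sup>2 = x\<^sup>2 + h" and xp0: "xp > 0"
    unfolding xp_def x2 h_def using mu_sq[of "n + 1"] by (simp_all add: field_simps)
  have h0: "h > 0" by (simp add: h_def)
  \<comment> \<open>115^2 - h is still above 114.9^2, which is where the range of the asymptotic
    lemmas comes from.\<close>
  have xm_ge: "xm \<ge> 114.9"
  proof (rule power2_le_imp_le)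
    show "114.9\<^sup>2 \<le> xm\<^sup>2" unfolding xm_sq using x2_ge h by (simp add: power2_eq_square)
  qed (use xm0 in auto)
  have xp_ge: "xp \<ge> x"
  proof (rule power2_le_imp_le)
    show "x\<^sup>2 \<le> xp\<^sup>2" unfolding xp_sq using h0 by simp
  qed (use xp0 in auto)
  \<comment> \<open>14 enlarged to 14.03, to serve all three arguments at once: at n - 1 the square
    of \<mu> is at least 0.9995 x^2, and 14 / 0.9995^3 < 14.03.\<close>
  define e where "e = (1403 / 100) / x ^ 6"
  have x6: "x ^ 6 > 0" using x by simp
  have e0: "0 \<le> e" "e \<le> 1 / 1000000"
  proof -
    show "0 \<le> e" using x by (simp add: e_def)
    have "x ^ 6 \<ge> 115 ^ 6" using x by (intro power_mono) auto
    hence "e \<le> (1403 / 100) / 115 ^ 6" unfolding e_def by (intro divide_left_mono) auto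
    thus "e \<le> 1 / 1000000" by simp
  qed
  have err: "14 / y ^ 6 \<le> e" if "y\<^sup>2 \<ge> x\<^sup>2 - h" "y > 0" for y
  proof -
    have "9995 / 10000 * x\<^sup>2 \<le> y\<^sup>2"
    proof -
      have "h \<le> 5 / 10000 * x\<^sup>2" using h x2_ge by simp
      thus ?thesis using that by simp
    qed
    hence "(9995 / 10000 * x\<^sup>2) ^ 3 \<le> (y\<^sup>2) ^ 3" by (intro power_mono) auto
    moreover have "(9995 / 10000 * x\<^sup>2) ^ 3 = (9995 / 10000) ^ 3 * x ^ 6"
      unfolding power_mult_distrib power_mult[symmetric] by simp
    moreover have "(y\<^sup>2) ^ 3 = y ^ 6" by (simp flip: power_mult)
    ultimately have "(9995 / 10000) ^ 3 * x ^ 6 \<le> y ^ 6" by (simp only:)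
    moreover have "14 / (1403 / 100) * x ^ 6 \<le> (9995 / 10000) ^ 3 * x ^ 6" using x by (intro mult_right_mono) (auto simp: power_divide)
    ultimately have "14 / (1403 / 100) * x ^ 6 \<le> y ^ 6" by linarith
    thus ?thesis using x that by (simp add: e_def field_simps)
  qed
  have asy: "\<bar>real (M k m) - partition_main (\<mu> m) / 2\<bar> \<le> e * (partition_main (\<mu> m) / 2)"
    if "\<mu> m \<ge> 114.9" "(\<mu> m)\<^sup>2 \<ge> x\<^sup>2 - h" for m
  proof -
    have "14 / \<mu> m ^ 6 * (partition_main (\<mu> m) / 2) \<le> e * (partition_main (\<mu> m) / 2)"
      using that partition_main_pos[of "\<mu> m"] by (intro mult_right_mono err) auto
    thus ?thesis using M_asymptotic[OF assms(1) that(1)] by linarith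
  qed
  define f where "f = (\<lambda>y. partition_main y / 2)"
  have f0: "f x > 0" "f xm > 0" "f xp > 0" using x xm_ge xp_ge by (auto simp: f_def intro!: partition_main_pos)
  have a0: "\<bar>real (M k n) - f x\<bar> \<le> e * f x"
    unfolding f_def x_def using x h0 by (intro asy) (auto simp: x_def)
  have am: "\<bar>real (M k (n - 1)) - f xm\<bar> \<le> e * f xm"
    unfolding f_def xm_def using xm_ge xm_sq by (intro asy) (auto simp: xm_def)
  have ap: "\<bar>real (M k (n + 1)) - f xp\<bar> \<le> e * f xp"
    unfolding f_def xp_def using xp_ge x xp_sq h0 by (intro asy) (auto simp: xp_def)
  define B where "B = (xm - 1) * (xp - 1) / (x - 1)\<^sup>2 * (x\<^sup>2 / (xm * xp)) ^ 3 * exp (xm + xp - 2 * x)"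
  have fB: "f xm * f xp / (f x)\<^sup>2 = B"
  proof -
    define C where "C = pi\<^sup>2 / (6 * sqrt 3) / 2"
    have C: "C \<noteq> 0" by (simp add: C_def)
    have f_eq: "f y = C * (exp y * ((y - 1) / y ^ 3))" if "y > 0" for y
      using that by (simp add: f_def partition_main_def C_def field_simps eval_nat_numeral)
    have "exp (xm + xp - 2 * x) = exp xm * exp xp / (exp x)\<^sup>2"
      by (simp add: exp_diff exp_add exp_double)
    moreover have "(x\<^sup>2 / (xm * xp)) ^ 3 = (x ^ 3)\<^sup>2 / (xm ^ 3 * xp ^ 3)"
      by (simp add: power_divide power_mult_distrib flip: power_mult)
    ultimately show ?thesis
      unfolding B_def f_eq[OF x(2)] f_eq[OF xm0] f_eq[OF xp0] using C x xm0 xp0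
      by (simp add: power_mult_distrib power_divide power2_eq_square mult_ac)
  qed
  have Y_le: "Y k n \<le> B * (1 + 4001 / 1000 * e)" and Y_ge: "Y k n \<ge> B * (1 - 4 * e)"
    using relative_error_product[OF f0 e0 a0 am ap] unfolding fB Y_def by auto
  define L where "L = 1 - c / 4 * v ^ 3 + c * v ^ 4 - 3 / 4 * c * v ^ 5"
  have B_le: "B \<le> L + 60 * v ^ 6" and B_ge: "B \<ge> L - (38 / 10) * v ^ 6"
    unfolding B_def L_def c_def v_def
    using main_ratio_bounds[of x h xm xp] x c xm0 xp0 xm_sq xp_sq by (auto simp: c_def)
  have v: "v > 0" "v \<le> 1 / 115" using x by (auto simp: v_def field_simps)
  have v6: "v ^ 6 > 0" using v by simp
  have e_v: "e = (1403 / 100) * v ^ 6" by (simp add: e_def v_def power_divide)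
  have L1: "L \<le> 1 - c / 8 * v ^ 3"
  proof -
    have "c * v ^ 3 * v \<le> c * v ^ 3 * (1 / 115)" using c v by (intro mult_left_mono) auto
    moreover have "c * v ^ 3 \<ge> 0" "c * v ^ 5 \<ge> 0" using c v by auto
    moreover have "c * v ^ 4 = c * v ^ 3 * v" by (simp add: eval_nat_numeral)
    ultimately show ?thesis unfolding L_def by linarith
  qed
  \<comment> \<open>This allows the relative error of \<open>Y k n\<close> to be used as an absolute
    one.\<close>
  have B1: "B \<le> 1"
  proof -
    have "v ^ 3 * v ^ 3 \<le> v ^ 3 * (1 / 115) ^ 3" using v by (intro mult_left_mono power_mono) auto
    hence "v ^ 6 * 1520875 \<le> v ^ 3" by (simp add: power_divide flip: power_add)
    hence "60 * v ^ 6 \<le> v ^ 3" using v6 by linarith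
    moreover have "(4328 / 100) * v ^ 3 \<le> c * v ^ 3" using c v by (intro mult_right_mono) auto
    moreover have "v ^ 3 \<ge> 0" using v by simp
    ultimately show ?thesis using B_le L1 by linarith
  qed
  have B0: "B > 0" using f0 unfolding fB[symmetric] by simp
  have "Y k n \<le> L + 60 * v ^ 6 + 4001 / 1000 * e"
  proof -
    have "B * (4001 / 1000 * e) \<le> 1 * (4001 / 1000 * e)" using B1 e0 by (intro mult_right_mono) auto
    thus ?thesis using Y_le B_le by (simp add: algebra_simps)
  qed
  \<comment> \<open>60 + 4.001 * 14.03 is below 117, which in turn is below pi^8/81 + 5.\<close>
  also have "\<dots> < L + (pi ^ 8 / 81 + 5) * v ^ 6"
  proof -
    have "pi ^ 8 = (pi ^ 4)\<^sup>2" by (simp flip: power_mult)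
    moreover have "(pi ^ 4)\<^sup>2 \<ge> (9739 / 100)\<^sup>2" using pi4 by (intro power_mono) auto
    ultimately have "117 \<le> pi ^ 8 / 81 + 5" by (simp add: power2_eq_square)
    hence "117 * v ^ 6 \<le> (pi ^ 8 / 81 + 5) * v ^ 6" using v6 by (intro mult_right_mono) auto
    thus ?thesis using v6 unfolding e_v by simp
  qed
  finally have upper: "Y k n < L + (pi ^ 8 / 81 + 5) * v ^ 6" .
  \<comment> \<open>The budget is nearly exhausted: 3.8 + 4 * 14.03 = 59.92. This determines the
    constant 38/10 in \<open>main_ratio_bounds\<close>.\<close>
  have lower: "Y k n > L - 60 * v ^ 6"
  proof -
    have "B * (4 * e) \<le> 1 * (4 * e)" using B1 e0 by (intro mult_right_mono) auto
    hence "Y k n \<ge> L - (38 / 10) * v ^ 6 - 4 * e" using Y_ge B_ge by (simp add: algebra_simps)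
    thus ?thesis using v6 unfolding e_v by linarith
  qed
  have L: "L = 1 - pi ^ 4 / (9 * x ^ 3) + 4 * pi ^ 4 / (9 * x ^ 4) - pi ^ 4 / (3 * x ^ 5)"
    by (simp add: L_def c_pi v_def power_divide)
  have "(pi ^ 8 / 81 + 5) * v ^ 6 = (pi ^ 8 / 81 + 5) / x ^ 6" "60 * v ^ 6 = 60 / x ^ 6"
    by (simp_all add: v_def power_divide)
  with upper lower show ?thesis unfolding L x_def by simp
qed

end
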